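(* Let $\alpha>-1$ and let $\mu$ be a complex Borel measure on $\mathbb{D}$ satisfying $$\int_{\mathbb{D}}(1-|w|^2)^{\alpha+1}\,d|\mu|(w)<\infty.$$ Then the Green potential $$G_\alpha^\mu(z)=\int_{\mathbb{D}}G_\alpha(z,w)\,d\mu(w)$$ is the unique solution (functions in $L^1_{loc}(\mathbb{D})$ being identified when equal almost everywhere) to Poisson's equation for $L_\alpha$: (1) $L_\alpha G_\alpha^\mu=\mu$ in the sense of distributions on $\mathbb{D}$; and (2) $G_\alpha^\mu(re^{i\cdot})\to0$ in $L^1(\mathbb{T})$ when $r\nearrow1$, i.e. $\int_0^{2\pi}|G_\alpha^\mu(re^{i\theta})|\,\frac{d\theta}{2\pi}\to0$ as $r\nearrow1$. Uniqueness means: if $u\in L^1_{loc}(\mathbb{D})$ satisfies $L_\alpha u=\mu$ in the sense of distributions on $\mathbb{D}$ and $u(re^{i\cdot})\to0$ in $L^1(\mathbb{T})$ when $r\nearrow1$, then $u=G_\alpha^\mu$ almost everywhere.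
   Context: $\mathbb{D}$ is the open unit disc in $\mathbb{C}$ and $\mathbb{T}$ the unit circle. $\partial_z=\frac12(\partial_x-i\partial_y)$ and $\overline{\partial}_z=\frac12(\partial_x+i\partial_y)$, $z=x+iy$. The area measure is normalized as $dA=\frac1\pi\,dx\,dy$. A function $u\in L^1_{loc}(\mathbb{D})$ is identified with the distribution $\langle u,\phi\rangle=\int_{\mathbb{D}}u\,\phi\,dA$, and $\mu$ with the distribution $\langle\mu,\phi\rangle=\int_{\mathbb{D}}\phi\,d\mu$, $\phi\in C_0^\infty(\mathbb{D})$ (complex-valued test functions). The operator $L_\alpha=-\overline{\partial}_z(1-|z|^2)^{-\alpha}\partial_z$ acts on distributions on $\mathbb{D}$ by $\langle L_\alpha u,\phi\rangle=\langle u,\overline{L_\alpha}\phi\rangle$, where $\overline{L_\alpha}=-\partial_z(1-|z|^2)^{-\alpha}\overline{\partial}_z$. "Complex Borel measure" allows infinite total variation on $\mathbb{D}$: $d\mu=\sigma\,d|\mu|$ with $|\mu|$ a positive Borel measure on $\mathbb{D}$ and $\sigma$ a Borel function with $|\sigma|=1$; the integrability condition makes $|\mu|$ locally finite, so $\mu$ is a Radon measure and defines a distribution. $G_\alpha$ is the Green's function for $L_\alpha$ in $\mathbb{D}$, given for $z\neq w$ by $G_\alpha(z,w)=(1-\overline{z}w)^\alpha h(g(z,w))$, with the principal branch of the power (real positive on the positive reals, defined for $\operatorname{Re}>0$), $h(s)=\int_0^s\frac{t^\alpha}{1-t}\,dt$ for $0\le s<1$, and $g(z,w)=\frac{(1-|z|^2)(1-|w|^2)}{|1-z\overline{w}|^2}$.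 The potential $G_\alpha^\mu$ is understood as defined wherever the integral converges absolutely. *)

theory Defs
  imports "HOL-Analysis.Analysis"
begin

abbreviation unit_disc :: "complex set"
  where "unit_disc \<equiv> ball 0 1"

definition deriv_x :: "(complex \<Rightarrow> complex) \<Rightarrow> complex \<Rightarrow> complex"
  where "deriv_x f z = frechet_derivative f (at z) 1"

definition deriv_y :: "(complex \<Rightarrow> complex) \<Rightarrow> complex \<Rightarrow> complex"
  where "deriv_y f z = frechet_derivative f (at z) \<i>"

definition wirtinger :: "(complex \<Rightarrow> complex) \<Rightarrow> complex \<Rightarrow> complex"
  where "wirtinger f z = (deriv_x f z - \<i> * deriv_y f z) / 2"

definition wirtinger_bar :: "(complex \<Rightarrow> complex) \<Rightarrow> complex \<Rightarrow> complex"
  where "wirtinger_bar f z = (deriv_x f z + \<i> * deriv_y f z) / 2"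

text \<open>Differentiability below is real (Frechet) differentiability of a function of two real
  variables; no holomorphy is involved.\<close>

primrec times_cont_diff :: "nat \<Rightarrow> (complex \<Rightarrow> complex) \<Rightarrow> bool"
  where
    "times_cont_diff 0 f \<longleftrightarrow> continuous_on UNIV f"
  | "times_cont_diff (Suc k) f \<longleftrightarrow>
      (\<forall>z. f differentiable (at z)) \<and> times_cont_diff k (deriv_x f) \<and> times_cont_diff k (deriv_y f)"

text \<open>Test functions on the disc are total functions on the plane, extended by zero. A closed subset
  of the plane that lies inside the open disc is compact.\<close>

definition test_function :: "(complex \<Rightarrow> complex) \<Rightarrow> bool"
  where "test_function \<phi> \<longleftrightarrow>
    (\<forall>k. times_cont_diff k \<phi>) \<and> closure {z. \<phi> z \<noteq> 0} \<subseteq> unit_disc"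

definition L1_loc_disc :: "(complex \<Rightarrow> complex) \<Rightarrow> bool"
  where "L1_loc_disc u \<longleftrightarrow> (\<forall>K. compact K \<and> K \<subseteq> unit_disc \<longrightarrow> u absolutely_integrable_on K)"

text \<open>A distribution is represented by its action on test functions; two distributions are
  compared on test functions only. The factor \<open>1 / pi\<close> normalizes the area measure.\<close>

type_synonym functional = "(complex \<Rightarrow> complex) \<Rightarrow> complex"

definition distr_eq :: "functional \<Rightarrow> functional \<Rightarrow> bool"
  where "distr_eq S T \<longleftrightarrow> (\<forall>\<phi>. test_function \<phi> \<longrightarrow> S \<phi> = T \<phi>)"

definition distr_of_fun :: "(complex \<Rightarrow> complex) \<Rightarrow> functional"
  where "distr_of_fun u \<phi> = of_real (1 / pi) * (LINT z:unit_disc|lebesgue. u z * \<phi> z)"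

definition L_bar :: "real \<Rightarrow> (complex \<Rightarrow> complex) \<Rightarrow> complex \<Rightarrow> complex"
  where "L_bar \<alpha> \<phi> z =
    - wirtinger (\<lambda>w. of_real ((1 - (norm w)\<^sup>2) powr (- \<alpha>)) * wirtinger_bar \<phi> w) z"

definition L_distr :: "real \<Rightarrow> functional \<Rightarrow> functional"
  where "L_distr \<alpha> T \<phi> = T (L_bar \<alpha> \<phi>)"

text \<open>A complex Borel measure on the disc, possibly of infinite total variation, is given by its
  total variation \<open>M\<close> and its polar density \<open>\<sigma>\<close>, that is, it is \<open>\<sigma> dM\<close>.\<close>

definition complex_borel_measure :: "complex measure \<Rightarrow> (complex \<Rightarrow> complex) \<Rightarrow> bool"
  where "complex_borel_measure M \<sigma> \<longleftrightarrow>
    sets M = sets (restrict_space borel unit_disc) \<and>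
    \<sigma> \<in> borel_measurable M \<and> (\<forall>w\<in>unit_disc. norm (\<sigma> w) = 1)"

definition cm_integral ::
    "complex measure \<Rightarrow> (complex \<Rightarrow> complex) \<Rightarrow> (complex \<Rightarrow> complex) \<Rightarrow> complex"
  where "cm_integral M \<sigma> f = (LINT w|M. f w * \<sigma> w)"

text \<open>The distribution defined by the measure is \<open>cm_integral M \<sigma>\<close> itself.\<close>

definition green_h :: "real \<Rightarrow> real \<Rightarrow> real"
  where "green_h \<alpha> s = (LINT t:{0..s}|lborel. t powr \<alpha> / (1 - t))"

definition green_g :: "complex \<Rightarrow> complex \<Rightarrow> real"
  where "green_g z w = (1 - (norm z)\<^sup>2) * (1 - (norm w)\<^sup>2) / (norm (1 - z * cnj w))\<^sup>2"

definition green_function :: "real \<Rightarrow> complex \<Rightarrow> complex \<Rightarrow> complex"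
  where "green_function \<alpha> z w =
    (1 - cnj z * w) powr (of_real \<alpha>) * of_real (green_h \<alpha> (green_g z w))"

text \<open>On the diagonal \<open>green_g z z = 1\<close> and the integral \<open>green_h \<alpha> 1\<close> diverges, so that the
  modulus of the Green's function is infinite there; as the Bochner integral assigns \<open>green_h \<alpha> 1\<close>
  a default value, the absence of an atom at \<open>z\<close> has to be demanded separately.\<close>

definition green_potential_converges :: "real \<Rightarrow> complex measure \<Rightarrow> complex \<Rightarrow> bool"
  where "green_potential_converges \<alpha> M z \<longleftrightarrow>
    emeasure M {z} = 0 \<and> integrable M (green_function \<alpha> z)"

text \<open>The value \<open>0\<close> outside the domain of convergence is a dummy.\<close>

definition green_potential ::
    "real \<Rightarrow> complex measure \<Rightarrow> (complex \<Rightarrow> complex) \<Rightarrow> complex \<Rightarrow> complex"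
  where "green_potential \<alpha> M \<sigma> z =
    (if green_potential_converges \<alpha> M z then cm_integral M \<sigma> (green_function \<alpha> z) else 0)"

text \<open>Integrability on the circles near the boundary is part of the notion, since a
  non-integrable function has Bochner integral \<open>0\<close>.\<close>

definition vanishes_at_circle_L1 :: "(complex \<Rightarrow> complex) \<Rightarrow> bool"
  where "vanishes_at_circle_L1 u \<longleftrightarrow>
    (\<forall>\<^sub>F r in at_left 1. (\<lambda>\<theta>. u (of_real r * cis \<theta>)) absolutely_integrable_on {0..2 * pi}) \<and>
    ((\<lambda>r. (LINT \<theta>:{0..2 * pi}|lebesgue. norm (u (of_real r * cis \<theta>))) / (2 * pi)) \<longlongrightarrow> 0)
      (at_left 1)"

definition solves_poisson ::
    "real \<Rightarrow> complex measure \<Rightarrow> (complex \<Rightarrow> complex) \<Rightarrow> (complex \<Rightarrow> complex) \<Rightarrow> bool"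
  where "solves_poisson \<alpha> M \<sigma> u \<longleftrightarrow>
    L1_loc_disc u \<and>
    distr_eq (L_distr \<alpha> (distr_of_fun u)) (cm_integral M \<sigma>) \<and>
    vanishes_at_circle_L1 u"

end

theory Submission
  imports Defs "HOL-Real_Asymp.Real_Asymp"
begin

text \<open>The derivative of the Green's function satisfies
  \<open>(1 - |z|^2)^(-\<alpha>) d/dz G(z,w) = - (1 - |w|^2)^(\<alpha>+1) (1 - z cnj w)^(-\<alpha>-1) / (z - w)\<close>, a holomorphic
  multiple of the Cauchy kernel, so that the Cauchy--Pompeiu formula gives \<open>L G(., w) = \<delta>_w\<close>.
  Since \<open>h(s) \<le> C s^(\<alpha>+1) (1 - s)^(-1/4)\<close>, the Green's function is dominated by
  \<open>C (1 - |z|^2)^(\<alpha>+1) (1 - |w|^2)^(\<alpha>+1) |1 - z cnj w|^(-\<alpha>-3/2) |z - w|^(-1/2)\<close>. The integral of this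
  majorant over compact sets or circles is at most a constant times \<open>(1 - |w|^2)^(\<alpha>+1)\<close>, and on the
  circle of radius \<open>r\<close> it tends to \<open>0\<close> as \<open>r\<close> tends to \<open>1\<close>; Fubini's theorem and dominated convergence
  then give the existence part.

  For uniqueness let \<open>v\<close> be the difference of two solutions. It is tested against
  \<open>\<phi> = (1 - |z|^2)^(\<alpha>+1) z^a cnj z^b\<close>, cut off at distance \<open>\<epsilon>\<close> from the circle. Without the cutoff
  \<open>L_bar \<phi> = (\<alpha> + 1 + b) (a + 1) z^a cnj z^b - a b z^(a-1) cnj z^(b-1)\<close>, while the error made by the
  cutoff is \<open>O(1/\<epsilon>)\<close> on an annulus of area \<open>O(\<epsilon>)\<close>, where the circle means of \<open>|v|\<close> are small. Hence
  all moments of \<open>v\<close> vanish by induction, and \<open>v = 0\<close> by the Stone--Weierstrass theorem.\<close>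

section \<open>Integration in the complex plane\<close>

text \<open>Near the diagonal h(g(z,w)) has a logarithmic singularity. Its replacement (1 -
  s)^(-1/4) stands for any such power with exponent between 0 and 1/2: it turns into |z - w|^(-1/2),
  which stays integrable on circles uniformly in w, while s^(\<alpha>+1) preserves exactly the
  weight of the hypothesis. The potential is defined only almost everywhere, and a circle is a null
  set of the plane. Hence convergence is proved separately for area and for circles, both times from
  a finite integral of a majorant that is infinite on the diagonal. For uniqueness nothing is known
  about v near the circle except its means. The power \<alpha>+1 makes the cutoff affordable: the
  weight in \<open>L_bar\<close> removes \<alpha> factors 1 - |z|^2, and the one that is left, being
  O(\<epsilon>) where the cutoff varies, compensates one of the two factors 1/\<epsilon> of its
  second derivative. The means of |v| then only have to tend to 0, at no prescribed rate.\<close>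

lemma Complex_borel_measurable [measurable (raw)]:
  assumes [measurable]: "f \<in> borel_measurable M" "g \<in> borel_measurable M"
  shows "(\<lambda>x. Complex (f x) (g x)) \<in> borel_measurable M"
  unfolding Complex_eq by measurable

text \<open>Lebesgue measure is determined by its values on boxes, and boxes are products of
  intervals in x and y. Fubini's theorem in these coordinates rests on this identity.\<close>

lemma lborel_complex:
  "(lborel :: complex measure) = distr (lborel \<Otimes>\<^sub>M lborel) borel (\<lambda>(x, y). Complex x y)"
proof (rule lborel_eqI)
  fix l u :: complex
  assume le: "\<And>b. b \<in> Basis \<Longrightarrow> l \<bullet> b \<le> u \<bullet> b"
  have [measurable]: "(\<lambda>(x, y). Complex x y) \<in> lborel \<Otimes>\<^sub>M lborel \<rightarrow>\<^sub>M borel"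
    by simp
  have *: "Re l \<le> Re u" "Im l \<le> Im u"
    using le[of 1] le[of \<i>] by (auto simp: Basis_complex_def inner_complex_def)
  have "(\<lambda>(x, y). Complex x y) -` box l u = {Re l <..< Re u} \<times> {Im l <..< Im u}"
    by (auto simp: box_def Basis_complex_def inner_complex_def)
  then have "emeasure (distr (lborel \<Otimes>\<^sub>M lborel) borel (\<lambda>(x, y). Complex x y)) (box l u)
      = ennreal (Re u - Re l) * ennreal (Im u - Im l)"
    using * by (simp add: emeasure_distr space_pair_measure lborel.emeasure_pair_measure_Times)
  then show "emeasure (distr (lborel \<Otimes>\<^sub>M lborel) borel (\<lambda>(x, y). Complex x y)) (box l u)
      = (\<Prod>b\<in>Basis. (u - l) \<bullet> b)"
    using * by (simp add: Basis_complex_def inner_complex_def ennreal_mult[symmetric])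
qed simp

lemma nn_integral_complex:
  assumes [measurable]: "f \<in> borel_measurable borel"
  shows "(\<integral>\<^sup>+ z. f z \<partial>(lborel :: complex measure)) = (\<integral>\<^sup>+ x. \<integral>\<^sup>+ y. f (Complex x y) \<partial>lborel \<partial>lborel)"
    and "(\<integral>\<^sup>+ z. f z \<partial>(lborel :: complex measure)) = (\<integral>\<^sup>+ y. \<integral>\<^sup>+ x. f (Complex x y) \<partial>lborel \<partial>lborel)"
proof -
  have "(\<integral>\<^sup>+ z. f z \<partial>(lborel :: complex measure)) = (\<integral>\<^sup>+ (x, y). f (Complex x y) \<partial>(lborel \<Otimes>\<^sub>M lborel))"
    by (subst lborel_complex) (simp add: nn_integral_distr split_beta')
  then show "(\<integral>\<^sup>+ z. f z \<partial>(lborel :: complex measure)) = (\<integral>\<^sup>+ x. \<integral>\<^sup>+ y. f (Complex x y) \<partial>lborel \<partial>lborel)"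
    and "(\<integral>\<^sup>+ z. f z \<partial>(lborel :: complex measure)) = (\<integral>\<^sup>+ y. \<integral>\<^sup>+ x. f (Complex x y) \<partial>lborel \<partial>lborel)"
    using lborel.nn_integral_fst[of "\<lambda>(x, y). f (Complex x y)" lborel]
      lborel_pair.nn_integral_snd[of "\<lambda>(x, y). f (Complex x y)"] by simp_all
qed

lemma integrable_complex:
  fixes f :: "complex \<Rightarrow> 'a::{banach, second_countable_topology}"
  assumes "integrable lborel f"
  shows "integrable (lborel \<Otimes>\<^sub>M lborel) (\<lambda>(x, y). f (Complex x y))"
proof -
  have [measurable]: "f \<in> borel_measurable borel"
    using assms by auto
  show ?thesis
    using assms by (subst (asm) lborel_complex) (simp add: integrable_distr_eq split_beta')
qed

lemma
  fixes f :: "complex \<Rightarrow> 'a::{banach, second_countable_topology}"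
  assumes f: "integrable lborel f"
  shows AE_integrable_complex_x: "AE y in lborel. integrable lborel (\<lambda>x. f (Complex x y))"
    and integral_complex_x: "(\<integral>z. f z \<partial>lborel) = (\<integral>y. \<integral>x. f (Complex x y) \<partial>lborel \<partial>lborel)"
    and AE_integrable_complex_y: "AE x in lborel. integrable lborel (\<lambda>y. f (Complex x y))"
    and integral_complex_y: "(\<integral>z. f z \<partial>lborel) = (\<integral>x. \<integral>y. f (Complex x y) \<partial>lborel \<partial>lborel)"
proof -
  have [measurable]: "f \<in> borel_measurable borel"
    using f by auto
  have eq: "(\<integral>z. f z \<partial>lborel) = integral\<^sup>L (lborel \<Otimes>\<^sub>M lborel) (\<lambda>(x, y). f (Complex x y))"
    by (subst lborel_complex) (simp add: integral_distr split_beta')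
  note int = integrable_complex[OF f]
  show "AE y in lborel. integrable lborel (\<lambda>x. f (Complex x y))"
    by (rule lborel_pair.AE_integrable_snd[OF int])
  show "(\<integral>z. f z \<partial>lborel) = (\<integral>y. \<integral>x. f (Complex x y) \<partial>lborel \<partial>lborel)"
    unfolding eq by (rule lborel_pair.integral_snd[OF int, symmetric])
  show "AE x in lborel. integrable lborel (\<lambda>y. f (Complex x y))"
    by (rule lborel_pair.AE_integrable_fst[OF int])
  show "(\<integral>z. f z \<partial>lborel) = (\<integral>x. \<integral>y. f (Complex x y) \<partial>lborel \<partial>lborel)"
    unfolding eq by (rule lborel_pair.integral_fst[OF int, symmetric])
qed

section \<open>Shears and rotations\<close>

lemma nn_integral_shear_x:
  assumes [measurable]: "f \<in> borel_measurable borel"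
  shows "(\<integral>\<^sup>+ z. f (Complex (Re z + a * Im z) (Im z)) \<partial>lborel) = (\<integral>\<^sup>+ z. f z \<partial>lborel)"
proof -
  have "(\<integral>\<^sup>+ x. f (Complex (x + a * y) y) \<partial>lborel) = (\<integral>\<^sup>+ x. f (Complex x y) \<partial>lborel)" for y
    using nn_integral_real_affine[of "\<lambda>x. f (Complex x y)" 1 "a * y"] by (simp add: add.commute)
  then show ?thesis
    by (simp add: nn_integral_complex(2))
qed

lemma nn_integral_shear_y:
  assumes [measurable]: "f \<in> borel_measurable borel"
  shows "(\<integral>\<^sup>+ z. f (Complex (Re z) (Im z + a * Re z)) \<partial>lborel) = (\<integral>\<^sup>+ z. f z \<partial>lborel)"
proof -
  have "(\<integral>\<^sup>+ y. f (Complex x (y + a * x)) \<partial>lborel) = (\<integral>\<^sup>+ y. f (Complex x y) \<partial>lborel)" for x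
    using nn_integral_real_affine[of "\<lambda>y. f (Complex x y)" 1 "a * x"] by (simp add: add.commute)
  then show ?thesis
    by (simp add: nn_integral_complex(1))
qed

text \<open>A rotation is a product of three shears, which preserve area by Fubini's theorem.\<close>

lemma nn_integral_rotate:
  assumes f [measurable]: "f \<in> borel_measurable borel" and t: "cos (t / 2) \<noteq> 0"
  shows "(\<integral>\<^sup>+ z. f (cis t * z) \<partial>lborel) = (\<integral>\<^sup>+ z. f z \<partial>lborel)"
proof -
  define s where "s = t / 2"
  \<comment> \<open>\<open>a\<close> is - tan (t/2). With A = (1, a; 0, 1) and B = (1, 0; sin t, 1)
    the product A B A is the rotation by t for this \<open>a\<close>.\<close>
  define a where "a = - sin s / cos s"
  have cs: "cos t = (cos s)\<^sup>2 - (sin s)\<^sup>2" "sin t = 2 * sin s * cos s" "cos s \<noteq> 0"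
    using cos_double[of s] sin_double[of s] t by (auto simp: s_def)
  have q: "cos t = 1 - 2 * (sin s)\<^sup>2" "cos t = 2 * (cos s)\<^sup>2 - 1"
    using sin_cos_squared_add[of s] cs(1) by linarith+
  have e: "cos t = 1 + a * sin t"
    using cs(3) unfolding cs(2) q(1) a_def by (simp add: power2_eq_square)
  have "cos t * a + a = 2 * (cos s)\<^sup>2 * a"
    unfolding q(2) by (simp add: algebra_simps)
  also have "\<dots> = - sin t"
    using cs(3) unfolding cs(2) a_def by (simp add: power2_eq_square)
  finally have e': "cos t * a + a = - sin t" .
  let ?A = "\<lambda>z. Complex (Re z + a * Im z) (Im z)" and ?B = "\<lambda>z. Complex (Re z) (Im z + sin t * Re z)"
  have "cis t * z = ?A (?B (?A z))" for z
  proof (rule complex_eqI)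
    have "Re (?A (?B (?A z))) = (1 + a * sin t) * Re z + (a + a * (1 + a * sin t)) * Im z"
      by (simp add: algebra_simps)
    also have "\<dots> = cos t * Re z - sin t * Im z"
      unfolding e[symmetric] using e' by (simp add: algebra_simps)
    finally show "Re (cis t * z) = Re (?A (?B (?A z)))" by simp
    have "Im (?A (?B (?A z))) = sin t * Re z + (1 + a * sin t) * Im z"
      by (simp add: algebra_simps)
    then show "Im (cis t * z) = Im (?A (?B (?A z)))"
      unfolding e[symmetric] by (simp add: algebra_simps)
  qed
  then have "(\<integral>\<^sup>+ z. f (cis t * z) \<partial>lborel) = (\<integral>\<^sup>+ z. f (?A (?B (?A z))) \<partial>lborel)"
    by simp
  also have "\<dots> = (\<integral>\<^sup>+ z. f (?A (?B z)) \<partial>lborel)"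
    by (rule nn_integral_shear_x[where f="\<lambda>z. f (?A (?B z))"]) measurable
  also have "\<dots> = (\<integral>\<^sup>+ z. f (?A z) \<partial>lborel)"
    by (rule nn_integral_shear_y[where f="\<lambda>z. f (?A z)"]) measurable
  also have "\<dots> = (\<integral>\<^sup>+ z. f z \<partial>lborel)"
    by (rule nn_integral_shear_x) measurable
  finally show ?thesis .
qed

section \<open>Integrability of the Cauchy kernel\<close>

lemma ball_borel_measurable [measurable]: "ball c r \<in> sets borel"
  by simp

lemma nn_integral_even:
  fixes f :: "real \<Rightarrow> ennreal"
  assumes [measurable]: "f \<in> borel_measurable borel"
  shows "(\<integral>\<^sup>+ x. f \<bar>x\<bar> \<partial>lborel) = 2 * (\<integral>\<^sup>+ x. f x * indicator {0..} x \<partial>lborel)"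
proof -
  have "AE x in lborel. f \<bar>x\<bar> = f x * indicator {0..} x + f (- x) * indicator {0..} (- x)"
    using AE_lborel_singleton[of 0] by eventually_elim (auto simp: indicator_def)
  then have "(\<integral>\<^sup>+ x. f \<bar>x\<bar> \<partial>lborel)
      = (\<integral>\<^sup>+ x. f x * indicator {0..} x + f (- x) * indicator {0..} (- x) \<partial>lborel)"
    by (rule nn_integral_cong_AE)
  also have "\<dots> = (\<integral>\<^sup>+ x. f x * indicator {0..} x \<partial>lborel) + (\<integral>\<^sup>+ x. f (- x) * indicator {0..} (- x) \<partial>lborel)"
    by (rule nn_integral_add) measurable
  also have "(\<integral>\<^sup>+ x. f (- x) * indicator {0..} (- x) \<partial>lborel) = (\<integral>\<^sup>+ x. f x * indicator {0..} x \<partial>lborel)"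
    using nn_integral_real_affine[of "\<lambda>x. f x * indicator {0..} x" "-1" 0] by simp
  finally show ?thesis
    by (simp add: mult_2)
qed

lemma nn_integral_powr_from_0:
  assumes "a > -1" "c \<ge> (0::real)"
  shows "(\<integral>\<^sup>+ x. ennreal (x powr a) * indicator {0..c} x \<partial>lborel) = ennreal (c powr (a + 1) / (a + 1))"
  by (rule nn_integral_has_integral_lebesgue'[OF _ has_integral_powr_from_0[OF assms]]) simp

text \<open>On the interval |x - a| is at most 2, so the integral is at most twice that of x^(-1/2)
  over [0, 2], which is 4 sqrt 2.\<close>

lemma nn_integral_inverse_sqrt_line:
  assumes "\<bar>a\<bar> \<le> 1"
  shows "(\<integral>\<^sup>+ x. ennreal (\<bar>x - a\<bar> powr (- 1 / 2)) * indicator {-1..1} x \<partial>lborel) \<le> ennreal 8"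
proof -
  let ?f = "\<lambda>x::real. ennreal (x powr (- 1 / 2)) * indicator {..2} x"
  have "(\<integral>\<^sup>+ x. ennreal (\<bar>x - a\<bar> powr (- 1 / 2)) * indicator {-1..1} x \<partial>lborel) \<le> (\<integral>\<^sup>+ x. ?f \<bar>- a + 1 * x\<bar> \<partial>lborel)"
    using assms by (intro nn_integral_mono) (auto split: split_indicator)
  also have "\<dots> = (\<integral>\<^sup>+ x. ?f \<bar>x\<bar> \<partial>lborel)"
    using nn_integral_real_affine[of "\<lambda>x. ?f \<bar>x\<bar>" 1 "- a"] by simp
  also have "\<dots> = 2 * (\<integral>\<^sup>+ x. ?f x * indicator {0..} x \<partial>lborel)"
    by (rule nn_integral_even) measurable
  also have "(\<integral>\<^sup>+ x. ?f x * indicator {0..} x \<partial>lborel)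
      = (\<integral>\<^sup>+ x. ennreal (x powr (- 1 / 2)) * indicator {0..2} x \<partial>lborel)"
    by (intro nn_integral_cong) (auto split: split_indicator)
  also have "\<dots> = ennreal (2 powr (- 1 / 2 + 1) / (- 1 / 2 + 1))"
    by (rule nn_integral_powr_from_0) auto
  also have "2 * \<dots> = ennreal (4 * sqrt 2)"
    by (simp add: powr_half_sqrt ennreal_mult'[symmetric] flip: ennreal_numeral)
  also have "\<dots> \<le> ennreal 8"
    using real_sqrt_le_mono[of 2 4] by (intro ennreal_leI) auto
  finally show ?thesis .
qed

text \<open>The planar singularity splits into two linear ones: with p, q the coordinate distances,
  p q \<le> p^2 + q^2 gives 1/|z - w| \<le> p^(-1/2) q^(-1/2), and the integral over the enclosing
  square factors into two integrals bounded by 8.\<close>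

lemma nn_integral_inverse_dist:
  assumes "w \<in> unit_disc"
  shows "(\<integral>\<^sup>+ z. ennreal (1 / norm (z - w)) * indicator unit_disc z \<partial>lborel) \<le> ennreal 64"
proof -
  have w: "\<bar>Re w\<bar> \<le> 1" "\<bar>Im w\<bar> \<le> 1"
    using assms abs_Re_le_cmod[of w] abs_Im_le_cmod[of w] by auto
  define k where "k a x = ennreal (\<bar>x - a\<bar> powr (- 1 / 2)) * indicator {-1..1} x" for a x :: real
  have [measurable]: "k a \<in> borel_measurable borel" for a
    unfolding k_def by measurable
  have "AE y in lborel. y \<noteq> Im w" "AE x in lborel. x \<noteq> Re w"
    by (rule AE_lborel_singleton)+
  have bound: "ennreal (1 / norm (z - w)) * indicator unit_disc z \<le> k (Re w) (Re z) * k (Im w) (Im z)"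
    if "Re z \<noteq> Re w" "Im z \<noteq> Im w" for z
  proof (cases "z \<in> unit_disc")
    case True
    then have z: "\<bar>Re z\<bar> \<le> 1" "\<bar>Im z\<bar> \<le> 1"
      using abs_Re_le_cmod[of z] abs_Im_le_cmod[of z] by auto
    define p q where "p = \<bar>Re z - Re w\<bar>" and "q = \<bar>Im z - Im w\<bar>"
    have pq: "0 < p" "0 < q" "z \<noteq> w"
      using that by (auto simp: p_def q_def)
    have "sqrt (p * q) \<le> norm (z - w)"
    proof (rule real_le_lsqrt)
      have "p * q \<le> p\<^sup>2 + q\<^sup>2"
        using pq sum_squares_bound[of p q] mult_pos_pos[of p q] by linarith
      also have "\<dots> = (norm (z - w))\<^sup>2"
        by (simp add: cmod_power2 p_def q_def)
      finally show "p * q \<le> (norm (z - w))\<^sup>2" .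
    qed auto
    then have "1 / norm (z - w) \<le> 1 / sqrt (p * q)"
      using pq by (intro divide_left_mono) (auto intro!: mult_pos_pos)
    also have "\<dots> = p powr (- 1 / 2) * q powr (- 1 / 2)"
      using pq by (simp add: powr_minus powr_half_sqrt real_sqrt_mult divide_simps)
    finally show ?thesis
      using z True by (simp add: k_def p_def q_def ennreal_mult'[symmetric] indicator_def abs_le_iff)
  qed auto
  have "(\<integral>\<^sup>+ z. ennreal (1 / norm (z - w)) * indicator unit_disc z \<partial>lborel)
     = (\<integral>\<^sup>+ x. \<integral>\<^sup>+ y. ennreal (1 / norm (Complex x y - w)) * indicator unit_disc (Complex x y) \<partial>lborel \<partial>lborel)"
    by (rule nn_integral_complex(1)) measurable
  also have "\<dots> \<le> (\<integral>\<^sup>+ x. \<integral>\<^sup>+ y. k (Re w) x * k (Im w) y \<partial>lborel \<partial>lborel)"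
    using AE_lborel_singleton[of "Re w"]
  proof (intro nn_integral_mono_AE, eventually_elim)
    case (elim x)
    show ?case
      using AE_lborel_singleton[of "Im w"]
      by (intro nn_integral_mono_AE, eventually_elim) (use elim in \<open>auto intro: bound[of "Complex x _", simplified]\<close>)
  qed
  also have "\<dots> = (\<integral>\<^sup>+ x. k (Re w) x \<partial>lborel) * (\<integral>\<^sup>+ y. k (Im w) y \<partial>lborel)"
    by (simp add: nn_integral_cmult nn_integral_multc)
  also have "\<dots> \<le> ennreal 8 * ennreal 8"
    unfolding k_def using w by (intro mult_mono nn_integral_inverse_sqrt_line) auto
  also have "\<dots> = ennreal 64"
    by (simp add: ennreal_mult'[symmetric])
  finally show ?thesis .
qed

text \<open>The common integrability criterion for functions with at most the singularity of the
  Cauchy kernel at \<open>w\<close>. The value at \<open>w\<close> itself concerns a null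
  set.\<close>

lemma integrable_inverse_dist_bound:
  fixes f :: "complex \<Rightarrow> complex"
  assumes [measurable]: "f \<in> borel_measurable borel" and w: "w \<in> unit_disc"
    and bound: "\<And>z. z \<in> unit_disc \<Longrightarrow> z \<noteq> w \<Longrightarrow> norm (f z) \<le> C / norm (z - w)"
    and zero: "\<And>z. z \<notin> unit_disc \<Longrightarrow> f z = 0"
  shows "integrable lborel f"
proof (rule integrableI_bounded)
  have "AE z in lborel. ennreal (norm (f z)) \<le> ennreal \<bar>C\<bar> * (ennreal (1 / norm (z - w)) * indicator unit_disc z)"
    using AE_lborel_singleton[of w]
  proof eventually_elim
    case (elim z)
    show ?case
    proof (cases "z \<in> unit_disc")
      case True
      have "norm (f z) \<le> \<bar>C\<bar> * (1 / norm (z - w))"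
        using bound[OF True elim] by (auto simp: divide_simps intro: order_trans split: if_splits)
      then show ?thesis
        using True by (auto simp: ennreal_mult'[symmetric] intro!: ennreal_leI)
    qed (use zero in auto)
  qed
  then have "(\<integral>\<^sup>+ z. ennreal (norm (f z)) \<partial>lborel)
      \<le> (\<integral>\<^sup>+ z. ennreal \<bar>C\<bar> * (ennreal (1 / norm (z - w)) * indicator unit_disc z) \<partial>lborel)"
    by (rule nn_integral_mono_AE)
  also have "\<dots> = ennreal \<bar>C\<bar> * (\<integral>\<^sup>+ z. ennreal (1 / norm (z - w)) * indicator unit_disc z \<partial>lborel)"
    by (rule nn_integral_cmult) measurable
  also have "\<dots> \<le> ennreal \<bar>C\<bar> * ennreal 64"
    by (intro mult_left_mono nn_integral_inverse_dist w) auto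
  also have "\<dots> < \<infinity>"
    by (simp add: ennreal_mult_less_top)
  finally show "(\<integral>\<^sup>+ z. ennreal (norm (f z)) \<partial>lborel) < \<infinity>" .
qed measurable

text \<open>The derivative may be discontinuous, so the fundamental theorem is taken for the
  Henstock-Kurzweil integral over an interval containing the support; Lebesgue integrability of
  \<open>f'\<close> then identifies the two integrals.\<close>

lemma integral_derivative_eq_0:
  fixes f :: "real \<Rightarrow> complex"
  assumes f: "\<And>x. (f has_vector_derivative f' x) (at x)" and int: "integrable lborel f'"
    and R: "\<And>x. R \<le> \<bar>x\<bar> \<Longrightarrow> f x = 0"
  shows "integral\<^sup>L lborel f' = 0"
proof -
  define S where "S = {- \<bar>R\<bar> .. \<bar>R\<bar>}"
  have "f' x = 0" if "x \<notin> S" for x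
  proof -
    have "((\<lambda>x. 0) has_vector_derivative f' x) (at x)"
    proof (rule has_vector_derivative_transform_within_open[OF f[of x]])
      show "open (- S)" "x \<in> - S"
        using that by (auto simp: S_def)
      show "f y = 0" if "y \<in> - S" for y
        using that by (intro R) (auto simp: S_def)
    qed
    then show ?thesis
      using vector_derivative_unique_at has_vector_derivative_const by blast
  qed
  then have eq: "f' x = indicator S x *\<^sub>R f' x" for x
    by (auto split: split_indicator)
  have "(f' has_integral (f \<bar>R\<bar> - f (- \<bar>R\<bar>))) S"
    unfolding S_def
    by (intro fundamental_theorem_of_calculus) (auto intro: has_vector_derivative_at_within f)
  moreover have "f \<bar>R\<bar> = 0" "f (- \<bar>R\<bar>) = 0"
    by (auto intro: R)
  ultimately have "integral S f' = 0"
    by (simp add: integral_unique)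
  moreover have "set_integrable lborel S f'"
    using int eq by (simp add: set_integrable_def cong: integrable_cong)
  then have "(LINT x:S|lborel. f' x) = integral S f'"
    by (rule set_borel_integral_eq_integral)
  ultimately show ?thesis
    using eq by (simp add: set_lebesgue_integral_def cong: Bochner_Integration.integral_cong)
qed

text \<open>On almost every horizontal or vertical line the exceptional point is not met, so that the
  fundamental theorem of calculus applies there; no continuity of the derivative is needed.\<close>

lemma
  fixes F :: "complex \<Rightarrow> complex"
  assumes F: "\<And>z. z \<noteq> w \<Longrightarrow> (F has_derivative F' z) (at z)"
    and zero: "\<And>z. R \<le> norm z \<Longrightarrow> F z = 0"
  shows integral_partial_x_eq_0:
      "integrable lborel (\<lambda>z. F' z 1) \<Longrightarrow> (\<integral>z. F' z 1 \<partial>lborel) = 0"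
    and integral_partial_y_eq_0:
      "integrable lborel (\<lambda>z. F' z \<i>) \<Longrightarrow> (\<integral>z. F' z \<i> \<partial>lborel) = 0"
proof -
  have line: "((\<lambda>t. F (c + of_real t * v)) has_vector_derivative F' (c + of_real t * v) v) (at t)"
    if "c + of_real t * v \<noteq> w" for c v t
  proof -
    have "((\<lambda>t. F (c + of_real t * v)) has_derivative (\<lambda>h. F' (c + of_real t * v) (of_real h * v))) (at t)"
      by (rule has_derivative_compose[where f="\<lambda>t. c + of_real t * v" and g=F, OF _ F[OF that]]) (auto intro!: derivative_eq_intros)
    moreover have "F' (c + of_real t * v) (of_real h * v) = h *\<^sub>R F' (c + of_real t * v) v" for h
      using linear_scale[OF has_derivative_linear[OF F[OF that]], of h v] by (simp add: scaleR_conv_of_real)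
    ultimately show ?thesis
      by (simp add: has_vector_derivative_def)
  qed
  show "(\<integral>z. F' z 1 \<partial>lborel) = 0" if int: "integrable lborel (\<lambda>z. F' z 1)"
  proof (subst integral_complex_x[OF int], rule integral_eq_zero_AE)
    show "AE y in lborel. (\<integral>x. F' (Complex x y) 1 \<partial>lborel) = 0"
      using AE_lborel_singleton[of "Im w"] AE_integrable_complex_x[OF int]
    proof eventually_elim
      case (elim y)
      have eq: "\<i> * of_real y + of_real x * 1 = Complex x y" for x
        by (simp add: complex_eq_iff)
      show ?case
      proof (rule integral_derivative_eq_0[OF _ elim(2)])
        show "((\<lambda>x. F (Complex x y)) has_vector_derivative F' (Complex x y) 1) (at x)" for x
          using line[of "\<i> * of_real y" x 1] elim(1) unfolding eq by (auto simp: complex_eq_iff)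
        show "F (Complex x y) = 0" if "R \<le> \<bar>x\<bar>" for x
          using that abs_Re_le_cmod[of "Complex x y"] by (intro zero) auto
      qed
    qed
  qed
  show "(\<integral>z. F' z \<i> \<partial>lborel) = 0" if int: "integrable lborel (\<lambda>z. F' z \<i>)"
  proof (subst integral_complex_y[OF int], rule integral_eq_zero_AE)
    show "AE x in lborel. (\<integral>y. F' (Complex x y) \<i> \<partial>lborel) = 0"
      using AE_lborel_singleton[of "Re w"] AE_integrable_complex_y[OF int]
    proof eventually_elim
      case (elim x)
      have eq: "of_real x + of_real y * \<i> = Complex x y" for y
        by (simp add: complex_eq_iff)
      show ?case
      proof (rule integral_derivative_eq_0[OF _ elim(2)])
        show "((\<lambda>y. F (Complex x y)) has_vector_derivative F' (Complex x y) \<i>) (at y)" for y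
          using line[of "of_real x" y \<i>] elim(1) unfolding eq by (auto simp: complex_eq_iff)
        show "F (Complex x y) = 0" if "R \<le> \<bar>y\<bar>" for y
          using that abs_Im_le_cmod[of "Complex x y"] by (intro zero) auto
      qed
    qed
  qed
qed

section \<open>The Cauchy--Pompeiu formula\<close>

lemma nn_integral_poisson_kernel_line:
  fixes a :: real
  assumes a: "0 < a"
  shows "(\<integral>\<^sup>+ y. ennreal (1 / (a\<^sup>2 + y\<^sup>2)\<^sup>2) \<partial>lborel) = ennreal (pi / (2 * a ^ 3))"
proof -
  \<comment> \<open>An antiderivative: the terms have derivatives (a^2 - y^2) / (2 a^2 (a^2 +
    y^2)^2) and 1 / (2 a^2 (a^2 + y^2)), and y^2 cancels over the common denominator.\<close>
  define A where "A y = y / (2 * a\<^sup>2 * (a\<^sup>2 + y\<^sup>2)) + arctan (y / a) / (2 * a ^ 3)" for y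
  have pos: "a\<^sup>2 + y\<^sup>2 > 0" for y
    using a by (simp add: add_pos_nonneg)
  have deriv: "(A has_real_derivative 1 / (a\<^sup>2 + y\<^sup>2)\<^sup>2) (at y)" for y
  proof -
    have "((\<lambda>y. y / (2 * a\<^sup>2 * (a\<^sup>2 + y\<^sup>2))) has_real_derivative (a\<^sup>2 - y\<^sup>2) / (2 * a\<^sup>2 * (a\<^sup>2 + y\<^sup>2)\<^sup>2)) (at y)"
      using a pos[of y] by (auto intro!: derivative_eq_intros simp: divide_simps power2_eq_square) (auto simp: algebra_simps)
    moreover have "((\<lambda>y. arctan (y / a) / (2 * a ^ 3)) has_real_derivative 1 / (2 * a\<^sup>2 * (a\<^sup>2 + y\<^sup>2))) (at y)"
      using a pos[of y] by (auto intro!: derivative_eq_intros simp: divide_simps power2_eq_square power3_eq_cube)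
    ultimately have "(A has_real_derivative (a\<^sup>2 - y\<^sup>2) / (2 * a\<^sup>2 * (a\<^sup>2 + y\<^sup>2)\<^sup>2) + 1 / (2 * a\<^sup>2 * (a\<^sup>2 + y\<^sup>2))) (at y)"
      unfolding A_def by (rule DERIV_add)
    also have "(a\<^sup>2 - y\<^sup>2) / (2 * a\<^sup>2 * (a\<^sup>2 + y\<^sup>2)\<^sup>2) + 1 / (2 * a\<^sup>2 * (a\<^sup>2 + y\<^sup>2)) = 1 / (a\<^sup>2 + y\<^sup>2)\<^sup>2"
      using a pos[of y] by (simp add: divide_simps) (simp add: algebra_simps power2_eq_square)
    finally show ?thesis .
  qed
  have lim: "(A \<longlongrightarrow> pi / (4 * a ^ 3)) at_top"
  proof -
    have "((\<lambda>y. y / (2 * a\<^sup>2 * (a\<^sup>2 + y\<^sup>2))) \<longlongrightarrow> 0) at_top"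
      using a by real_asymp
    moreover have "((\<lambda>y. arctan (y / a)) \<longlongrightarrow> pi / 2) at_top"
      using a by (intro filterlim_compose[OF tendsto_arctan_at_top] filterlim_tendsto_pos_mult_at_top[where c="1/a" and f="\<lambda>_. 1/a" and g="\<lambda>y. y", simplified]) (auto simp: filterlim_ident)
    ultimately have "(A \<longlongrightarrow> 0 + pi / 2 / (2 * a ^ 3)) at_top"
      unfolding A_def using a by (intro tendsto_intros) auto
    then show ?thesis by simp
  qed
  have "(\<integral>\<^sup>+ y. ennreal (1 / (a\<^sup>2 + y\<^sup>2)\<^sup>2) \<partial>lborel) = (\<integral>\<^sup>+ y. ennreal (1 / (a\<^sup>2 + \<bar>y\<bar>\<^sup>2)\<^sup>2) \<partial>lborel)"
    by simp
  also have "\<dots> = 2 * (\<integral>\<^sup>+ y. ennreal (1 / (a\<^sup>2 + y\<^sup>2)\<^sup>2) * indicator {0..} y \<partial>lborel)"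
    by (rule nn_integral_even) measurable
  also have "(\<integral>\<^sup>+ y. ennreal (1 / (a\<^sup>2 + y\<^sup>2)\<^sup>2) * indicator {0..} y \<partial>lborel) = ennreal (pi / (4 * a ^ 3) - A 0)"
    by (rule nn_integral_FTC_atLeast[OF _ deriv _ lim]) auto
  also have "2 * \<dots> = ennreal (pi / (2 * a ^ 3))"
    by (simp add: A_def ennreal_mult'[symmetric] flip: ennreal_numeral)
  finally show ?thesis .
qed

lemma nn_integral_inverse_cube_line:
  "(\<integral>\<^sup>+ x. ennreal (1 / (sqrt (1 + x\<^sup>2)) ^ 3) \<partial>lborel) = ennreal 2"
proof -
  define A where "A x = x / sqrt (1 + x\<^sup>2)" for x :: real
  have pos: "1 + x\<^sup>2 > 0" for x :: real
    by (simp add: add_pos_nonneg)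
  have deriv: "(A has_real_derivative 1 / (sqrt (1 + x\<^sup>2)) ^ 3) (at x)" for x
  proof -
    define s where "s = sqrt (1 + x\<^sup>2)"
    have s: "s > 0" "s\<^sup>2 = 1 + x\<^sup>2"
      using pos[of x] by (simp_all add: s_def)
    have "(A has_real_derivative (s - x * (x / s)) / (s * s)) (at x)"
      unfolding A_def s_def using pos[of x]
      by (auto intro!: derivative_eq_intros simp: field_simps)
    also have "(s - x * (x / s)) / (s * s) = 1 / s ^ 3"
      using s by (simp add: field_simps power2_eq_square power3_eq_cube)
    finally show ?thesis by (simp add: s_def)
  qed
  have lim: "(A \<longlongrightarrow> 1) at_top"
    unfolding A_def by real_asymp
  have "(\<integral>\<^sup>+ x. ennreal (1 / (sqrt (1 + x\<^sup>2)) ^ 3) \<partial>lborel) = (\<integral>\<^sup>+ x. ennreal (1 / (sqrt (1 + \<bar>x\<bar>\<^sup>2)) ^ 3) \<partial>lborel)"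
    by simp
  also have "\<dots> = 2 * (\<integral>\<^sup>+ x. ennreal (1 / (sqrt (1 + x\<^sup>2)) ^ 3) * indicator {0..} x \<partial>lborel)"
    by (rule nn_integral_even) measurable
  also have "(\<integral>\<^sup>+ x. ennreal (1 / (sqrt (1 + x\<^sup>2)) ^ 3) * indicator {0..} x \<partial>lborel) = ennreal (1 - A 0)"
    by (rule nn_integral_FTC_atLeast[OF _ deriv _ lim]) auto
  finally show ?thesis
    by (simp add: A_def)
qed

text \<open>In Cartesian coordinates the inner integral, with a = sqrt (1 + x^2), is pi / (2 a^3),
  and the outer integral of 1 / a^3 is 2. This mass becomes the constant \<open>pi\<close> of the
  Cauchy--Pompeiu formula.\<close>

lemma has_bochner_integral_poisson_kernel:
  "has_bochner_integral lborel (\<lambda>z :: complex. 1 / (1 + (norm z)\<^sup>2)\<^sup>2) pi"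
proof (rule has_bochner_integral_nn_integral)
  have "(\<integral>\<^sup>+ z. ennreal (1 / (1 + (norm z)\<^sup>2)\<^sup>2) \<partial>(lborel :: complex measure))
     = (\<integral>\<^sup>+ x. \<integral>\<^sup>+ y. ennreal (1 / (1 + (norm (Complex x y))\<^sup>2)\<^sup>2) \<partial>lborel \<partial>lborel)"
    by (rule nn_integral_complex(1)) measurable
  also have "\<dots> = (\<integral>\<^sup>+ x. \<integral>\<^sup>+ y. ennreal (1 / ((sqrt (1 + x\<^sup>2))\<^sup>2 + y\<^sup>2)\<^sup>2) \<partial>lborel \<partial>lborel)"
    by (simp add: cmod_power2 add.assoc)
  also have "\<dots> = (\<integral>\<^sup>+ x. ennreal (pi / (2 * sqrt (1 + x\<^sup>2) ^ 3)) \<partial>lborel)"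
    by (intro nn_integral_cong nn_integral_poisson_kernel_line) (simp add: add_pos_nonneg)
  also have "\<dots> = (\<integral>\<^sup>+ x. ennreal (pi / 2) * ennreal (1 / (sqrt (1 + x\<^sup>2)) ^ 3) \<partial>lborel)"
    by (simp add: ennreal_mult'[symmetric])
  also have "\<dots> = ennreal (pi / 2) * ennreal 2"
    by (subst nn_integral_cmult) (simp_all add: nn_integral_inverse_cube_line)
  also have "\<dots> = ennreal pi"
    by (subst ennreal_mult'[symmetric]) auto
  finally show "(\<integral>\<^sup>+ z. ennreal (1 / (1 + (norm z)\<^sup>2)\<^sup>2) \<partial>(lborel :: complex measure)) = ennreal pi" .
qed auto

lemma integrable_continuous_compact_support:
  fixes f :: "complex \<Rightarrow> complex"
  assumes f: "continuous_on UNIV f" and zero: "\<And>z. R \<le> norm z \<Longrightarrow> f z = 0"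
  shows "integrable lborel f"
proof -
  have "integrable lborel (\<lambda>z. indicator (cball 0 R) z *\<^sub>R f z)"
    by (intro borel_integrable_compact continuous_on_subset[OF f]) auto
  also have "(\<lambda>z. indicator (cball 0 R) z *\<^sub>R f z) = f"
    using zero by (auto simp: fun_eq_iff indicator_def)
  finally show ?thesis .
qed

lemma bounded_continuous_compact_support:
  fixes f :: "complex \<Rightarrow> complex"
  assumes f: "continuous_on UNIV f" and zero: "\<And>z. R \<le> norm z \<Longrightarrow> f z = 0"
  obtains C where "0 < C" "\<And>z. norm (f z) \<le> C"
proof -
  have "bounded (f ` cball 0 R)"
    by (intro compact_imp_bounded compact_continuous_image continuous_on_subset[OF f]) auto
  then obtain C where C: "0 < C" "\<And>z. z \<in> cball 0 R \<Longrightarrow> norm (f z) \<le> C"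
    by (auto simp: bounded_pos)
  have "norm (f z) \<le> C" for z
    using C(2)[of z] C(1) zero[of z] by (cases "norm z \<le> R") auto
  with C(1) show ?thesis by (rule that)
qed

lemma integral_complex_affine:
  fixes f :: "complex \<Rightarrow> complex"
  assumes [measurable]: "f \<in> borel_measurable borel" and e: "0 < e"
  shows "(\<integral>z. f z \<partial>lborel) = e\<^sup>2 *\<^sub>R (\<integral>z. f (w + e *\<^sub>R z) \<partial>lborel)"
  using e by (subst lborel_affine[of e w]) (simp_all add: integral_density integral_distr)

text \<open>The Cauchy kernel is regularised to \<open>k e\<close>; the scaling \<open>z = w + e u\<close> turns \<open>dbar (k e)\<close> into
  the kernel \<open>1 / (1 + |u|^2)^2\<close> of mass \<open>pi\<close>.\<close>

lemma cauchy_pompeiu_compact_support: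
  fixes F :: "complex \<Rightarrow> complex"
  assumes F: "\<And>z. (F has_derivative F' z) (at z)"
    and cont: "continuous_on UNIV (\<lambda>z. F' z 1)" "continuous_on UNIV (\<lambda>z. F' z \<i>)"
    and zero: "\<And>z. z \<notin> unit_disc \<Longrightarrow> F z = 0" "\<And>z v. z \<notin> unit_disc \<Longrightarrow> F' z v = 0"
    and w: "w \<in> unit_disc"
  shows "(\<integral>z. (F' z 1 + \<i> * F' z \<i>) / 2 / (z - w) \<partial>lborel) = - of_real pi * F w"
proof -
  have contF: "continuous_on UNIV F"
    using F by (meson has_derivative_at_withinI has_derivative_continuous_on)
  have zero': "1 \<le> norm z \<Longrightarrow> F z = 0" "1 \<le> norm z \<Longrightarrow> F' z v = 0" for z v
    using zero by auto
  obtain CF where CF: "0 < CF" "\<And>z. norm (F z) \<le> CF"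
    using bounded_continuous_compact_support[OF contF zero'(1)] by blast
  define dbF where "dbF z = (F' z 1 + \<i> * F' z \<i>) / 2" for z
  have cdb: "continuous_on UNIV dbF"
    unfolding dbF_def by (intro continuous_intros cont) auto
  have zdb: "1 \<le> norm z \<Longrightarrow> dbF z = 0" for z
    by (simp add: dbF_def zero')
  obtain Cd where Cd: "0 < Cd" "\<And>z. norm (dbF z) \<le> Cd"
    using bounded_continuous_compact_support[OF cdb zdb] by blast
  have [measurable]: "dbF \<in> borel_measurable borel" "F \<in> borel_measurable borel"
    using cdb contF by (auto intro: borel_measurable_continuous_onI)
  \<comment> \<open>\<open>D e z\<close> is |z - w|^2 + e^2. Written with \<open>cnj\<close>, it has
    a derivative that is polynomial in the data.\<close>
  define D where "D e z = (z - w) * cnj (z - w) + of_real (e\<^sup>2)" for e :: real and z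
  have Dre: "D e z = of_real ((norm (z - w))\<^sup>2 + e\<^sup>2)" for e z
    unfolding D_def by (metis complex_norm_square of_real_add of_real_power)
  have D0: "D e z \<noteq> 0" if "e > 0" for e z
    using that unfolding Dre of_real_eq_0_iff by (smt (verit) zero_le_power2 zero_less_power)
  define k where "k e z = cnj (z - w) / D e z" for e z
  define k' where "k' e z v = cnj v / D e z - cnj (z - w) * (v * cnj (z - w) + (z - w) * cnj v) / (D e z)\<^sup>2" for e z v
  have ck: "continuous_on UNIV (k e)" "continuous_on UNIV (\<lambda>z. k' e z v)" if "e > 0" for e v
    unfolding k_def k'_def D_def using D0[OF that, unfolded D_def]
    by (auto intro!: continuous_intros)
  have dk: "(k e has_derivative k' e z) (at z)" if "e > 0" for e z
  proof -
    have "((\<lambda>z. cnj (z - w)) has_derivative (\<lambda>v. cnj v)) (at z)"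
      by (auto intro!: derivative_eq_intros)
    moreover have "(D e has_derivative (\<lambda>v. v * cnj (z - w) + (z - w) * cnj v)) (at z)"
      unfolding D_def by (auto intro!: derivative_eq_intros simp: fun_eq_iff)
    ultimately have "(k e has_derivative (\<lambda>v. (cnj v * D e z - cnj (z - w) * (v * cnj (z - w) + (z - w) * cnj v))
        / (D e z * D e z))) (at z)"
      unfolding k_def by (rule has_derivative_divide') (rule D0[OF that])
    moreover have "(cnj v * D e z - cnj (z - w) * (v * cnj (z - w) + (z - w) * cnj v)) / (D e z * D e z) = k' e z v" for v
      using D0[OF that, of z] by (simp add: k'_def diff_divide_distrib power2_eq_square)
    ultimately show ?thesis by simp
  qed
  \<comment> \<open>The integral of dbar (F k) over the plane is 0, and dbar (k e) = e^2 / (D e)^2.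
    Area scales by e^2 under z = w + e u, so this term becomes the integral of F (w + e u) against a
    kernel that does not depend on e.\<close>
  have main: "(\<integral>z. dbF z * k e z \<partial>lborel) = - (\<integral>z. F (w + e *\<^sub>R z) * of_real (1 / (1 + (norm z)\<^sup>2)\<^sup>2) \<partial>lborel)"
    if e: "e > 0" for e
  proof -
    have cker: "continuous_on UNIV (\<lambda>z. F z * (of_real (e\<^sup>2) / (D e z)\<^sup>2))"
      unfolding D_def using D0[OF e, unfolded D_def]
      by (intro continuous_intros contF) auto
    define G' where "G' z v = F z * k' e z v + F' z v * k e z" for z v
    have dG: "((\<lambda>z. F z * k e z) has_derivative G' z) (at z)" for z
      unfolding G'_def by (rule has_derivative_mult[OF F dk[OF e]])
    have int: "integrable lborel (\<lambda>z. G' z 1)" "integrable lborel (\<lambda>z. G' z \<i>)"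
      unfolding G'_def
      by (rule integrable_continuous_compact_support[where R=1];
          (intro continuous_intros ck[OF e] cont contF | simp add: zero'))+
    have "(\<integral>z. G' z 1 \<partial>lborel) = 0" "(\<integral>z. G' z \<i> \<partial>lborel) = 0"
      by (rule integral_partial_x_eq_0[OF dG _ int(1), of 1] integral_partial_y_eq_0[OF dG _ int(2), of 1];
          simp add: zero')+
    then have "0 = (\<integral>z. (G' z 1 + \<i> * G' z \<i>) / 2 \<partial>lborel)"
      using int by simp
    also have "(\<lambda>z. (G' z 1 + \<i> * G' z \<i>) / 2) = (\<lambda>z. dbF z * k e z + F z * (of_real (e\<^sup>2) / (D e z)\<^sup>2))"
    proof
      fix z
      have "(k' e z 1 + \<i> * k' e z \<i>) / 2 = 1 / D e z - (z - w) * cnj (z - w) / (D e z)\<^sup>2"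
        using D0[OF e, of z] by (simp add: k'_def field_simps power2_eq_square)
      also have "\<dots> = (D e z - (z - w) * cnj (z - w)) / (D e z)\<^sup>2"
        using D0[OF e, of z] by (simp add: field_simps power2_eq_square)
      also have "\<dots> = of_real (e\<^sup>2) / (D e z)\<^sup>2"
        by (simp add: D_def)
      finally have kk: "(k' e z 1 + \<i> * k' e z \<i>) / 2 = of_real (e\<^sup>2) / (D e z)\<^sup>2" .
      have "(G' z 1 + \<i> * G' z \<i>) / 2 = dbF z * k e z + F z * ((k' e z 1 + \<i> * k' e z \<i>) / 2)"
        by (simp add: G'_def dbF_def field_simps)
      then show "(G' z 1 + \<i> * G' z \<i>) / 2 = dbF z * k e z + F z * (of_real (e\<^sup>2) / (D e z)\<^sup>2)"
        by (simp only: kk)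
    qed
    also have "(\<integral>z. dbF z * k e z + F z * (of_real (e\<^sup>2) / (D e z)\<^sup>2) \<partial>lborel)
        = (\<integral>z. dbF z * k e z \<partial>lborel) + (\<integral>z. F z * (of_real (e\<^sup>2) / (D e z)\<^sup>2) \<partial>lborel)"
    proof (intro Bochner_Integration.integral_add integrable_continuous_compact_support[where R=1])
      show "continuous_on UNIV (\<lambda>z. F z * (of_real (e\<^sup>2) / (D e z)\<^sup>2))"
        by (rule cker)
    qed (auto intro!: continuous_intros cdb ck[OF e] simp: zdb zero')
    also have "(\<integral>z. F z * (of_real (e\<^sup>2) / (D e z)\<^sup>2) \<partial>lborel)
        = e\<^sup>2 *\<^sub>R (\<integral>z. F (w + e *\<^sub>R z) * (of_real (e\<^sup>2) / (D e (w + e *\<^sub>R z))\<^sup>2) \<partial>lborel)"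
      by (rule integral_complex_affine[OF borel_measurable_continuous_onI[OF cker] e])
    also have "\<dots> = (\<integral>z. F (w + e *\<^sub>R z) * of_real (1 / (1 + (norm z)\<^sup>2)\<^sup>2) \<partial>lborel)"
    proof -
      have "e\<^sup>2 *\<^sub>R (F (w + e *\<^sub>R z) * (of_real (e\<^sup>2) / (D e (w + e *\<^sub>R z))\<^sup>2))
          = F (w + e *\<^sub>R z) * of_real (1 / (1 + (norm z)\<^sup>2)\<^sup>2)" for z
      proof -
        have "D e (w + e *\<^sub>R z) = of_real (e\<^sup>2 * (1 + (norm z)\<^sup>2))"
          using e by (simp add: Dre power_mult_distrib algebra_simps)
        then have "of_real (e\<^sup>2) * (of_real (e\<^sup>2) / (D e (w + e *\<^sub>R z))\<^sup>2)
            = complex_of_real (e\<^sup>2 * (e\<^sup>2 / (e\<^sup>2 * (1 + (norm z)\<^sup>2))\<^sup>2))"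
          by simp
        also have "e\<^sup>2 * (e\<^sup>2 / (e\<^sup>2 * (1 + (norm z)\<^sup>2))\<^sup>2) = 1 / (1 + (norm z)\<^sup>2)\<^sup>2"
          using e by (simp add: power_mult_distrib power2_eq_square)
        finally have eq: "of_real (e\<^sup>2) * (of_real (e\<^sup>2) / (D e (w + e *\<^sub>R z))\<^sup>2)
            = complex_of_real (1 / (1 + (norm z)\<^sup>2)\<^sup>2)" .
        show ?thesis
          unfolding eq[symmetric] scaleR_conv_of_real[of "e\<^sup>2"] by (simp only: mult.left_commute)
      qed
      then show ?thesis
        by (simp only: integral_scaleR_right[symmetric])
    qed
    finally show ?thesis
      by (simp add: eq_neg_iff_add_eq_0)
  qed
  define ee where "ee n = 1 / real (Suc n)" for n
  have ee: "ee n > 0" for n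
    by (simp add: ee_def)
  have lim: "ee \<longlonglongrightarrow> 0"
    unfolding ee_def using LIMSEQ_inverse_real_of_nat by (simp add: inverse_eq_divide)
  \<comment> \<open>Since |k e| \<le> 1 / |z - w|, the limit dbar F / (z - w), which is integrable,
    is itself a majorant for all e.\<close>
  have "(\<lambda>n. \<integral>z. dbF z * k (ee n) z \<partial>lborel) \<longlonglongrightarrow> (\<integral>z. dbF z / (z - w) \<partial>lborel)"
  proof (rule integral_dominated_convergence[where w="\<lambda>z. norm (dbF z / (z - w))"])
    show "integrable lborel (\<lambda>z. norm (dbF z / (z - w)))"
      by (intro integrable_norm integrable_inverse_dist_bound[OF _ w, of _ Cd])
         (auto simp: norm_divide zdb intro!: divide_right_mono Cd)
    show "AE z in lborel. (\<lambda>n. dbF z * k (ee n) z) \<longlonglongrightarrow> dbF z / (z - w)"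
      using AE_lborel_singleton[of w]
    proof eventually_elim
      case (elim z)
      have "(\<lambda>n. dbF z * (cnj (z - w) / ((z - w) * cnj (z - w) + of_real ((ee n)\<^sup>2))))
          \<longlonglongrightarrow> dbF z * (cnj (z - w) / ((z - w) * cnj (z - w) + of_real (0\<^sup>2)))"
        using elim by (intro tendsto_intros lim) auto
      then show ?case
        using elim by (simp add: k_def D_def)
    qed
    show "AE z in lborel. norm (dbF z * k (ee n) z) \<le> norm (dbF z / (z - w))" for n
    proof (rule AE_I2)
      fix z
      show "norm (dbF z * k (ee n) z) \<le> norm (dbF z / (z - w))"
      proof (cases "z = w")
        case False
        have "norm (k (ee n) z) = norm (z - w) / ((norm (z - w))\<^sup>2 + (ee n)\<^sup>2)"
          unfolding k_def norm_divide Dre norm_of_real by (simp add: norm_minus_commute flip: complex_cnj_diff)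
        also have "\<dots> \<le> norm (z - w) / (norm (z - w))\<^sup>2"
          using False by (intro divide_left_mono) (auto intro!: mult_pos_pos add_pos_nonneg)
        also have "\<dots> = 1 / norm (z - w)"
          by (simp add: power2_eq_square)
        finally have "norm (dbF z) * norm (k (ee n) z) \<le> norm (dbF z) * (1 / norm (z - w))"
          by (intro mult_left_mono) auto
        then show ?thesis
          by (simp add: norm_mult norm_divide)
      qed (simp add: k_def)
    qed
    show "(\<lambda>z. dbF z * k (ee n) z) \<in> borel_measurable lborel" for n
      using borel_measurable_continuous_onI[OF continuous_on_mult[OF cdb ck(1)[OF ee]]] by simp
  qed simp
  moreover have "(\<lambda>n. \<integral>z. F (w + ee n *\<^sub>R z) * of_real (1 / (1 + (norm z)\<^sup>2)\<^sup>2) \<partial>lborel)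
      \<longlonglongrightarrow> (\<integral>z. F w * of_real (1 / (1 + (norm z)\<^sup>2)\<^sup>2) \<partial>(lborel :: complex measure))"
  proof (rule integral_dominated_convergence[where w="\<lambda>z. CF * (1 / (1 + (norm z)\<^sup>2)\<^sup>2)"])
    show "integrable lborel (\<lambda>z :: complex. CF * (1 / (1 + (norm z)\<^sup>2)\<^sup>2))"
      using has_bochner_integral_poisson_kernel by (intro integrable_mult_right) (simp add: has_bochner_integral_iff)
    show "AE z in lborel. (\<lambda>n. F (w + ee n *\<^sub>R z) * of_real (1 / (1 + (norm z)\<^sup>2)\<^sup>2))
        \<longlonglongrightarrow> F w * of_real (1 / (1 + (norm z)\<^sup>2)\<^sup>2)"
    proof (rule AE_I2)
      fix z
      have "isCont F w"
        using contF by (simp add: continuous_on_eq_continuous_at)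
      moreover have "(\<lambda>n. w + ee n *\<^sub>R z) \<longlonglongrightarrow> w + 0 *\<^sub>R z"
        by (intro tendsto_intros lim)
      ultimately have "(\<lambda>n. F (w + ee n *\<^sub>R z)) \<longlonglongrightarrow> F w"
        using isCont_tendsto_compose[of w F "\<lambda>n. w + ee n *\<^sub>R z"] by simp
      then show "(\<lambda>n. F (w + ee n *\<^sub>R z) * of_real (1 / (1 + (norm z)\<^sup>2)\<^sup>2))
          \<longlonglongrightarrow> F w * of_real (1 / (1 + (norm z)\<^sup>2)\<^sup>2)"
        by (intro tendsto_intros)
    qed
    show "AE z in lborel. norm (F (w + ee n *\<^sub>R z) * of_real (1 / (1 + (norm z)\<^sup>2)\<^sup>2))
        \<le> CF * (1 / (1 + (norm z)\<^sup>2)\<^sup>2)" for n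
      unfolding norm_mult norm_of_real using CF by (intro AE_I2 mult_mono) auto
  qed measurable
  then have "(\<lambda>n. \<integral>z. dbF z * k (ee n) z \<partial>lborel)
      \<longlonglongrightarrow> - (\<integral>z. F w * of_real (1 / (1 + (norm z)\<^sup>2)\<^sup>2) \<partial>(lborel :: complex measure))"
    unfolding main[OF ee] by (rule tendsto_minus)
  ultimately have "(\<integral>z. dbF z / (z - w) \<partial>lborel) = - (\<integral>z. F w * of_real (1 / (1 + (norm z)\<^sup>2)\<^sup>2) \<partial>(lborel :: complex measure))"
    by (rule LIMSEQ_unique)
  also have "(\<integral>z. F w * of_real (1 / (1 + (norm z)\<^sup>2)\<^sup>2) \<partial>(lborel :: complex measure))
      = F w * of_real (\<integral>z. 1 / (1 + (norm z)\<^sup>2)\<^sup>2 \<partial>(lborel :: complex measure))"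
    by (simp only: integral_mult_right_zero integral_complex_of_real)
  also have "(\<integral>z. 1 / (1 + (norm z)\<^sup>2)\<^sup>2 \<partial>(lborel :: complex measure)) = pi"
    using has_bochner_integral_poisson_kernel by (simp add: has_bochner_integral_iff)
  finally show ?thesis
    by (simp add: dbF_def)
qed

section \<open>The Green's function\<close>

text \<open>Covers both signs of the exponent at once: a power is monotone in one direction or the
  other, hence at most one of its two end values.\<close>

lemma powr_le_sum:
  fixes x :: real
  assumes "0 < m" "m \<le> x" "x \<le> M"
  shows "x powr a \<le> m powr a + M powr a"
proof (cases "a \<ge> 0")
  case True
  then have "x powr a \<le> M powr a" using assms by (intro powr_mono2) auto
  then show ?thesis by (simp add: add_increasing)
next
  case False
  then have "x powr a \<le> m powr a" using assms by (intro powr_mono2') auto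
  then show ?thesis by (simp add: add_increasing2)
qed

lemma one_minus_norm_square_pos:
  assumes "z \<in> unit_disc"
  shows "0 < 1 - (norm z)\<^sup>2"
  using assms by (simp add: power_less_one_iff abs_square_less_1)

text \<open>The first two estimates keep 1 - z cnj w and its conjugate in the right half-plane, away
  from the branch cut of the power.\<close>

lemma one_minus_cnj_mult:
  assumes z: "z \<in> unit_disc" and w: "w \<in> unit_disc"
  shows "0 < Re (1 - z * cnj w)" "0 < Re (1 - cnj z * w)" "1 - norm z \<le> norm (1 - z * cnj w)"
    "norm (1 - z * cnj w) \<le> 2" "norm (1 - cnj z * w) = norm (1 - z * cnj w)"
    "1 - norm z * norm w \<le> norm (1 - z * cnj w)" "1 - z * cnj w \<noteq> 0"
proof -
  have m: "norm (z * cnj w) = norm z * norm w" "norm (cnj z * w) = norm z * norm w"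
    by (simp_all add: norm_mult)
  have n: "norm z * norm w < 1" "norm z * norm w \<le> norm z"
    using z w mult_strict_mono[of "norm z" 1 "norm w" 1] mult_left_le[of "norm w" "norm z"] by auto
  show "0 < Re (1 - z * cnj w)" "0 < Re (1 - cnj z * w)"
    using complex_Re_le_cmod[of "z * cnj w"] complex_Re_le_cmod[of "cnj z * w"] n m by auto
  show *: "1 - norm z * norm w \<le> norm (1 - z * cnj w)"
    using norm_triangle_ineq2[of 1 "z * cnj w"] m by simp
  then show "1 - norm z \<le> norm (1 - z * cnj w)" "1 - z * cnj w \<noteq> 0"
    using n by auto
  show "norm (1 - z * cnj w) \<le> 2"
    using norm_triangle_ineq4[of 1 "z * cnj w"] m n by simp
  show "norm (1 - cnj z * w) = norm (1 - z * cnj w)"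
    by (metis complex_cnj_cnj complex_cnj_diff complex_cnj_mult complex_cnj_one complex_mod_cnj)
qed

text \<open>The right-hand side is the square of the pseudohyperbolic distance of z and w. It places
  the singularity of h(g) at g = 1 on the diagonal and measures it by |z - w|.\<close>

lemma one_minus_green_g:
  assumes z: "z \<in> unit_disc" and w: "w \<in> unit_disc"
  shows "1 - green_g z w = (norm (z - w))\<^sup>2 / (norm (1 - z * cnj w))\<^sup>2"
proof -
  have "(1 - (norm z)\<^sup>2) * (1 - (norm w)\<^sup>2) + (norm (z - w))\<^sup>2 = (norm (1 - z * cnj w))\<^sup>2"
    unfolding cmod_power2 by (simp add: algebra_simps power2_eq_square)
  then show ?thesis
    using one_minus_cnj_mult(7)[OF z w] by (simp add: green_g_def field_simps)
qed

lemma
  assumes z: "z \<in> unit_disc" and w: "w \<in> unit_disc"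
  shows green_g_pos: "0 < green_g z w" and green_g_le_1: "green_g z w \<le> 1"
    and green_g_less_1: "z \<noteq> w \<Longrightarrow> green_g z w < 1"
proof -
  show "0 < green_g z w"
    using one_minus_norm_square_pos[OF z] one_minus_norm_square_pos[OF w] one_minus_cnj_mult(7)[OF z w]
    by (simp add: green_g_def)
  show "green_g z w \<le> 1"
    using one_minus_green_g[OF z w] by (smt (verit) divide_nonneg_nonneg zero_le_power2)
  show "green_g z w < 1" if "z \<noteq> w"
    using one_minus_green_g[OF z w] that one_minus_cnj_mult(7)[OF z w]
    by (smt (verit) divide_pos_pos zero_less_norm_iff zero_less_power right_minus_eq)
qed

text \<open>The derivative of s^(\<alpha>+1) (1 - s)^(-1/4), relative to the integrand of h,
  contains (\<alpha> + 1)(1 - s) + s/4, a convex combination of \<alpha> + 1 and 1/4. The constant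
  is the reciprocal of the smaller of the two.\<close>

definition green_h_const :: "real \<Rightarrow> real"
  where "green_h_const \<alpha> = 1 / min (\<alpha> + 1) (1 / 4)"

text \<open>The bound for h at s = g, multiplied by |1 - z cnj w|^\<alpha>. The exponent of |1 - z
  cnj w| collects \<alpha> from the power, -2 (\<alpha> + 1) from g^(\<alpha>+1) and 1/2 from (1 -
  g)^(-1/4).\<close>

definition green_majorant :: "real \<Rightarrow> complex \<Rightarrow> complex \<Rightarrow> real"
  where "green_majorant \<alpha> z w = green_h_const \<alpha> * (1 - (norm z)\<^sup>2) powr (\<alpha> + 1)
    * (1 - (norm w)\<^sup>2) powr (\<alpha> + 1) * norm (1 - z * cnj w) powr (- \<alpha> - 3 / 2) * norm (z - w) powr (- 1 / 2)"

context
  fixes \<alpha> :: real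
  assumes \<alpha>: "-1 < \<alpha>"
begin

section \<open>The profile h\<close>

lemma green_h_const_pos: "0 < green_h_const \<alpha>"
  using \<alpha> by (simp add: green_h_const_def)

lemma green_h_integrable:
  assumes "0 \<le> s" "s < 1"
  shows "set_integrable lborel {0..s} (\<lambda>t. t powr \<alpha> / (1 - t))"
proof -
  have "set_integrable lborel {0..s} (\<lambda>t. t powr \<alpha>)"
    unfolding set_integrable_def
  proof (rule integrableI_nn_integral_finite)
    have "(\<integral>\<^sup>+ t. ennreal (indicator {0..s} t *\<^sub>R t powr \<alpha>) \<partial>lborel)
        = (\<integral>\<^sup>+ t. ennreal (t powr \<alpha>) * indicator {0..s} t \<partial>lborel)"
      by (intro nn_integral_cong) (auto split: split_indicator)
    then show "(\<integral>\<^sup>+ t. ennreal (indicator {0..s} t *\<^sub>R t powr \<alpha>) \<partial>lborel) = ennreal (s powr (\<alpha> + 1) / (\<alpha> + 1))"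
      using nn_integral_powr_from_0[OF \<alpha> assms(1)] by simp
  qed auto
  then have "integrable lborel (\<lambda>t. (1 / (1 - s)) * (indicator {0..s} t *\<^sub>R t powr \<alpha>))"
    unfolding set_integrable_def by (rule integrable_mult_right)
  then show ?thesis
    unfolding set_integrable_def
  proof (rule Bochner_Integration.integrable_bound)
    show "AE t in lborel. norm (indicator {0..s} t *\<^sub>R (t powr \<alpha> / (1 - t)))
        \<le> norm (1 / (1 - s) * (indicator {0..s} t *\<^sub>R t powr \<alpha>))"
      using assms by (intro AE_I2) (auto split: split_indicator intro!: divide_left_mono)
  qed auto
qed

lemma green_h_eq_integral:
  assumes "0 \<le> s" "s < 1"
  shows "green_h \<alpha> s = integral {0..s} (\<lambda>t. t powr \<alpha> / (1 - t))"
    and "(\<lambda>t. t powr \<alpha> / (1 - t)) integrable_on {0..s}"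
  unfolding green_h_def using set_borel_integral_eq_integral[OF green_h_integrable[OF assms]] by auto

lemma green_h_has_derivative:
  assumes "0 < s" "s < 1"
  shows "(green_h \<alpha> has_real_derivative s powr \<alpha> / (1 - s)) (at s)"
proof -
  \<comment> \<open>The interval from \<open>a\<close> to \<open>b\<close> keeps away from 0, where
    t^\<alpha> may blow up, and from 1, where the denominator vanishes. Only the part of the
    integral beyond \<open>a\<close> is differentiated.\<close>
  define a b where "a = s / 2" and "b = (s + 1) / 2"
  have ab: "0 < a" "a < s" "s < b" "b < 1"
    using assms by (auto simp: a_def b_def)
  let ?f = "\<lambda>t. t powr \<alpha> / (1 - t)"
  have "continuous_on {a..b} ?f"
    using ab by (intro continuous_intros) auto
  then have "((\<lambda>x. integral {a..x} ?f) has_real_derivative ?f s) (at s within {a..b})"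
    using ab by (intro integral_has_real_derivative) auto
  then have "((\<lambda>x. integral {a..x} ?f) has_real_derivative ?f s) (at s)"
    using ab by (simp add: at_within_Icc_at)
  then have "((\<lambda>x. green_h \<alpha> a + integral {a..x} ?f) has_real_derivative ?f s) (at s)"
    by (auto intro!: derivative_eq_intros)
  then show ?thesis
  proof (rule has_field_derivative_transform_within_open)
    show "green_h \<alpha> a + integral {a..x} ?f = green_h \<alpha> x" if "x \<in> {a<..<b}" for x
      using that ab green_h_eq_integral[of a] green_h_eq_integral[of x]
        Henstock_Kurzweil_Integration.integral_combine[of 0 a x ?f] by auto
  qed (use ab in auto)
qed

text \<open>The bounding function \<open>H\<close> vanishes at 0, so it is enough to compare the
  integrand of h with \<open>H'\<close>. As \<open>H\<close> need not be differentiable at 0, the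
  fundamental theorem is used with continuity on the closed interval and the derivative
  inside.\<close>

lemma green_h_bound:
  assumes "0 \<le> s" "s < 1"
  shows "0 \<le> green_h \<alpha> s"
    and "green_h \<alpha> s \<le> green_h_const \<alpha> * (s powr (\<alpha> + 1) * (1 - s) powr (- 1 / 4))"
proof -
  define C where "C = green_h_const \<alpha>"
  define m where "m = min (\<alpha> + 1) (1 / 4)"
  have m: "0 < m" "C = 1 / m" "0 < C"
    using \<alpha> by (auto simp: m_def C_def green_h_const_def)
  define H where "H t = C * (t powr (\<alpha> + 1) * (1 - t) powr (- 1 / 4))" for t :: real
  define H' where "H' t = C * ((\<alpha> + 1) * t powr \<alpha> * (1 - t) powr (- 1 / 4)
      + t powr (\<alpha> + 1) * (1 / 4 * (1 - t) powr (- 5 / 4)))" for t :: real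
  show "0 \<le> green_h \<alpha> s"
    unfolding green_h_def set_lebesgue_integral_def
    using assms by (intro integral_nonneg_AE AE_I2) (auto split: split_indicator)
  have deriv: "(H has_real_derivative H' t) (at t)" if "0 < t" "t < 1" for t
  proof -
    have "((\<lambda>t. t powr (\<alpha> + 1)) has_real_derivative (\<alpha> + 1) * t powr \<alpha>) (at t)"
      using has_real_derivative_powr[of t "\<alpha> + 1"] that by simp
    moreover have "((\<lambda>t. 1 - t) has_real_derivative - 1) (at t)"
      by (auto intro!: derivative_eq_intros)
    from DERIV_chain2[OF has_real_derivative_powr this, of "- 1 / 4"]
    have "((\<lambda>t. (1 - t) powr (- 1 / 4)) has_real_derivative 1 / 4 * (1 - t) powr (- 5 / 4)) (at t)"
      using that by simp
    ultimately have "(H has_real_derivative C * ((\<alpha> + 1) * t powr \<alpha> * (1 - t) powr (- 1 / 4)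
        + 1 / 4 * (1 - t) powr (- 5 / 4) * t powr (\<alpha> + 1))) (at t)"
      unfolding H_def by (intro DERIV_cmult DERIV_mult)
    then show ?thesis
      by (simp add: H'_def mult.commute)
  qed
  have "(H' has_integral H s - H 0) {0..s}"
  proof (rule fundamental_theorem_of_calculus_interior[OF assms(1)])
    show "continuous_on {0..s} H"
      unfolding H_def using assms \<alpha> by (intro continuous_intros continuous_on_powr') auto
    show "(H has_vector_derivative H' t) (at t)" if "t \<in> {0<..<s}" for t
      using deriv[of t] that assms by (simp add: has_real_derivative_iff_has_vector_derivative)
  qed
  moreover have "H 0 = 0"
    by (simp add: H_def)
  ultimately have "(H' has_integral H s) {0..s}"
    by simp
  moreover have "t powr \<alpha> / (1 - t) \<le> H' t" if t: "t \<in> {0..s}" for t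
  \<comment> \<open>At t = 0 \<open>powr\<close> returns 0 for every exponent, so that both sides
    are 0.\<close>
  proof (cases "t = 0")
    case False
    define q where "q = (1 - t) powr (- 1 / 4)"
    have t01: "0 < t" "t < 1"
      using t assms False by auto
    have q1: "1 \<le> q"
      unfolding q_def using t01 powr_mono2'[of "- 1 / 4" "1 - t" 1] by simp
    have e: "(1 - t) powr (- 5 / 4) = q / (1 - t)"
      using t01 powr_diff[of "1 - t" "- 1 / 4" 1] by (simp add: q_def)
    have e2: "t powr (\<alpha> + 1) = t powr \<alpha> * t"
      using t01 by (simp add: powr_add)
    have "H' t = (t powr \<alpha> / (1 - t)) * q * (C * ((\<alpha> + 1) * (1 - t) + t / 4))"
      unfolding H'_def e e2 q_def[symmetric] using t01 by (simp add: field_simps)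
    moreover have "1 \<le> C * ((\<alpha> + 1) * (1 - t) + t / 4)"
    proof -
      have "m = m * (1 - t) + m * t"
        by (simp add: algebra_simps)
      also have "\<dots> \<le> (\<alpha> + 1) * (1 - t) + (1 / 4) * t"
        unfolding m_def using t01 by (intro add_mono mult_right_mono min.cobounded1 min.cobounded2) auto
      finally have "C * m \<le> C * ((\<alpha> + 1) * (1 - t) + t / 4)"
        using m by (intro mult_left_mono) auto
      then show ?thesis
        using m by simp
    qed
    then have "1 \<le> q * (C * ((\<alpha> + 1) * (1 - t) + t / 4))"
      using q1 mult_mono[of 1 q 1 "C * ((\<alpha> + 1) * (1 - t) + t / 4)"] by simp
    ultimately show ?thesis
      using t01 mult_left_mono[of 1 "q * (C * ((\<alpha> + 1) * (1 - t) + t / 4))" "t powr \<alpha> / (1 - t)"]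
      by (simp add: mult.assoc)
  qed (simp add: H'_def)
  ultimately have "integral {0..s} (\<lambda>t. t powr \<alpha> / (1 - t)) \<le> H s"
    using integral_le[OF green_h_eq_integral(2)[OF assms], of H'] by (auto simp: has_integral_iff)
  then show "green_h \<alpha> s \<le> C * (s powr (\<alpha> + 1) * (1 - s) powr (- 1 / 4))"
    using green_h_eq_integral(1)[OF assms] by (simp add: H_def)
qed

lemma green_function_bound:
  assumes z: "z \<in> unit_disc" and w: "w \<in> unit_disc" and zw: "z \<noteq> w"
  shows "norm (green_function \<alpha> z w) \<le> green_majorant \<alpha> z w"
proof -
  define g p u where "g = green_g z w" and "p = norm (1 - z * cnj w)" and "u = norm (z - w)"
  have pu: "0 < p" "0 < u"
    using one_minus_cnj_mult(7)[OF z w] zw by (auto simp: p_def u_def)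
  have g: "0 < g" "g < 1"
    using green_g_pos[OF z w] green_g_less_1[OF z w zw] by (auto simp: g_def)
  note zp = one_minus_norm_square_pos[OF z] and wp = one_minus_norm_square_pos[OF w]
  have g1: "g powr (\<alpha> + 1) = (1 - (norm z)\<^sup>2) powr (\<alpha> + 1) * (1 - (norm w)\<^sup>2) powr (\<alpha> + 1) * p powr (- 2 * (\<alpha> + 1))"
  proof -
    have "g = (1 - (norm z)\<^sup>2) * (1 - (norm w)\<^sup>2) * p powr (- 2)"
      using pu by (simp add: g_def green_g_def p_def powr_minus divide_simps)
    then have "g powr (\<alpha> + 1) = (1 - (norm z)\<^sup>2) powr (\<alpha> + 1) * (1 - (norm w)\<^sup>2) powr (\<alpha> + 1) * (p powr (- 2)) powr (\<alpha> + 1)"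
      using zp wp pu by (simp add: powr_mult)
    then show ?thesis
      by (simp only: powr_powr)
  qed
  have g2: "(1 - g) powr (- 1 / 4) = u powr (- 1 / 2) * p powr (1 / 2)"
  proof -
    have "1 - g = u powr 2 * p powr (- 2)"
      using one_minus_green_g[OF z w] pu by (simp add: g_def u_def p_def powr_minus divide_simps)
    then show ?thesis
      using pu by (simp add: powr_mult powr_powr del: powr_numeral)
  qed
  have "norm (green_function \<alpha> z w) = p powr \<alpha> * green_h \<alpha> g"
    unfolding green_function_def norm_mult
    using green_h_bound(1)[of g] g one_minus_cnj_mult(5)[OF z w] by (simp add: norm_powr_real_powr' p_def g_def)
  also have "\<dots> \<le> p powr \<alpha> * (green_h_const \<alpha> * (g powr (\<alpha> + 1) * (1 - g) powr (- 1 / 4)))"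
    using green_h_bound(2)[of g] g by (intro mult_left_mono) auto
  also have "\<dots> = green_h_const \<alpha> * (1 - (norm z)\<^sup>2) powr (\<alpha> + 1)
    * (1 - (norm w)\<^sup>2) powr (\<alpha> + 1) * (p powr \<alpha> * p powr (- 2 * (\<alpha> + 1)) * p powr (1 / 2)) * u powr (- 1 / 2)"
    unfolding g1 g2 by (simp add: mult_ac)
  also have "p powr \<alpha> * p powr (- 2 * (\<alpha> + 1)) * p powr (1 / 2) = p powr (- \<alpha> - 3 / 2)"
    unfolding powr_add[symmetric] by (rule arg_cong[where f="\<lambda>x. p powr x"]) (simp add: field_simps)
  finally show ?thesis
    by (simp add: p_def u_def green_majorant_def)
qed

text \<open>The real derivative of G(., w) in direction \<open>v\<close>. The first term stems from
  the antiholomorphic factor (1 - cnj z w)^\<alpha>, hence \<open>cnj v\<close>. In the second, from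
  h(g), the pole 1 / (1 - g) of h' has cancelled against the factor 1 - g in the derivative of
  g.\<close>

definition green_deriv :: "complex \<Rightarrow> complex \<Rightarrow> complex \<Rightarrow> complex"
  where "green_deriv w z v =
    - of_real \<alpha> * w * cnj v * (1 - cnj z * w) powr (of_real \<alpha> - 1) * of_real (green_h \<alpha> (green_g z w))
    - (1 - cnj z * w) powr of_real \<alpha> * of_real (green_g z w powr \<alpha> * (2 * (1 - (norm w)\<^sup>2) *
        Re (v / ((z - w) * (1 - z * cnj w)))))"

lemma green_function_has_derivative:
  assumes z: "z \<in> unit_disc" and w: "w \<in> unit_disc" and zw: "z \<noteq> w"
  shows "((\<lambda>z. green_function \<alpha> z w) has_derivative green_deriv w z) (at z)"
proof -
  define u p where "u = z - w" and "p = 1 - z * cnj w"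
  have u0: "u \<noteq> 0" and p0: "p \<noteq> 0"
    using zw one_minus_cnj_mult(7)[OF z w] by (auto simp: u_def p_def)
  define P' where "P' v = - of_real \<alpha> * w * cnj v * (1 - cnj z * w) powr (of_real \<alpha> - 1)" for v
  have "1 - cnj z * w \<notin> \<real>\<^sub>\<le>\<^sub>0"
    using one_minus_cnj_mult(2)[OF z w] by (auto simp: complex_nonpos_Reals_iff)
  then have "((\<lambda>x. x powr of_real \<alpha>) has_derivative
      (\<lambda>h. of_real \<alpha> * (1 - cnj z * w) powr (of_real \<alpha> - 1) * h)) (at (1 - cnj z * w))"
    using has_field_derivative_powr[of "1 - cnj z * w" "of_real \<alpha>"] by (simp add: has_field_derivative_def)
  moreover have "((\<lambda>z. 1 - cnj z * w) has_derivative (\<lambda>v. - cnj v * w)) (at z)"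
    by (auto intro!: derivative_eq_intros)
  ultimately have "((\<lambda>z. (1 - cnj z * w) powr of_real \<alpha>) has_derivative
      (\<lambda>v. of_real \<alpha> * (1 - cnj z * w) powr (of_real \<alpha> - 1) * (- cnj v * w))) (at z)"
    by (rule has_derivative_compose[where f="\<lambda>z. 1 - cnj z * w" and g="\<lambda>x. x powr of_real \<alpha>", rotated])
  then have P: "((\<lambda>z. (1 - cnj z * w) powr of_real \<alpha>) has_derivative P') (at z)"
    by (rule has_derivative_eq_rhs) (simp add: P'_def fun_eq_iff)
  \<comment> \<open>From the logarithmic derivative of 1 - g = |u|^2 / |p|^2, which is 2 Re (v/u + v
    cnj w / p); the identity p + cnj w u = 1 - |w|^2 merges the two fractions.\<close>
  define g' where "g' v = - (1 - green_g z w) * (2 * (1 - (norm w)\<^sup>2) * Re (v / (u * p)))" for v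
  have g': "((\<lambda>z. green_g z w) has_derivative g') (at z)"
  proof -
    let ?N = "\<lambda>z. (norm (z - w))\<^sup>2" and ?D = "\<lambda>z. (norm (1 - z * cnj w))\<^sup>2"
    have N: "(?N has_derivative (\<lambda>v. 2 * Re (v * cnj u))) (at z)"
      unfolding cmod_power2 by (auto intro!: derivative_eq_intros simp: u_def algebra_simps)
    have D: "(?D has_derivative (\<lambda>v. - 2 * Re (v * cnj w * cnj p))) (at z)"
      unfolding cmod_power2 by (auto intro!: derivative_eq_intros simp: p_def algebra_simps)
    have "?D z \<noteq> 0"
      using p0 by (simp add: p_def)
    from has_derivative_diff[OF has_derivative_const[of 1] has_derivative_divide'[OF N D this]]
    have "((\<lambda>z. 1 - ?N z / ?D z) has_derivative
        (\<lambda>v. - ((2 * Re (v * cnj u) * ?D z - ?N z * (- 2 * Re (v * cnj w * cnj p))) / (?D z * ?D z)))) (at z)"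
      by (rule has_derivative_eq_rhs) simp
    moreover have "- ((2 * Re (v * cnj u) * ?D z - ?N z * (- 2 * Re (v * cnj w * cnj p))) / (?D z * ?D z)) = g' v" for v
    proof -
      have Nu: "?N z = (norm u)\<^sup>2" "?D z = (norm p)\<^sup>2"
        by (simp_all add: u_def p_def)
      have r: "Re (v * cnj x) = (norm x)\<^sup>2 * Re (v / x)" if "x \<noteq> 0" for x v
      proof -
        have "v * cnj x = of_real ((norm x)\<^sup>2) * (v / x)"
          using that complex_norm_square[of x] by simp
        then show ?thesis by (simp only: Re_complex_of_real Im_complex_of_real times_complex.sel)
      qed
      have "p + cnj w * u = of_real (1 - (norm w)\<^sup>2)"
        using complex_norm_square[of w] by (simp add: p_def u_def algebra_simps)
      moreover have Re_scale: "Re (of_real s * x) = s * Re x" for s x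
        by simp
      moreover have "v / u + v * cnj w / p = (p + cnj w * u) * (v / (u * p))"
        using u0 p0 by (simp add: field_simps)
      ultimately have "v / u + v * cnj w / p = of_real (1 - (norm w)\<^sup>2) * (v / (u * p))"
        by (simp only:)
      then have "Re (v / u) + Re (v * cnj w / p) = (1 - (norm w)\<^sup>2) * Re (v / (u * p))"
        by (simp only: plus_complex.sel(1)[symmetric] Re_scale)
      moreover have "- ((2 * Re (v * cnj u) * ?D z - ?N z * (- 2 * Re (v * cnj w * cnj p))) / (?D z * ?D z))
          = - ((norm u)\<^sup>2 / (norm p)\<^sup>2) * 2 * (Re (v / u) + Re (v * cnj w / p))"
        unfolding Nu r[OF u0] r[OF p0, of "v * cnj w"] using p0 by (simp add: field_simps)
      ultimately show ?thesis
        using one_minus_green_g[OF z w] by (simp add: g'_def u_def p_def)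
    qed
    ultimately have "((\<lambda>z. 1 - ?N z / ?D z) has_derivative g') (at z)"
      by simp
    then show ?thesis
    proof (rule has_derivative_transform_within_open)
      show "1 - ?N x / ?D x = green_g x w" if "x \<in> unit_disc" for x
        using one_minus_green_g[OF that w] by simp
    qed (use z in auto)
  qed
  have gz: "0 < green_g z w" "green_g z w < 1"
    using green_g_pos[OF z w] green_g_less_1[OF z w zw] by auto
  have "((\<lambda>z. green_h \<alpha> (green_g z w)) has_derivative
      (\<lambda>v. green_g z w powr \<alpha> / (1 - green_g z w) * g' v)) (at z)"
    by (rule has_derivative_compose[OF g' green_h_has_derivative[OF gz, unfolded has_field_derivative_def]])
  then have "((\<lambda>z. complex_of_real (green_h \<alpha> (green_g z w))) has_derivative
      (\<lambda>v. of_real (green_g z w powr \<alpha> / (1 - green_g z w) * g' v))) (at z)"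
    by (rule has_derivative_of_real)
  from has_derivative_mult[OF P this]
  have "((\<lambda>z. green_function \<alpha> z w) has_derivative
     (\<lambda>v. (1 - cnj z * w) powr of_real \<alpha> * of_real (green_g z w powr \<alpha> / (1 - green_g z w) * g' v)
       + P' v * of_real (green_h \<alpha> (green_g z w)))) (at z)"
    by (simp add: green_function_def)
  moreover have "(1 - cnj z * w) powr of_real \<alpha> * of_real (green_g z w powr \<alpha> / (1 - green_g z w) * g' v)
       + P' v * of_real (green_h \<alpha> (green_g z w)) = green_deriv w z v" for v
  proof -
    have "green_g z w powr \<alpha> / (1 - green_g z w) * g' v
        = - (green_g z w powr \<alpha> * (2 * (1 - (norm w)\<^sup>2) * Re (v / (u * p))))"
    proof -
      have "a / (1 - g) * (- (1 - g) * x) = - (a * x)" if "g < 1" for a g x :: real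
        using that by (simp add: divide_simps) (simp add: algebra_simps)
      from this[OF gz(2)] show ?thesis
        unfolding g'_def .
    qed
    then show ?thesis
      unfolding green_deriv_def P'_def u_def p_def by (simp only: of_real_minus) simp
  qed
  ultimately show ?thesis
    by simp
qed

text \<open>The antiholomorphic factor is annihilated by d/dz, so only the term with h' survives.
  There (1 - cnj z w)^\<alpha> = cnj (p^\<alpha>) with p = 1 - z cnj w, and division by |p|^(2
  \<alpha>), which comes from g^\<alpha>, turns it into p^(-\<alpha>). Apart from the factor (1 -
  |z|^2)^\<alpha> the result is holomorphic in z off w.\<close>

lemma wirtinger_green_deriv:
  assumes z: "z \<in> unit_disc" and w: "w \<in> unit_disc" and zw: "z \<noteq> w"
  shows "(green_deriv w z 1 - \<i> * green_deriv w z \<i>) / 2 =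
    - of_real ((1 - (norm z)\<^sup>2) powr \<alpha> * (1 - (norm w)\<^sup>2) powr (\<alpha> + 1)) *
      (1 - z * cnj w) powr (- of_real (\<alpha> + 1)) / (z - w)"
proof -
  define p where "p = 1 - z * cnj w"
  define c where "c = 1 / ((z - w) * p)"
  define A where "A = (1 - cnj z * w) powr of_real \<alpha> * of_real (green_g z w powr \<alpha> * (1 - (norm w)\<^sup>2))"
  define B where "B = - of_real \<alpha> * w * (1 - cnj z * w) powr (of_real \<alpha> - 1) * of_real (green_h \<alpha> (green_g z w))"
  have p0: "p \<noteq> 0"
    using one_minus_cnj_mult(7)[OF z w] by (simp add: p_def)
  have *: "green_deriv w z v = B * cnj v - 2 * A * of_real (Re (v * c))" for v
    unfolding green_deriv_def A_def B_def c_def p_def by (simp add: mult_ac)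
  have "(green_deriv w z 1 - \<i> * green_deriv w z \<i>) / 2 = - A * (of_real (Re c) + \<i> * of_real (Im c))"
    unfolding * by (simp add: field_simps)
  also have "of_real (Re c) + \<i> * of_real (Im c) = c"
    by (simp add: complex_eq_iff)
  also have "- A * c = - ((1 - cnj z * w) powr of_real \<alpha> * of_real (green_g z w powr \<alpha>))
      * of_real (1 - (norm w)\<^sup>2) / (p * (z - w))"
    by (simp add: A_def c_def mult.commute[of p])
  also have "(1 - cnj z * w) powr of_real \<alpha> * of_real (green_g z w powr \<alpha>) =
      of_real ((1 - (norm z)\<^sup>2) powr \<alpha> * (1 - (norm w)\<^sup>2) powr \<alpha>) * p powr (- of_real \<alpha>)"
  proof -
    note zp = one_minus_norm_square_pos[OF z] and wp = one_minus_norm_square_pos[OF w]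
    have pre: "0 \<le> Re p"
      using one_minus_cnj_mult(1)[OF z w] by (simp add: p_def)
    \<comment> \<open>Conjugation commutes with the principal power in the right half-plane.\<close>
    have c1: "(1 - cnj z * w) powr of_real \<alpha> = cnj (p powr of_real \<alpha>)"
      using pre by (subst cnj_powr) (simp_all add: p_def)
    have A: "green_g z w powr \<alpha> = (1 - (norm z)\<^sup>2) powr \<alpha> * (1 - (norm w)\<^sup>2) powr \<alpha> / (norm p) powr (2 * \<alpha>)"
      using zp wp p0 by (simp add: green_g_def p_def powr_divide powr_mult powr_powr[of _ 2, symmetric])
    have B: "cnj (p powr of_real \<alpha>) * p powr of_real \<alpha> = of_real (norm p powr (2 * \<alpha>))"
    proof -
      have "cnj (p powr of_real \<alpha>) * p powr of_real \<alpha> = of_real ((norm (p powr of_real \<alpha>))\<^sup>2)"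
        using complex_norm_square[of "p powr of_real \<alpha>"] by (simp add: mult.commute)
      also have "norm (p powr of_real \<alpha>) = norm p powr \<alpha>"
        by (simp add: norm_powr_real_powr')
      also have "(norm p powr \<alpha>)\<^sup>2 = norm p powr (2 * \<alpha>)"
        by (simp add: powr_add[symmetric] power2_eq_square)
      finally show ?thesis .
    qed
    have C: "cnj P * of_real (a / n) = of_real a * inverse P"
      if "cnj P * P = of_real n" "P \<noteq> 0" for P :: complex and a n :: real
    proof -
      have "of_real n \<noteq> (0 :: complex)"
        using that by (metis complex_cnj_zero_iff mult_eq_0_iff)
      then have "cnj P * of_real (a / n) = cnj P * P * of_real a / (of_real n * P)"
        using that(2) by simp
      also have "\<dots> = of_real a * inverse P"
        unfolding that(1) using \<open>of_real n \<noteq> (0 :: complex)\<close> by (simp add: divide_inverse)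
      finally show ?thesis .
    qed
    show ?thesis
      unfolding c1 powr_minus A by (rule C[OF B]) (simp add: p0)
  qed
  also have "- (of_real ((1 - (norm z)\<^sup>2) powr \<alpha> * (1 - (norm w)\<^sup>2) powr \<alpha>) * p powr (- of_real \<alpha>))
      * of_real (1 - (norm w)\<^sup>2) / (p * (z - w))
      = - of_real ((1 - (norm z)\<^sup>2) powr \<alpha> * ((1 - (norm w)\<^sup>2) powr \<alpha> * (1 - (norm w)\<^sup>2))) *
      (p powr (- of_real \<alpha>) / p) / (z - w)"
    by simp
  also have "(1 - (norm w)\<^sup>2) powr \<alpha> * (1 - (norm w)\<^sup>2) = (1 - (norm w)\<^sup>2) powr (\<alpha> + 1)"
    using one_minus_norm_square_pos[OF w] by (simp add: powr_add)
  also have "p powr (- of_real \<alpha>) / p = p powr (- of_real (\<alpha> + 1))"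
    using powr_diff[of p "- of_real \<alpha>" 1] p0 by simp
  finally show ?thesis
    unfolding p_def .
qed

end

section \<open>Test functions and integration by parts\<close>

lemma
  assumes "(f has_derivative D) (at z)"
  shows deriv_x_eq: "deriv_x f z = D 1" and deriv_y_eq: "deriv_y f z = D \<i>"
  using frechet_derivative_at[OF assms] by (simp_all add: deriv_x_def deriv_y_def)

lemma
  assumes "(f has_derivative D) (at z)"
  shows wirtinger_eq: "wirtinger f z = (D 1 - \<i> * D \<i>) / 2"
    and wirtinger_bar_eq: "wirtinger_bar f z = (D 1 + \<i> * D \<i>) / 2"
  by (simp_all add: wirtinger_def wirtinger_bar_def deriv_x_eq[OF assms] deriv_y_eq[OF assms])

lemma has_derivative_complex_expand:
  fixes f :: "complex \<Rightarrow> complex"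
  assumes "(f has_derivative D) F"
  shows "D v = of_real (Re v) * D 1 + of_real (Im v) * D \<i>"
proof -
  interpret linear D by (rule has_derivative_linear[OF assms])
  have "D v = D (Re v *\<^sub>R 1 + Im v *\<^sub>R \<i>)"
    by (rule arg_cong[where f=D]) (simp add: complex_eq_iff)
  then show ?thesis
    unfolding add scale by (simp add: scaleR_conv_of_real)
qed

lemma differentiable_has_derivative_xy:
  assumes "f differentiable (at z)"
  shows "(f has_derivative (\<lambda>v. of_real (Re v) * deriv_x f z + of_real (Im v) * deriv_y f z)) (at z)"
proof -
  obtain D where D: "(f has_derivative D) (at z)"
    using assms by (auto simp: differentiable_def)
  then show ?thesis
    by (rule has_derivative_eq_rhs)
       (rule ext, simp add: deriv_x_eq[OF D] deriv_y_eq[OF D] has_derivative_complex_expand[OF D, symmetric])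
qed

lemma
  assumes "open U" "z \<in> U" "\<And>x. x \<in> U \<Longrightarrow> f x = 0"
  shows deriv_x_zero_on_open: "deriv_x f z = 0" and deriv_y_zero_on_open: "deriv_y f z = 0"
    and has_derivative_zero_on_open: "(f has_derivative (\<lambda>v. 0)) (at z)"
proof -
  show "(f has_derivative (\<lambda>v. 0)) (at z)"
    by (rule has_derivative_transform_within_open[of "\<lambda>_. 0", OF _ assms(1,2)]) (auto simp: assms(3))
  then show "deriv_x f z = 0" "deriv_y f z = 0"
    by (rule deriv_x_eq, rule deriv_y_eq)
qed

section \<open>Calculus of continuously differentiable functions\<close>

lemma times_cont_diff_Suc_D: "times_cont_diff (Suc k) f \<Longrightarrow> times_cont_diff k f"
proof (induction k arbitrary: f)
  case 0
  then show ?case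
    using differentiable_imp_continuous_within[of f _ UNIV] by (simp add: continuous_on_eq_continuous_within)
next
  case (Suc k)
  have "times_cont_diff (Suc k) (deriv_x f)" "times_cont_diff (Suc k) (deriv_y f)" and d: "\<forall>z. f differentiable (at z)"
    using Suc.prems by simp_all
  then have "times_cont_diff k (deriv_x f)" "times_cont_diff k (deriv_y f)"
    by (blast intro: Suc.IH)+
  with d show ?case
    by simp
qed

lemma times_cont_diff_const: "times_cont_diff k (\<lambda>z. c)"
proof (induction k arbitrary: c)
  case (Suc k)
  have "deriv_x (\<lambda>z. c) = (\<lambda>z. 0)" "deriv_y (\<lambda>z. c) = (\<lambda>z. 0)"
    by (rule ext, rule deriv_x_eq[OF has_derivative_const], rule ext, rule deriv_y_eq[OF has_derivative_const])
  then show ?case using Suc by simp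
qed auto

lemma times_cont_diff_add:
  "times_cont_diff k f \<Longrightarrow> times_cont_diff k g \<Longrightarrow> times_cont_diff k (\<lambda>z. f z + g z)"
proof (induction k arbitrary: f g)
  case (Suc k)
  have D: "((\<lambda>z. f z + g z) has_derivative (\<lambda>v. of_real (Re v) * deriv_x f z + of_real (Im v) * deriv_y f z
      + (of_real (Re v) * deriv_x g z + of_real (Im v) * deriv_y g z))) (at z)" for z
    using Suc.prems by (intro has_derivative_add differentiable_has_derivative_xy) auto
  have "deriv_x (\<lambda>z. f z + g z) = (\<lambda>z. deriv_x f z + deriv_x g z)"
    "deriv_y (\<lambda>z. f z + g z) = (\<lambda>z. deriv_y f z + deriv_y g z)"
    by (auto simp: fun_eq_iff deriv_x_eq[OF D] deriv_y_eq[OF D])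
  then show ?case
    using Suc.IH[of "deriv_x f" "deriv_x g"] Suc.IH[of "deriv_y f" "deriv_y g"] Suc.prems D
    by (auto simp: differentiable_def)
qed (auto intro!: continuous_intros)

lemma times_cont_diff_mult:
  "times_cont_diff k f \<Longrightarrow> times_cont_diff k g \<Longrightarrow> times_cont_diff k (\<lambda>z. f z * g z)"
proof (induction k arbitrary: f g)
  case (Suc k)
  have D: "((\<lambda>z. f z * g z) has_derivative (\<lambda>v. f z * (of_real (Re v) * deriv_x g z + of_real (Im v) * deriv_y g z)
      + (of_real (Re v) * deriv_x f z + of_real (Im v) * deriv_y f z) * g z)) (at z)" for z
    using Suc.prems by (intro has_derivative_mult differentiable_has_derivative_xy) auto
  have "deriv_x (\<lambda>z. f z * g z) = (\<lambda>z. f z * deriv_x g z + deriv_x f z * g z)"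
    "deriv_y (\<lambda>z. f z * g z) = (\<lambda>z. f z * deriv_y g z + deriv_y f z * g z)"
    by (auto simp: fun_eq_iff deriv_x_eq[OF D] deriv_y_eq[OF D])
  moreover have "times_cont_diff k f" "times_cont_diff k g"
    using Suc.prems by (auto intro: times_cont_diff_Suc_D simp del: times_cont_diff.simps)
  ultimately show ?case
    using Suc D by (auto simp: differentiable_def intro!: times_cont_diff_add)
qed (auto intro!: continuous_intros)

lemma times_cont_diff_wirtinger_bar:
  assumes "times_cont_diff (Suc k) f"
  shows "times_cont_diff k (wirtinger_bar f)"
proof -
  have eq: "wirtinger_bar f = (\<lambda>z. (1 / 2) * (deriv_x f z + \<i> * deriv_y f z))"
    by (auto simp: wirtinger_bar_def)
  show ?thesis
    unfolding eq
    by (rule times_cont_diff_mult[OF times_cont_diff_const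
        times_cont_diff_add[OF _ times_cont_diff_mult[OF times_cont_diff_const]]])
       (use assms in simp_all)
qed

text \<open>Continuity is asked for inside the disc only, since powers of 1 - |z|^2 are not
  controlled on the circle and beyond; vanishing from radius \<open>\<rho>\<close> on takes care of
  the rest.\<close>

lemma bounded_on_disc_of_support:
  fixes f :: "complex \<Rightarrow> complex"
  assumes "continuous_on unit_disc f" "\<rho> < 1" "\<And>z. \<rho> \<le> norm z \<Longrightarrow> f z = 0"
  obtains C where "0 < C" "\<And>z. norm (f z) \<le> C"
proof -
  have "bounded (f ` cball 0 \<rho>)"
    using assms(2)
    by (intro compact_imp_bounded compact_continuous_image continuous_on_subset[OF assms(1)]) auto
  then obtain C where C: "0 < C" "\<And>z. z \<in> cball 0 \<rho> \<Longrightarrow> norm (f z) \<le> C"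
    by (auto simp: bounded_pos)
  have "norm (f z) \<le> C" for z
    using C(2)[of z] C(1) assms(3)[of z] by (cases "norm z \<le> \<rho>") auto
  with C(1) show ?thesis by (rule that)
qed

lemma continuous_on_of_support:
  fixes f :: "complex \<Rightarrow> complex"
  assumes f: "continuous_on unit_disc f" and "\<rho> < 1" "\<And>z. \<rho> \<le> norm z \<Longrightarrow> f z = 0"
  shows "continuous_on UNIV f"
proof -
  have "continuous_on {z. \<rho> < norm z} f"
    using assms(3) by (subst continuous_on_cong[where g="\<lambda>_. 0"]) auto
  then have "continuous_on (unit_disc \<union> {z. \<rho> < norm z}) f"
    by (intro continuous_on_open_Un f open_Collect_less continuous_intros) auto
  also have "unit_disc \<union> {z. \<rho> < norm z} = UNIV"
    using assms(2) by auto
  finally show ?thesis .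
qed

section \<open>The inner factor of \<open>L_bar\<close>\<close>

lemma deriv_one_minus_norm_powr:
  assumes "z \<in> unit_disc"
  shows "((\<lambda>z. complex_of_real ((1 - (norm z)\<^sup>2) powr a)) has_derivative
    (\<lambda>v. of_real (- 2 * a * (1 - (norm z)\<^sup>2) powr (a - 1) * Re (cnj z * v)))) (at z)"
proof -
  have "((\<lambda>z. 1 - (norm z)\<^sup>2) has_derivative (\<lambda>v. - 2 * Re (cnj z * v))) (at z)"
    unfolding cmod_power2 by (auto intro!: derivative_eq_intros simp: algebra_simps)
  from has_derivative_compose[OF this has_real_derivative_powr[OF one_minus_norm_square_pos[OF assms],
      unfolded has_field_derivative_def], of a]
  have "((\<lambda>z. (1 - (norm z)\<^sup>2) powr a) has_derivative
      (\<lambda>v. a * (1 - (norm z)\<^sup>2) powr (a - 1) * (- 2 * Re (cnj z * v)))) (at z)" .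
  from has_derivative_of_real[OF this] show ?thesis
    by (rule has_derivative_eq_rhs) (simp add: fun_eq_iff algebra_simps)
qed

definition weighted_wirtinger_bar :: "real \<Rightarrow> (complex \<Rightarrow> complex) \<Rightarrow> complex \<Rightarrow> complex"
  where "weighted_wirtinger_bar \<alpha> \<phi> z = of_real ((1 - (norm z)\<^sup>2) powr (- \<alpha>)) * wirtinger_bar \<phi> z"

text \<open>The direction comes before the point, so that a fixed direction gives a function on the
  plane to which the lemmas on continuity and support apply. Off the disc the weight has no meaning,
  and 0 is imposed.\<close>

definition weighted_wirtinger_bar_deriv :: "real \<Rightarrow> (complex \<Rightarrow> complex) \<Rightarrow> complex \<Rightarrow> complex \<Rightarrow> complex"
  where "weighted_wirtinger_bar_deriv \<alpha> \<phi> v z =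
    (if z \<in> unit_disc then
      of_real ((1 - (norm z)\<^sup>2) powr (- \<alpha>)) *
        (of_real (Re v) * deriv_x (wirtinger_bar \<phi>) z + of_real (Im v) * deriv_y (wirtinger_bar \<phi>) z)
      + of_real (2 * \<alpha> * (1 - (norm z)\<^sup>2) powr (- \<alpha> - 1) * Re (cnj z * v)) * wirtinger_bar \<phi> z
     else 0)"

lemma has_derivative_weighted_wirtinger_bar:
  assumes \<phi>: "times_cont_diff 2 \<phi>" and z: "z \<in> unit_disc"
  shows "(weighted_wirtinger_bar \<alpha> \<phi> has_derivative (\<lambda>v. weighted_wirtinger_bar_deriv \<alpha> \<phi> v z)) (at z)"
proof -
  have "times_cont_diff (Suc 0) (wirtinger_bar \<phi>)"
    using \<phi> by (intro times_cont_diff_wirtinger_bar) (simp add: eval_nat_numeral)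
  then have "wirtinger_bar \<phi> differentiable (at z)"
    by simp
  from has_derivative_mult[OF deriv_one_minus_norm_powr[OF z, of "- \<alpha>"] differentiable_has_derivative_xy[OF this]]
  show ?thesis
    unfolding weighted_wirtinger_bar_def[abs_def]
    by (rule has_derivative_eq_rhs) (use z in \<open>simp add: fun_eq_iff weighted_wirtinger_bar_deriv_def\<close>)
qed

lemma continuous_on_weighted_wirtinger_bar:
  assumes \<phi>: "times_cont_diff 2 \<phi>"
  shows "continuous_on unit_disc (weighted_wirtinger_bar \<alpha> \<phi>)"
    and "continuous_on unit_disc (weighted_wirtinger_bar_deriv \<alpha> \<phi> v)"
proof -
  have t: "times_cont_diff (Suc 0) (wirtinger_bar \<phi>)"
    using \<phi> by (intro times_cont_diff_wirtinger_bar) (simp add: eval_nat_numeral)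
  have c: "continuous_on A (wirtinger_bar \<phi>)" for A
    using times_cont_diff_Suc_D[OF t] by (auto intro: continuous_on_subset)
  have cx: "continuous_on A (deriv_x (wirtinger_bar \<phi>))" "continuous_on A (deriv_y (wirtinger_bar \<phi>))" for A
    using t by (auto intro: continuous_on_subset)
  have p: "z \<in> unit_disc \<Longrightarrow> 1 - (norm z)\<^sup>2 \<noteq> 0" for z
    using one_minus_norm_square_pos[of z] by auto
  show "continuous_on unit_disc (weighted_wirtinger_bar \<alpha> \<phi>)"
    unfolding weighted_wirtinger_bar_def[abs_def] by (intro continuous_intros c ballI p)
  show "continuous_on unit_disc (weighted_wirtinger_bar_deriv \<alpha> \<phi> v)"
    unfolding weighted_wirtinger_bar_deriv_def[abs_def]
    by (subst continuous_on_cong[OF refl if_P]) (auto intro!: continuous_intros c cx p)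
qed

lemma L_bar_eq:
  assumes \<phi>: "times_cont_diff 2 \<phi>" and z: "z \<in> unit_disc"
  shows "L_bar \<alpha> \<phi> z =
    - (weighted_wirtinger_bar_deriv \<alpha> \<phi> 1 z - \<i> * weighted_wirtinger_bar_deriv \<alpha> \<phi> \<i> z) / 2"
  using wirtinger_eq[OF has_derivative_weighted_wirtinger_bar[OF \<phi> z]]
  by (simp add: L_bar_def weighted_wirtinger_bar_def[abs_def])

lemma test_function_times_cont_diff: "test_function \<phi> \<Longrightarrow> times_cont_diff k \<phi>"
  by (simp add: test_function_def)

text \<open>One radius serves \<open>\<phi>\<close> and everything derived from it, since all of
  these vanish on the open set beyond the support.\<close>

lemma test_function_support:
  assumes "test_function \<phi>"
  obtains \<rho> where "0 < \<rho>" "\<rho> < 1"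
    "\<And>z. \<rho> \<le> norm z \<Longrightarrow> \<phi> z = 0"
    "\<And>z. \<rho> \<le> norm z \<Longrightarrow> deriv_x \<phi> z = 0" "\<And>z. \<rho> \<le> norm z \<Longrightarrow> deriv_y \<phi> z = 0"
    "\<And>z. \<rho> \<le> norm z \<Longrightarrow> wirtinger_bar \<phi> z = 0"
    "\<And>z. \<rho> \<le> norm z \<Longrightarrow> weighted_wirtinger_bar \<alpha> \<phi> z = 0"
    "\<And>z v. \<rho> \<le> norm z \<Longrightarrow> weighted_wirtinger_bar_deriv \<alpha> \<phi> v z = 0"
    "\<And>z. \<rho> \<le> norm z \<Longrightarrow> L_bar \<alpha> \<phi> z = 0"
proof -
  define S where "S = closure {z. \<phi> z \<noteq> 0}"
  have S: "S \<subseteq> unit_disc" "closed S"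
    using assms by (auto simp: S_def test_function_def)
  then have "compact S"
    using bounded_subset[OF bounded_ball] compact_eq_bounded_closed by blast
  obtain r where r: "0 \<le> r" "r < 1" "\<And>z. z \<in> S \<Longrightarrow> norm z \<le> r"
  proof (cases "S = {}")
    case True
    then show ?thesis using that[of 0] by auto
  next
    case False
    then obtain x where "x \<in> S" "\<And>y. y \<in> S \<Longrightarrow> norm y \<le> norm x"
      using continuous_attains_sup[OF \<open>compact S\<close> False, of norm] by (auto intro: continuous_intros)
    then show ?thesis using S that[of "norm x"] by auto
  qed
  have op: "open {z :: complex. r < norm z}"
    by (intro open_Collect_less continuous_intros)
  have 1: "\<phi> z = 0" if "z \<in> {z. r < norm z}" for z
    using r(3)[of z] that closure_subset[of "{z. \<phi> z \<noteq> 0}"] unfolding S_def by force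
  have 2: "deriv_x \<phi> z = 0" "deriv_y \<phi> z = 0" if "z \<in> {z. r < norm z}" for z
    using deriv_x_zero_on_open[OF op that 1] deriv_y_zero_on_open[OF op that 1] by auto
  have 3: "wirtinger_bar \<phi> z = 0" if "z \<in> {z. r < norm z}" for z
    using 2[OF that] by (simp add: wirtinger_bar_def)
  have 4: "deriv_x (wirtinger_bar \<phi>) z = 0" "deriv_y (wirtinger_bar \<phi>) z = 0" if "z \<in> {z. r < norm z}" for z
    using deriv_x_zero_on_open[OF op that 3] deriv_y_zero_on_open[OF op that 3] by auto
  have 5: "weighted_wirtinger_bar \<alpha> \<phi> z = 0" if "z \<in> {z. r < norm z}" for z
    using 3[OF that] by (simp add: weighted_wirtinger_bar_def)
  have 6: "L_bar \<alpha> \<phi> z = 0" if "z \<in> {z. r < norm z}" for z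
    using deriv_x_zero_on_open[OF op that 5] deriv_y_zero_on_open[OF op that 5]
    by (simp add: L_bar_def wirtinger_def weighted_wirtinger_bar_def[abs_def])
  \<comment> \<open>Derivatives are known to vanish on the open set r < |z|, while the claims
    include |z| = \<open>\<rho>\<close>; the midpoint of r and 1 leaves room for this.\<close>
  show ?thesis
    by (rule that[of "(r + 1) / 2"])
       (use r 1 2 3 4 5 6 in \<open>auto simp: weighted_wirtinger_bar_deriv_def\<close>)
qed

lemma continuous_on_L_bar:
  assumes "test_function \<phi>"
  shows "continuous_on UNIV (L_bar \<alpha> \<phi>)"
proof -
  obtain \<rho> where \<rho>: "\<rho> < 1" "\<And>z. \<rho> \<le> norm z \<Longrightarrow> L_bar \<alpha> \<phi> z = 0"
    using test_function_support[OF assms, of \<alpha>] by metis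
  note t = test_function_times_cont_diff[OF assms, of 2]
  show ?thesis
  proof (rule continuous_on_of_support[OF _ \<rho>])
    show "continuous_on unit_disc (L_bar \<alpha> \<phi>)"
      by (subst continuous_on_cong[OF refl L_bar_eq[OF t]])
         (auto intro!: continuous_intros continuous_on_weighted_wirtinger_bar t)
  qed
qed

lemma borel_measurable_punctured:
  fixes f :: "complex \<Rightarrow> complex"
  assumes f: "continuous_on (unit_disc - {w}) f" and zero: "\<And>z. z \<notin> unit_disc \<Longrightarrow> f z = 0"
  shows "f \<in> borel_measurable borel"
proof -
  have "(\<lambda>z. indicator (unit_disc - {w}) z *\<^sub>R f z) \<in> borel_measurable borel"
    by (rule borel_measurable_continuous_on_indicator[OF _ f]) auto
  then have "(\<lambda>z. if z = w then f w else indicator (unit_disc - {w}) z *\<^sub>R f z) \<in> borel_measurable borel"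
    by measurable
  also have "(\<lambda>z. if z = w then f w else indicator (unit_disc - {w}) z *\<^sub>R f z) = f"
    using zero by (auto simp: fun_eq_iff indicator_def)
  finally show ?thesis .
qed

section \<open>Bounds on compact subsets of the disc\<close>

context
  fixes \<alpha> :: real
  assumes \<alpha>: "-1 < \<alpha>"
begin

lemma green_majorant_local_bound:
  assumes z: "norm z \<le> \<rho>" and \<rho>: "\<rho> < 1" and w: "w \<in> unit_disc" and zw: "z \<noteq> w"
  shows "green_majorant \<alpha> z w \<le>
    2 * green_h_const \<alpha> * (1 - \<rho>) powr (- \<alpha> - 3 / 2) * (1 - (norm w)\<^sup>2) powr (\<alpha> + 1) / norm (z - w)"
proof -
  have zd: "z \<in> unit_disc"
    using z \<rho> by auto
  have 1: "(1 - (norm z)\<^sup>2) powr (\<alpha> + 1) \<le> 1"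
    using one_minus_norm_square_pos[OF zd] \<alpha> by (intro powr_le1) auto
  have 2: "norm (1 - z * cnj w) powr (- \<alpha> - 3 / 2) \<le> (1 - \<rho>) powr (- \<alpha> - 3 / 2)"
    using one_minus_cnj_mult(3)[OF zd w] z \<rho> \<alpha> by (intro powr_mono2') auto
  \<comment> \<open>The singularity is deliberately weakened to that of the Cauchy kernel, by |z -
    w|^(-1/2) = |z - w|^(1/2) / |z - w|, so that the estimate of 1 / |z - w| over the disc
    applies.\<close>
  have 3: "norm (z - w) powr (- 1 / 2) \<le> 2 / norm (z - w)"
  proof -
    have "norm (z - w) \<le> 2 * 2"
      using norm_triangle_ineq4[of z w] zd w by auto
    then have "sqrt (norm (z - w)) \<le> sqrt (2 * 2)"
      by (rule real_sqrt_le_mono)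
    then have "sqrt (norm (z - w)) \<le> 2"
      by simp
    moreover have "norm (z - w) powr (- 1 / 2) = sqrt (norm (z - w)) / norm (z - w)"
      using zw by (simp add: powr_minus powr_half_sqrt field_simps)
    ultimately show ?thesis
      by (simp add: divide_right_mono)
  qed
  have "green_majorant \<alpha> z w = green_h_const \<alpha> * (1 - (norm z)\<^sup>2) powr (\<alpha> + 1) * (1 - (norm w)\<^sup>2) powr (\<alpha> + 1)
      * norm (1 - z * cnj w) powr (- \<alpha> - 3 / 2) * norm (z - w) powr (- 1 / 2)"
    by (simp add: green_majorant_def)
  also have "\<dots> \<le> green_h_const \<alpha> * 1 * (1 - (norm w)\<^sup>2) powr (\<alpha> + 1) * (1 - \<rho>) powr (- \<alpha> - 3 / 2) * (2 / norm (z - w))"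
    using green_h_const_pos[OF \<alpha>] by (intro mult_mono 1 2 3) auto
  finally show ?thesis
    by (simp add: mult_ac)
qed

lemma green_function_local_bound:
  assumes z: "norm z \<le> \<rho>" and \<rho>: "\<rho> < 1" and w: "w \<in> unit_disc" and zw: "z \<noteq> w"
  shows "norm (green_function \<alpha> z w) \<le>
    2 * green_h_const \<alpha> * (1 - \<rho>) powr (- \<alpha> - 3 / 2) * (1 - (norm w)\<^sup>2) powr (\<alpha> + 1) / norm (z - w)"
  using green_function_bound[OF \<alpha> _ w zw] green_majorant_local_bound[OF assms] z \<rho> by simp

text \<open>The derivative is integrated in z for fixed \<open>w\<close> only, so the constant may
  depend on \<open>w\<close>.\<close>

lemma green_deriv_local_bound:
  assumes \<rho>: "0 \<le> \<rho>" "\<rho> < 1" and w: "w \<in> unit_disc"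
  obtains C where "\<And>z v. norm z \<le> \<rho> \<Longrightarrow> z \<noteq> w \<Longrightarrow> norm v = 1 \<Longrightarrow> norm (green_deriv \<alpha> w z v) \<le> C / norm (z - w)"
proof -
  define K where "K = 2 * green_h_const \<alpha> * (1 - \<rho>) powr (- \<alpha> - 3 / 2) * (1 - (norm w)\<^sup>2) powr (\<alpha> + 1)"
  \<comment> \<open>A lower bound for g, from |1 - z cnj w| \<le> 2. Together with g \<le> 1 it
    controls g^\<alpha> also for negative \<alpha>.\<close>
  define m where "m = (1 - \<rho>\<^sup>2) * (1 - (norm w)\<^sup>2) / 4"
  define A where "A = (1 - \<rho>) powr (\<alpha> - 1) + 2 powr (\<alpha> - 1)"
  define B where "B = m powr \<alpha> + 1 powr \<alpha>"
  define C where "C = \<bar>\<alpha>\<bar> * (1 / (1 - \<rho>)) * K + A * (B * 2)"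
  note wp = one_minus_norm_square_pos[OF w]
  have "norm (green_deriv \<alpha> w z v) \<le> C / norm (z - w)" if z: "norm z \<le> \<rho>" and zw: "z \<noteq> w" and v: "norm v = 1" for z v
  proof -
    have zd: "z \<in> unit_disc"
      using z \<rho> by auto
    define p u where "p = norm (1 - z * cnj w)" and "u = norm (z - w)"
    have u: "0 < u" using zw by (simp add: u_def)
    have p: "1 - \<rho> \<le> p" "p \<le> 2" "0 < p"
      using one_minus_cnj_mult(3,4)[OF zd w] z \<rho> by (auto simp: p_def)
    have g: "m \<le> green_g z w" "green_g z w \<le> 1"
    proof -
      have "(norm z)\<^sup>2 \<le> \<rho>\<^sup>2"
        using z by (intro power_mono) auto
      moreover have "p\<^sup>2 \<le> 2\<^sup>2"
        using p by (intro power_mono) auto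
      ultimately show "m \<le> green_g z w"
        unfolding m_def green_g_def p_def[symmetric] using wp p \<rho> w
        by (intro frac_le mult_right_mono mult_nonneg_nonneg) (auto simp: abs_square_le_1)
      show "green_g z w \<le> 1"
        by (rule green_g_le_1[OF zd w])
    qed
    have m: "0 < m"
      using wp \<rho> by (auto simp: m_def power_less_one_iff abs_square_less_1 intro!: mult_pos_pos)
    have n: "norm ((1 - cnj z * w) powr of_real a) = p powr a" for a
      using one_minus_cnj_mult(5)[OF zd w] by (simp add: norm_powr_real_powr' p_def)
    have pa: "p powr \<alpha> = p powr (\<alpha> - 1) * p"
      using p by (simp add: powr_diff)
    have "norm (of_real \<alpha> * w * cnj v * (1 - cnj z * w) powr (of_real \<alpha> - 1) * of_real (green_h \<alpha> (green_g z w)))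
        \<le> \<bar>\<alpha>\<bar> * (1 / (1 - \<rho>)) * (K / u)"
    proof -
      have "norm ((1 - cnj z * w) powr (of_real \<alpha> - 1)) = p powr (\<alpha> - 1)"
        using n[of "\<alpha> - 1"] by simp
      then have "norm (of_real \<alpha> * w * cnj v * (1 - cnj z * w) powr (of_real \<alpha> - 1) * of_real (green_h \<alpha> (green_g z w)))
          = \<bar>\<alpha>\<bar> * norm w * (1 / p) * (p powr \<alpha> * \<bar>green_h \<alpha> (green_g z w)\<bar>)"
        unfolding pa using p v by (simp add: norm_mult)
      \<comment> \<open>The term with h is read off from the bound for G itself: |1 - z cnj
        w|^(\<alpha>-1) h = |G| / |1 - z cnj w|.\<close>
      also have "p powr \<alpha> * \<bar>green_h \<alpha> (green_g z w)\<bar> = norm (green_function \<alpha> z w)"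
        by (simp add: green_function_def norm_mult n)
      also have "\<bar>\<alpha>\<bar> * norm w * (1 / p) * norm (green_function \<alpha> z w) \<le> \<bar>\<alpha>\<bar> * 1 * (1 / (1 - \<rho>)) * (K / u)"
        using green_function_local_bound[OF z \<rho>(2) w zw] w p \<rho>
        by (intro mult_mono frac_le) (auto simp: K_def u_def)
      finally show ?thesis by simp
    qed
    moreover have "norm ((1 - cnj z * w) powr of_real \<alpha> * of_real (green_g z w powr \<alpha> * (2 * (1 - (norm w)\<^sup>2) *
        Re (v / ((z - w) * (1 - z * cnj w)))))) \<le> A * (B * 2) / u"
    proof -
      have re: "\<bar>Re (v / ((z - w) * (1 - z * cnj w)))\<bar> \<le> 1 / (u * p)"
        using abs_Re_le_cmod[of "v / ((z - w) * (1 - z * cnj w))"] v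
        by (simp add: norm_divide norm_mult u_def p_def)
      have "norm ((1 - cnj z * w) powr of_real \<alpha> * of_real (green_g z w powr \<alpha> * (2 * (1 - (norm w)\<^sup>2) *
        Re (v / ((z - w) * (1 - z * cnj w))))))
        = p powr \<alpha> * (green_g z w powr \<alpha> * (2 * (1 - (norm w)\<^sup>2) * \<bar>Re (v / ((z - w) * (1 - z * cnj w)))\<bar>))"
        using wp unfolding norm_mult n norm_of_real abs_mult by simp
      also have "\<dots> \<le> p powr \<alpha> * (B * (2 * 1 * (1 / (u * p))))"
        using wp re m g powr_le_sum[OF m g, of \<alpha>]
        by (intro mult_left_mono mult_mono) (auto simp: B_def)
      also have "\<dots> = p powr (\<alpha> - 1) * (B * 2) / u"
        using p u by (simp add: pa)
      also have "\<dots> \<le> A * (B * 2) / u"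
        using powr_le_sum[of "1 - \<rho>" p 2 "\<alpha> - 1"] p \<rho> u
        by (intro divide_right_mono mult_right_mono) (auto simp: A_def B_def)
      finally show ?thesis .
    qed
    ultimately have "norm (green_deriv \<alpha> w z v) \<le> \<bar>\<alpha>\<bar> * (1 / (1 - \<rho>)) * (K / u) + A * (B * 2) / u"
      unfolding green_deriv_def[OF \<alpha>]
      by (intro order_trans[OF norm_triangle_ineq4] add_mono) simp_all
    also have "\<dots> = C / u"
      by (simp add: C_def add_divide_distrib)
    finally show ?thesis by (simp add: u_def)
  qed
  then show ?thesis by (rule that)
qed

lemma continuous_on_green_function:
  assumes w: "w \<in> unit_disc"
  shows "continuous_on (unit_disc - {w}) (\<lambda>z. green_function \<alpha> z w)"
    and "continuous_on (unit_disc - {w}) (\<lambda>z. green_deriv \<alpha> w z v)"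
proof -
  show "continuous_on (unit_disc - {w}) (\<lambda>z. green_function \<alpha> z w)"
    using has_derivative_continuous[OF green_function_has_derivative[OF \<alpha> _ w]]
    by (intro continuous_at_imp_continuous_on) auto
  have p: "1 - cnj z * w \<noteq> 0" "1 - z * cnj w \<noteq> 0" "1 - cnj z * w \<notin> \<real>\<^sub>\<le>\<^sub>0" if "z \<in> unit_disc" for z
    using one_minus_cnj_mult[OF that w] by (auto simp: complex_nonpos_Reals_iff)
  have pw: "continuous_on (unit_disc - {w}) (\<lambda>z. (1 - cnj z * w) powr c)" for c
  proof (rule continuous_on_compose2[where f="\<lambda>z. 1 - cnj z * w" and g="\<lambda>x. x powr c" and t="- \<real>\<^sub>\<le>\<^sub>0"])
    show "continuous_on (- \<real>\<^sub>\<le>\<^sub>0) (\<lambda>x. x powr c)"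
      by (rule DERIV_continuous_on[OF has_field_derivative_at_within[OF has_field_derivative_powr]]) auto
  qed (use p in \<open>auto intro!: continuous_intros\<close>)
  have g: "continuous_on (unit_disc - {w}) (\<lambda>z. green_g z w)"
    unfolding green_g_def using p by (auto intro!: continuous_intros)
  have h: "continuous_on (unit_disc - {w}) (\<lambda>z. green_h \<alpha> (green_g z w))"
  proof (rule continuous_on_compose2[OF _ g])
    show "continuous_on {0<..<1} (green_h \<alpha>)"
      by (rule DERIV_continuous_on[where D="\<lambda>s. s powr \<alpha> / (1 - s)"])
         (rule has_field_derivative_at_within, rule green_h_has_derivative[OF \<alpha>], auto)
    show "(\<lambda>z. green_g z w) ` (unit_disc - {w}) \<subseteq> {0<..<1}"
      using green_g_pos[OF _ w] green_g_less_1[OF _ w] by (intro image_subsetI) simp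
  qed
  have g0: "\<forall>z\<in>unit_disc - {w}. green_g z w \<noteq> 0"
    using green_g_pos[OF _ w] by fastforce
  have gp: "continuous_on (unit_disc - {w}) (\<lambda>z. green_g z w powr \<alpha>)"
    using g0 by (intro continuous_on_powr g continuous_on_const) auto
  have r: "continuous_on (unit_disc - {w}) (\<lambda>z. Re (v / ((z - w) * (1 - z * cnj w))))"
    using p by (intro continuous_intros) auto
  show "continuous_on (unit_disc - {w}) (\<lambda>z. green_deriv \<alpha> w z v)"
    unfolding green_deriv_def[OF \<alpha>]
    by (intro continuous_on_diff continuous_on_mult continuous_on_minus continuous_on_of_real
        continuous_on_const continuous_on_cnj h gp r pw)
qed

end

text \<open>Integration by parts moves \<open>d/dz\<close> onto the Green's function; what is left is the
  Cauchy--Pompeiu formula for the product of \<open>\<phi>\<close> with a holomorphic function.\<close>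

lemma green_function_L_bar:
  assumes \<alpha>: "-1 < \<alpha>" and \<phi>: "test_function \<phi>" and w: "w \<in> unit_disc"
  shows "(\<integral>z. green_function \<alpha> z w * L_bar \<alpha> \<phi> z \<partial>lborel) = of_real pi * \<phi> w"
proof -
  note t = test_function_times_cont_diff[OF \<phi>]
  obtain \<rho> where \<rho>: "0 < \<rho>" "\<rho> < 1"
    and \<phi>0: "\<And>z. \<rho> \<le> norm z \<Longrightarrow> \<phi> z = 0"
      "\<And>z. \<rho> \<le> norm z \<Longrightarrow> deriv_x \<phi> z = 0" "\<And>z. \<rho> \<le> norm z \<Longrightarrow> deriv_y \<phi> z = 0"
    and "\<And>z. \<rho> \<le> norm z \<Longrightarrow> wirtinger_bar \<phi> z = 0"
    and P0: "\<And>z. \<rho> \<le> norm z \<Longrightarrow> weighted_wirtinger_bar \<alpha> \<phi> z = 0"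
    and P'0: "\<And>z v. \<rho> \<le> norm z \<Longrightarrow> weighted_wirtinger_bar_deriv \<alpha> \<phi> v z = 0"
    and L0: "\<And>z. \<rho> \<le> norm z \<Longrightarrow> L_bar \<alpha> \<phi> z = 0"
    by (rule test_function_support[OF \<phi>, of \<alpha>]) (rule that; assumption)
  define P where "P = weighted_wirtinger_bar \<alpha> \<phi>"
  define P' where "P' = weighted_wirtinger_bar_deriv \<alpha> \<phi>"
  define G where "G z = green_function \<alpha> z w" for z
  define G' where "G' z v = green_deriv \<alpha> w z v" for z v
  note contP = continuous_on_weighted_wirtinger_bar[OF t, of \<alpha>, folded P_def P'_def]
  note contG = continuous_on_green_function[OF \<alpha> w, folded G_def G'_def]
  obtain C1 where C1: "0 < C1" "\<And>z. norm (P z) \<le> C1"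
    by (rule bounded_on_disc_of_support[OF contP(1) \<rho>(2) P0[folded P_def]]) (assumption, rule that)
  have "\<exists>C. 0 < C \<and> (\<forall>z. norm (P' v z) \<le> C)" for v
    by (rule bounded_on_disc_of_support[OF contP(2) \<rho>(2) P'0[folded P'_def]]) (assumption, blast)
  then obtain C2 where C2: "\<And>v. 0 < C2 v" "\<And>z v. norm (P' v z) \<le> C2 v"
    by metis
  define K where "K = 2 * green_h_const \<alpha> * (1 - \<rho>) powr (- \<alpha> - 3 / 2) * (1 - (norm w)\<^sup>2) powr (\<alpha> + 1)"
  have G: "norm (G z) \<le> K / norm (z - w)" if "norm z \<le> \<rho>" "z \<noteq> w" for z
    using green_function_local_bound[OF \<alpha> that(1) \<rho>(2) w that(2)] by (simp add: G_def K_def)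
  obtain C3 where G': "\<And>z v. norm z \<le> \<rho> \<Longrightarrow> z \<noteq> w \<Longrightarrow> norm v = 1 \<Longrightarrow> norm (G' z v) \<le> C3 / norm (z - w)"
    by (rule green_deriv_local_bound[OF \<alpha> less_imp_le[OF \<rho>(1)] \<rho>(2) w, folded G'_def]) (rule that)
  define F' where "F' z v = (if z \<in> unit_disc then G z * P' v z + G' z v * P z else 0)" for z v
  have dF: "((\<lambda>z. G z * P z) has_derivative F' z) (at z)" if "z \<noteq> w" for z
  proof (cases "z \<in> unit_disc")
    case True
    show ?thesis
      using has_derivative_mult[OF green_function_has_derivative[OF \<alpha> True w that]
          has_derivative_weighted_wirtinger_bar[OF t True]]
      unfolding G_def P_def by (rule has_derivative_eq_rhs) (use True in \<open>simp add: fun_eq_iff F'_def G_def G'_def P_def P'_def\<close>)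
  next
    case False
    have "((\<lambda>z. G z * P z) has_derivative (\<lambda>v. 0)) (at z)"
    proof (rule has_derivative_zero_on_open)
      show "open {z :: complex. \<rho> < norm z}"
        by (intro open_Collect_less continuous_intros)
    qed (use False \<rho> P0 in \<open>auto simp: P_def\<close>)
    also have "(\<lambda>v. 0) = F' z"
      using False by (simp add: fun_eq_iff F'_def)
    finally show ?thesis .
  qed
  have cont: "continuous_on (unit_disc - {w}) (\<lambda>z. G z * P' v z)" "continuous_on (unit_disc - {w}) (\<lambda>z. G' z v * P z)" for v
    by (intro continuous_on_mult contG continuous_on_subset[OF contP(1)] continuous_on_subset[OF contP(2)]; auto)+
  have intGP: "integrable lborel (\<lambda>z. G z * P' v z)" for v
  proof (rule integrable_inverse_dist_bound[OF borel_measurable_punctured[OF cont(1)] w])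
    fix z assume z: "z \<in> unit_disc" "z \<noteq> w"
    show "norm (G z * P' v z) \<le> (K * C2 v) / norm (z - w)"
    proof (cases "norm z \<le> \<rho>")
      case True
      have "norm (G z) * norm (P' v z) \<le> K / norm (z - w) * C2 v"
        using G[OF True z(2)] C2[of v] less_imp_le[OF C2(1)] by (intro mult_mono) (auto intro: order_trans[OF norm_ge_zero])
      then show ?thesis by (simp add: norm_mult)
    qed (use P'0 C2(1)[of v] green_h_const_pos[OF \<alpha>] in \<open>auto simp: P'_def K_def\<close>)
  qed (use P'0 \<rho> in \<open>auto simp: P'_def\<close>)
  have intG'P: "integrable lborel (\<lambda>z. G' z v * P z)" if v: "norm v = 1" for v
  proof (rule integrable_inverse_dist_bound[OF borel_measurable_punctured[OF cont(2)] w])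
    fix z assume z: "z \<in> unit_disc" "z \<noteq> w"
    show "norm (G' z v * P z) \<le> (\<bar>C3\<bar> * C1) / norm (z - w)"
    proof (cases "norm z \<le> \<rho>")
      case True
      have "C3 / norm (z - w) \<le> \<bar>C3\<bar> / norm (z - w)"
        by (intro divide_right_mono) auto
      then have "norm (G' z v) * norm (P z) \<le> \<bar>C3\<bar> / norm (z - w) * C1"
        using G'[OF True z(2) v] C1 by (intro mult_mono) auto
      then show ?thesis by (simp add: norm_mult)
    qed (use P0 C1(1) in \<open>auto simp: P_def\<close>)
  qed (use P0 \<rho> in \<open>auto simp: P_def\<close>)
  have F'_eq: "F' z v = G z * P' v z + G' z v * P z" for z v
    using P0[of z] P'0[of z v] \<rho> by (auto simp: F'_def P_def P'_def)
  have intF: "integrable lborel (\<lambda>z. F' z v)" if "norm v = 1" for v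
    unfolding F'_eq by (intro Bochner_Integration.integrable_add intGP intG'P that)
  \<comment> \<open>Both partial derivatives of G P integrate to 0, hence so does d/dz (G P). This
    is the integration by parts; the singularity at w leaves no extra term.\<close>
  have "(\<integral>z. F' z 1 \<partial>lborel) = 0" "(\<integral>z. F' z \<i> \<partial>lborel) = 0"
    by (rule integral_partial_x_eq_0[OF dF _ intF] integral_partial_y_eq_0[OF dF _ intF];
        use P0 \<rho> in \<open>auto simp: P_def\<close>)+
  then have "0 = (\<integral>z. (F' z 1 - \<i> * F' z \<i>) / 2 \<partial>lborel)"
    using intF by simp
  also have "\<dots> = (\<integral>z. (G z * P' 1 z - \<i> * (G z * P' \<i> z)) / 2 + (G' z 1 * P z - \<i> * (G' z \<i> * P z)) / 2 \<partial>lborel)"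
    unfolding F'_eq by (intro Bochner_Integration.integral_cong) (auto simp: field_simps)
  also have "\<dots> = (\<integral>z. (G z * P' 1 z - \<i> * (G z * P' \<i> z)) / 2 \<partial>lborel)
      + (\<integral>z. (G' z 1 * P z - \<i> * (G' z \<i> * P z)) / 2 \<partial>lborel)"
    by (intro Bochner_Integration.integral_add integrable_divide Bochner_Integration.integrable_diff
        integrable_mult_right intGP intG'P) auto
  also have "(\<integral>z. (G z * P' 1 z - \<i> * (G z * P' \<i> z)) / 2 \<partial>lborel) = - (\<integral>z. G z * L_bar \<alpha> \<phi> z \<partial>lborel)"
  proof -
    have "(G z * P' 1 z - \<i> * (G z * P' \<i> z)) / 2 = - (G z * L_bar \<alpha> \<phi> z)" for z
    proof (cases "z \<in> unit_disc")
      case True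
      then show ?thesis
        unfolding L_bar_eq[OF t True, of \<alpha>] by (simp add: P'_def field_simps)
    qed (use P'0 L0 \<rho> in \<open>auto simp: P'_def\<close>)
    then show ?thesis by simp
  qed
  finally have *: "(\<integral>z. G z * L_bar \<alpha> \<phi> z \<partial>lborel) = (\<integral>z. (G' z 1 * P z - \<i> * (G' z \<i> * P z)) / 2 \<partial>lborel)"
    by simp
  define q where "q z = (1 - z * cnj w) powr (- of_real (\<alpha> + 1))" for z
  define W where "W = (1 - (norm w)\<^sup>2) powr (\<alpha> + 1)"
  \<comment> \<open>The factor (1 - |z|^2)^\<alpha> of d/dz G cancels against the weight in P, and
    the holomorphic q over z - w remains.\<close>
  have AE: "AE z in lborel. (G' z 1 * P z - \<i> * (G' z \<i> * P z)) / 2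
      = - of_real W * (if z \<in> unit_disc then q z * wirtinger_bar \<phi> z / (z - w) else 0)"
    using AE_lborel_singleton[of w]
  proof eventually_elim
    case (elim z)
    show ?case
    proof (cases "z \<in> unit_disc")
      case True
      have "(G' z 1 * P z - \<i> * (G' z \<i> * P z)) / 2 = (G' z 1 - \<i> * G' z \<i>) / 2 * P z"
        by (simp add: field_simps)
      also have "\<dots> = - of_real ((1 - (norm z)\<^sup>2) powr \<alpha> * W) * q z / (z - w) *
          (of_real ((1 - (norm z)\<^sup>2) powr (- \<alpha>)) * wirtinger_bar \<phi> z)"
        unfolding G'_def wirtinger_green_deriv[OF \<alpha> True w elim] by (simp add: P_def weighted_wirtinger_bar_def W_def q_def)
      also have "\<dots> = - of_real W * (of_real ((1 - (norm z)\<^sup>2) powr \<alpha> * (1 - (norm z)\<^sup>2) powr (- \<alpha>)) * (q z * wirtinger_bar \<phi> z / (z - w)))"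
        by simp
      also have "(1 - (norm z)\<^sup>2) powr \<alpha> * (1 - (norm z)\<^sup>2) powr (- \<alpha>) = 1"
        using one_minus_norm_square_pos[OF True] by (simp add: powr_add[symmetric])
      finally show ?thesis
        by (simp only: True if_True of_real_1 mult_1_left)
    qed (use P0 \<rho> in \<open>auto simp: P_def\<close>)
  qed
  \<comment> \<open>As q is holomorphic, dbar (q \<phi>) = q dbar \<phi>; extension by 0 makes this
    a function on the plane, as the Cauchy--Pompeiu formula requires.\<close>
  define f where "f z = (if z \<in> unit_disc then q z * \<phi> z else 0)" for z
  define q' where "q' z = - of_real (\<alpha> + 1) * (1 - z * cnj w) powr (- of_real (\<alpha> + 1) - 1) * (- cnj w)" for z
  define f' where "f' z v = (if z \<in> unit_disc then q z * (of_real (Re v) * deriv_x \<phi> z + of_real (Im v) * deriv_y \<phi> z)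
      + q' z * v * \<phi> z else 0)" for z v
  have np: "1 - z * cnj w \<notin> \<real>\<^sub>\<le>\<^sub>0" if "z \<in> unit_disc" for z
    using one_minus_cnj_mult(1)[OF that w] by (auto simp: complex_nonpos_Reals_iff)
  have dpow: "((\<lambda>z. (1 - z * cnj w) powr s) has_field_derivative s * (1 - z * cnj w) powr (s - 1) * (- cnj w)) (at z)"
    if "z \<in> unit_disc" for z s
    by (rule DERIV_chain2[where f="\<lambda>x. x powr s" and g="\<lambda>z. 1 - z * cnj w", OF has_field_derivative_powr[OF np[OF that]]])
       (auto intro!: derivative_eq_intros)
  have dq: "(q has_field_derivative q' z) (at z)" if "z \<in> unit_disc" for z
    unfolding q_def[abs_def] q'_def
    by (rule dpow[OF that])
  have cq: "continuous_on unit_disc q" "continuous_on unit_disc q'"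
  proof -
    show "continuous_on unit_disc q"
      by (rule DERIV_continuous_on[OF has_field_derivative_at_within[OF dq]])
    have "continuous_on unit_disc (\<lambda>z. (1 - z * cnj w) powr (- of_real (\<alpha> + 1) - 1))"
      by (rule DERIV_continuous_on[OF has_field_derivative_at_within[OF dpow]])
    then show "continuous_on unit_disc q'"
      unfolding q'_def[abs_def] by (intro continuous_on_mult continuous_on_const)
  qed
  have df: "(f has_derivative f' z) (at z)" for z
  proof (cases "z \<in> unit_disc")
    case True
    have "((\<lambda>z. q z * \<phi> z) has_derivative f' z) (at z)"
      using has_derivative_mult[OF dq[OF True, unfolded has_field_derivative_def] differentiable_has_derivative_xy[of \<phi> z]]
        t[of "Suc 0"] True
      by (simp add: f'_def[abs_def] fun_eq_iff)
    then show ?thesis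
      by (rule has_derivative_transform_within_open[OF _ open_ball True]) (simp add: f_def)
  next
    case False
    have "(f has_derivative (\<lambda>v. 0)) (at z)"
    proof (rule has_derivative_zero_on_open)
      show "open {z :: complex. \<rho> < norm z}"
        by (intro open_Collect_less continuous_intros)
    qed (use False \<rho> \<phi>0 in \<open>auto simp: f_def\<close>)
    also have "(\<lambda>v. 0) = f' z"
      using False by (simp add: fun_eq_iff f'_def)
    finally show ?thesis .
  qed
  have cont\<phi>: "continuous_on A \<phi>" "continuous_on A (deriv_x \<phi>)" "continuous_on A (deriv_y \<phi>)" for A
    using t[of 0] t[of "Suc 0"] by (auto intro: continuous_on_subset)
  have contf: "continuous_on UNIV (\<lambda>z. f' z v)" for v
  proof (rule continuous_on_of_support[OF _ \<rho>(2)])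
    have "continuous_on unit_disc (\<lambda>z. q z * (of_real (Re v) * deriv_x \<phi> z + of_real (Im v) * deriv_y \<phi> z) + q' z * v * \<phi> z)"
      by (intro continuous_on_add continuous_on_mult continuous_on_const cq cont\<phi>)
    then show "continuous_on unit_disc (\<lambda>z. f' z v)"
      by (rule continuous_on_eq) (simp add: f'_def)
  qed (simp add: f'_def \<phi>0)
  have "(\<integral>z. (f' z 1 + \<i> * f' z \<i>) / 2 / (z - w) \<partial>lborel) = - of_real pi * f w"
    by (rule cauchy_pompeiu_compact_support[OF df contf contf _ _ w]) (simp_all add: f_def f'_def)
  moreover have "(f' z 1 + \<i> * f' z \<i>) / 2 / (z - w) = (if z \<in> unit_disc then q z * wirtinger_bar \<phi> z / (z - w) else 0)" for z
    by (simp add: f'_def wirtinger_bar_def algebra_simps)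
  ultimately have "(\<integral>z. (if z \<in> unit_disc then q z * wirtinger_bar \<phi> z / (z - w) else 0) \<partial>lborel) = - of_real pi * f w"
    by simp
  moreover have "(\<integral>z. G z * L_bar \<alpha> \<phi> z \<partial>lborel)
      = - of_real W * (\<integral>z. (if z \<in> unit_disc then q z * wirtinger_bar \<phi> z / (z - w) else 0) \<partial>lborel)"
  proof -
    have "(\<lambda>z. (f' z 1 + \<i> * f' z \<i>) / 2 / (z - w)) \<in> borel_measurable borel"
      using contf[THEN borel_measurable_continuous_onI] by measurable
    then have m: "(\<lambda>z. if z \<in> unit_disc then q z * wirtinger_bar \<phi> z / (z - w) else 0) \<in> borel_measurable borel"
      using \<open>\<And>z. (f' z 1 + \<i> * f' z \<i>) / 2 / (z - w) = _ z\<close> by simp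
    have "(\<integral>z. (G' z 1 * P z - \<i> * (G' z \<i> * P z)) / 2 \<partial>lborel)
        = (\<integral>z. - of_real W * (if z \<in> unit_disc then q z * wirtinger_bar \<phi> z / (z - w) else 0) \<partial>lborel)"
      using m intG'P[of 1] intG'P[of \<i>] by (intro integral_cong_AE AE) auto
    then show ?thesis
      unfolding * by simp
  qed
  \<comment> \<open>At z = w the base 1 - |w|^2 is a positive real, so q w = 1 / W cancels the
    factor W of the derivative. The minus signs of the derivative and of the Cauchy--Pompeiu formula
    cancel as well.\<close>
  moreover have "f w = of_real (1 / W) * \<phi> w"
  proof -
    have "1 - w * cnj w = of_real (1 - (norm w)\<^sup>2)"
      using complex_norm_square[of w] by simp
    then have "q w = of_real ((1 - (norm w)\<^sup>2) powr (- (\<alpha> + 1)))"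
      using one_minus_norm_square_pos[OF w] unfolding q_def by (simp only: powr_of_real[symmetric] less_imp_le of_real_minus)
    also have "(1 - (norm w)\<^sup>2) powr (- (\<alpha> + 1)) = 1 / W"
      unfolding W_def by (rule powr_minus_divide)
    finally show ?thesis
      using w by (simp only: f_def if_True)
  qed
  moreover have "W \<noteq> 0"
    using one_minus_norm_square_pos[OF w] by (simp add: W_def)
  ultimately show ?thesis
    by (simp add: G_def)
qed

section \<open>Circle integrals of the majorant\<close>

text \<open>The hypothesis on \<open>a\<close> makes the tail y^(-a-1/2) integrable at infinity,
  while on [0, 1] only y^(-1/2) is left; the two terms of the bound are these two pieces.\<close>

lemma nn_integral_max_powr:
  fixes a :: real
  assumes a: "1 / 2 < a"
  shows "(\<integral>\<^sup>+ y. ennreal (max 1 y powr (- a) * y powr (- 1 / 2)) * indicator {0..} y \<partial>lborel)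
    \<le> ennreal (2 + 1 / (a - 1 / 2))"
proof -
  define F where "F y = - (y powr (1 / 2 - a)) / (a - 1 / 2)" for y :: real
  have dF: "(F has_real_derivative y powr (- a - 1 / 2)) (at y)" if "1 \<le> y" for y
  proof -
    have "(F has_real_derivative - ((1 / 2 - a) * y powr (1 / 2 - a - 1)) / (a - 1 / 2)) (at y)"
      unfolding F_def using has_real_derivative_powr[of y "1 / 2 - a"] that
      by (intro DERIV_cdivide DERIV_minus) auto
    moreover have "- ((1 / 2 - a) * y powr (1 / 2 - a - 1)) / (a - 1 / 2) = y powr (1 / 2 - a - 1)"
      using a by (simp add: field_simps)
    moreover have "1 / 2 - a - 1 = - a - 1 / 2" by simp
    ultimately show ?thesis by simp
  qed
  have "((\<lambda>y. y powr (1 / 2 - a)) \<longlongrightarrow> 0) at_top"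
    using a by (intro tendsto_neg_powr) (auto simp: filterlim_ident)
  then have lim: "(F \<longlongrightarrow> 0) at_top"
    unfolding F_def using a tendsto_divide[OF tendsto_minus tendsto_const[of "a - 1 / 2"]] by fastforce
  have "(\<integral>\<^sup>+ y. ennreal (max 1 y powr (- a) * y powr (- 1 / 2)) * indicator {0..} y \<partial>lborel)
    \<le> (\<integral>\<^sup>+ y. ennreal (y powr (- 1 / 2)) * indicator {0..1} y
        + ennreal (y powr (- a - 1 / 2)) * indicator {1..} y \<partial>lborel)"
  proof (intro nn_integral_mono)
    fix y :: real
    show "ennreal (max 1 y powr (- a) * y powr (- 1 / 2)) * indicator {0..} y
        \<le> ennreal (y powr (- 1 / 2)) * indicator {0..1} y + ennreal (y powr (- a - 1 / 2)) * indicator {1..} y"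
    proof (cases "1 \<le> y")
      case True
      then have "y powr (- a) * y powr (- 1 / 2) = y powr (- a - 1 / 2)"
        by (simp add: powr_add[symmetric])
      then show ?thesis
        using True by (simp add: max_def add_increasing)
    qed (auto simp: max_def split: split_indicator)
  qed
  also have "\<dots> = (\<integral>\<^sup>+ y. ennreal (y powr (- 1 / 2)) * indicator {0..1} y \<partial>lborel)
      + (\<integral>\<^sup>+ y. ennreal (y powr (- a - 1 / 2)) * indicator {1..} y \<partial>lborel)"
    by (rule nn_integral_add) measurable
  also have "(\<integral>\<^sup>+ y. ennreal (y powr (- 1 / 2)) * indicator {0..1} y \<partial>lborel) = ennreal 2"
    by (subst nn_integral_powr_from_0) auto
  also have "(\<integral>\<^sup>+ y. ennreal (y powr (- a - 1 / 2)) * indicator {1..} y \<partial>lborel) = ennreal (0 - F 1)"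
    by (rule nn_integral_FTC_atLeast[OF _ dF _ lim]) auto
  also have "ennreal 2 + ennreal (0 - F 1) = ennreal (2 + 1 / (a - 1 / 2))"
    using a by (subst ennreal_plus[symmetric]) (auto simp: F_def)
  finally show ?thesis .
qed

lemma nn_integral_max_powr_scaled:
  fixes a \<delta> :: real
  assumes a: "1 / 2 < a" and \<delta>: "0 < \<delta>"
  shows "(\<integral>\<^sup>+ x. ennreal (max \<delta> (2 * \<bar>x\<bar> / pi) powr (- a) * (\<bar>x\<bar> / pi) powr (- 1 / 2)) \<partial>lborel)
    \<le> ennreal (2 * pi * (2 + 1 / (a - 1 / 2)) * \<delta> powr (1 / 2 - a))"
proof -
  \<comment> \<open>The scale at which both entries of the maximum agree: for x = x0 y the second
    one becomes \<delta> |y|.\<close>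
  define x0 where "x0 = pi * \<delta> / 2"
  have x0: "0 < x0" using \<delta> by (simp add: x0_def)
  let ?f = "\<lambda>x. ennreal (max \<delta> (2 * \<bar>x\<bar> / pi) powr (- a) * (\<bar>x\<bar> / pi) powr (- 1 / 2))"
  let ?g = "\<lambda>y::real. ennreal (max 1 y powr (- a) * y powr (- 1 / 2))"
  define c where "c = \<delta> powr (- a) * (\<delta> / 2) powr (- 1 / 2)"
  have c: "0 \<le> c" by (simp add: c_def)
  have "(\<integral>\<^sup>+ x. ?f x \<partial>lborel) = ennreal x0 * (\<integral>\<^sup>+ y. ?f (0 + x0 * y) \<partial>lborel)"
    using nn_integral_real_affine[of ?f x0 0] x0 by simp
  also have "(\<integral>\<^sup>+ y. ?f (0 + x0 * y) \<partial>lborel) = (\<integral>\<^sup>+ y. ennreal c * ?g \<bar>y\<bar> \<partial>lborel)"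
  proof (intro nn_integral_cong)
    fix y :: real
    have m1: "max \<delta> (2 * \<bar>0 + x0 * y\<bar> / pi) = \<delta> * max 1 \<bar>y\<bar>"
      using \<delta> by (simp add: x0_def abs_mult max_mult_distrib_left)
    have m2: "\<bar>0 + x0 * y\<bar> / pi = (\<delta> / 2) * \<bar>y\<bar>"
      using \<delta> by (simp add: x0_def abs_mult)
    show "?f (0 + x0 * y) = ennreal c * ?g \<bar>y\<bar>"
    proof -
      have "(\<delta> * max 1 \<bar>y\<bar>) powr (- a) = \<delta> powr (- a) * max 1 \<bar>y\<bar> powr (- a)"
        "(\<delta> / 2 * \<bar>y\<bar>) powr (- 1 / 2) = (\<delta> / 2) powr (- 1 / 2) * \<bar>y\<bar> powr (- 1 / 2)"
        using \<delta> by (intro powr_mult; simp)+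
      then have "(\<delta> * max 1 \<bar>y\<bar>) powr (- a) * (\<delta> / 2 * \<bar>y\<bar>) powr (- 1 / 2)
          = c * (max 1 \<bar>y\<bar> powr (- a) * \<bar>y\<bar> powr (- 1 / 2))"
        by (simp only: c_def mult_ac)
      then show ?thesis
        unfolding m1 m2 using c by (simp only: ennreal_mult')
    qed
  qed
  also have "\<dots> = ennreal c * (\<integral>\<^sup>+ y. ?g \<bar>y\<bar> \<partial>lborel)"
    by (rule nn_integral_cmult) measurable
  also have "(\<integral>\<^sup>+ y. ?g \<bar>y\<bar> \<partial>lborel) = 2 * (\<integral>\<^sup>+ y. ?g y * indicator {0..} y \<partial>lborel)"
    by (rule nn_integral_even) measurable
  also have "ennreal x0 * (ennreal c * (2 * (\<integral>\<^sup>+ y. ?g y * indicator {0..} y \<partial>lborel)))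
      \<le> ennreal x0 * (ennreal c * (2 * ennreal (2 + 1 / (a - 1 / 2))))"
    by (intro mult_left_mono nn_integral_max_powr a) auto
  also have "\<dots> = ennreal (x0 * c * 2 * (2 + 1 / (a - 1 / 2)))"
  proof -
    have "ennreal x0 * (ennreal c * (2 * ennreal E)) = ennreal (x0 * c * 2 * E)" if "0 \<le> E" for E
      using x0 c that by (simp add: ennreal_mult mult.assoc)
    note eq = this
    have "0 \<le> 2 + 1 / (a - 1 / 2)"
      using a by simp
    then show ?thesis
      by (rule eq)
  qed
  also have "\<dots> \<le> ennreal (2 * pi * (2 + 1 / (a - 1 / 2)) * \<delta> powr (1 / 2 - a))"
  proof (rule ennreal_leI)
    have "(\<delta> / 2) powr (- 1 / 2) = \<delta> powr (- 1 / 2) * sqrt 2"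
      using \<delta> by (simp add: powr_divide powr_minus powr_half_sqrt field_simps)
    moreover have "\<delta> * (\<delta> powr (- a) * \<delta> powr (- 1 / 2)) = \<delta> powr (1 + (- a + - 1 / 2))"
      using \<delta> by (simp only: powr_add powr_one)
    moreover have "1 + (- a + - 1 / 2) = 1 / 2 - a" by simp
    ultimately have "x0 * c = pi / 2 * sqrt 2 * \<delta> powr (1 / 2 - a)"
      by (simp add: x0_def c_def)
    also have "\<dots> \<le> pi * \<delta> powr (1 / 2 - a)"
      using real_sqrt_le_mono[of 2 4] by (intro mult_right_mono) auto
    finally have "x0 * c * (2 * (2 + 1 / (a - 1 / 2))) \<le> pi * \<delta> powr (1 / 2 - a) * (2 * (2 + 1 / (a - 1 / 2)))"
      using a by (intro mult_right_mono) auto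
    then show "x0 * c * 2 * (2 + 1 / (a - 1 / 2)) \<le> 2 * pi * (2 + 1 / (a - 1 / 2)) * \<delta> powr (1 / 2 - a)"
      by (simp add: mult_ac)
  qed
  finally show ?thesis .
qed

text \<open>Jordan's inequality, from concavity of the sine on [0, pi/2], transported to the
  multiple of \<open>pi\<close> nearest to \<open>x\<close>.\<close>

lemma abs_sin_ge_dist:
  assumes "\<bar>x - of_int j * pi\<bar> \<le> pi / 2"
  shows "2 * \<bar>x - of_int j * pi\<bar> / pi \<le> \<bar>sin x\<bar>"
proof -
  define y where "y = x - of_int j * pi"
  have y: "\<bar>y\<bar> \<le> pi / 2"
    using assms by (simp add: y_def)
  have "x = y + of_int j * pi"
    by (simp add: y_def)
  then have "\<bar>sin x\<bar> = \<bar>sin y\<bar>"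
    using sin_npi_int[of j] cos_npi_int[of j] by (simp add: sin_add abs_mult mult.commute[of _ pi])
  also have "\<bar>sin y\<bar> = sin \<bar>y\<bar>"
  proof (cases "0 \<le> y")
    case True
    then show ?thesis
      using y pi_gt_zero by (simp add: sin_ge_zero)
  next
    case False
    then show ?thesis
      using y pi_gt_zero sin_ge_zero[of "- y"] by (simp add: abs_if)
  qed
  also have "2 * \<bar>y\<bar> / pi \<le> sin \<bar>y\<bar>"
  proof -
    have "concave_on {0..pi / 2} sin"
      by (rule f''_le0_imp_concave[where f'=cos and f''="\<lambda>x. - sin x"])
         (auto intro!: derivative_eq_intros sin_ge_zero)
    from concave_onD[OF this, of "2 * \<bar>y\<bar> / pi" 0 "pi / 2"] show ?thesis
      using y by simp
  qed
  finally show ?thesis by (simp add: y_def)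
qed

text \<open>Let x be the angle between the point and w. Then |1 - z cnj w| is at least |sin x| and
  at least 1 - r |w|, while |z - w| is at least r |sin x| and thus at least |sin x| / 2. So the
  kernel is dominated by a fixed function of the distance of x to the multiples of pi, whatever w
  is. The spurious zeros of the sine at odd multiples only enlarge the bound.\<close>

lemma nn_integral_circle_kernel:
  assumes a: "1 / 2 < a"
  obtains C where "0 \<le> C"
    "\<And>r w. 1 / 2 \<le> r \<Longrightarrow> r < 1 \<Longrightarrow> w \<in> unit_disc \<Longrightarrow>
      (\<integral>\<^sup>+ t. ennreal (norm (1 - of_real r * cis t * cnj w) powr (- a) * norm (of_real r * cis t - w) powr (- 1 / 2))
        * indicator {0..2 * pi} t \<partial>lborel) \<le> ennreal (C * (1 - r * norm w) powr (1 / 2 - a))"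
proof -
  define C0 where "C0 = 2 * pi * (2 + 1 / (a - 1 / 2))"
  have C0: "0 \<le> C0"
    using a by (simp add: C0_def)
  show ?thesis
  proof (rule that[of "5 * C0"])
    show "0 \<le> 5 * C0"
      using C0 by simp
    fix r :: real and w :: complex
    assume r: "1 / 2 \<le> r" "r < 1" and w: "w \<in> unit_disc"
    define \<rho> f where "\<rho> = norm w" and "f = Arg2pi w"
    have w_eq: "w = of_real \<rho> * cis f"
      using complex_norm_eq_1_exp_eq Arg2pi_eq[of w] by (simp add: \<rho>_def f_def cis_conv_exp mult.commute)
    have f: "0 \<le> f" "f < 2 * pi"
      using Arg2pi[of w] by (auto simp: f_def)
    have \<rho>: "0 \<le> \<rho>" "\<rho> < 1"
      using w by (auto simp: \<rho>_def)
    define \<delta> where "\<delta> = 1 - r * \<rho>"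
    have "r * \<rho> \<le> r"
      using r \<rho> by (simp add: mult_left_le)
    then have \<delta>: "0 < \<delta>"
      unfolding \<delta>_def using r by linarith
    define K where "K x = max \<delta> (2 * \<bar>x\<bar> / pi) powr (- a) * (\<bar>x\<bar> / pi) powr (- 1 / 2)" for x
    have K0: "0 \<le> K x" for x
      by (simp add: K_def)
    have [measurable]: "K \<in> borel_measurable borel"
      unfolding K_def[abs_def] by measurable
    \<comment> \<open>The multiples of pi that can be nearest to t - f, which lies in [-2 pi, 2 pi];
      their number is the factor 5 of the constant.\<close>
    define J where "J = {-2, -1, 0, 1, 2 :: int}"
    have bound: "norm (1 - of_real r * cis t * cnj w) powr (- a) * norm (of_real r * cis t - w) powr (- 1 / 2)
        \<le> (\<Sum>j\<in>J. K (t - f - of_int j * pi))" if t: "t \<in> {0..2 * pi}" and s: "sin (t - f) \<noteq> 0" for t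
    proof -
      define x where "x = t - f"
      have rot: "cis t * cnj (cis f) = cis x"
        by (simp add: x_def cis_cnj cis_mult)
      have "of_real r * cis t * cnj w = of_real (r * \<rho>) * cis x"
        unfolding w_eq rot[symmetric] by simp
      then have p: "\<bar>sin x\<bar> * 1 \<le> norm (1 - of_real r * cis t * cnj w)"
      proof -
        assume eq: "of_real r * cis t * cnj w = of_real (r * \<rho>) * cis x"
        have "(sin x)\<^sup>2 \<le> (norm (1 - of_real (r * \<rho>) * cis x))\<^sup>2"
        proof -
          have "(norm (1 - of_real (r * \<rho>) * cis x))\<^sup>2 = (1 - r * \<rho> * cos x)\<^sup>2 + (r * \<rho> * sin x)\<^sup>2"
            by (simp add: cmod_power2)
          also have "\<dots> = (r * \<rho> - cos x)\<^sup>2 + (1 - (cos x)\<^sup>2)"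
            using sin_cos_squared_add[of x] by (simp add: power2_eq_square algebra_simps) (simp flip: distrib_left)
          also have "1 - (cos x)\<^sup>2 = (sin x)\<^sup>2"
            by (simp add: sin_squared_eq)
          finally show ?thesis by simp
        qed
        then show ?thesis
          unfolding eq by (simp add: abs_le_square_iff[symmetric] power2_le_iff_abs_le)
      qed
      have u: "\<bar>sin x\<bar> / 2 \<le> norm (of_real r * cis t - w)"
      proof -
        have "norm (of_real r * cis t - w) = norm (of_real r * cis x - of_real \<rho>)"
        proof -
          have "of_real r * cis t - w = (of_real r * cis x - of_real \<rho>) * cis f"
            unfolding w_eq by (simp add: x_def algebra_simps cis_mult)
          then show ?thesis
            by (simp add: norm_mult)
        qed
        moreover have "\<bar>r * sin x\<bar> \<le> norm (of_real r * cis x - of_real \<rho>)"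
          using abs_Im_le_cmod[of "of_real r * cis x - of_real \<rho>"] by simp
        moreover have "1 / 2 * \<bar>sin x\<bar> \<le> r * \<bar>sin x\<bar>"
          using r by (intro mult_right_mono) auto
        ultimately show ?thesis
          using r by (simp add: abs_mult)
      qed
      have p2: "\<delta> \<le> norm (1 - of_real r * cis t * cnj w)"
        using one_minus_cnj_mult(6)[of "of_real r * cis t" w] w r by (simp add: \<delta>_def \<rho>_def norm_mult)
      have "\<bar>x\<bar> \<le> 2 * pi"
        using t f by (auto simp: x_def)
      then obtain j where j: "j \<in> J" "\<bar>x - of_int j * pi\<bar> \<le> pi / 2"
      proof -
        assume x2: "\<bar>x\<bar> \<le> 2 * pi"
        have close: "\<bar>x - of_int j * pi\<bar> \<le> pi / 2"
          if "of_int j * pi - pi / 2 \<le> x" "x \<le> of_int j * pi + pi / 2" for j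
          using that by linarith
        consider "x < - 3 / 2 * pi" | "- 3 / 2 * pi \<le> x" "x < - 1 / 2 * pi" | "\<bar>x\<bar> \<le> pi / 2"
          | "1 / 2 * pi < x" "x \<le> 3 / 2 * pi" | "3 / 2 * pi < x"
          by (cases "x < - 3 / 2 * pi"; cases "x < - 1 / 2 * pi"; cases "x \<le> 1 / 2 * pi"; cases "x \<le> 3 / 2 * pi")
             (auto simp: abs_le_iff)
        then show thesis
        proof cases
          case 1
          show thesis
            by (rule that[of "-2", OF _ close])
               (simp add: J_def, (use 1 x2 pi_gt_zero in \<open>simp only: of_int_minus of_int_numeral of_int_0 of_int_1; linarith\<close>)+)
        next
          case 2
          show thesis
            by (rule that[of "-1", OF _ close])
               (simp add: J_def, (use 2 x2 pi_gt_zero in \<open>simp only: of_int_minus of_int_numeral of_int_0 of_int_1; linarith\<close>)+)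
        next
          case 3
          show thesis
            by (rule that[of "0", OF _ close])
               (simp add: J_def, (use 3 x2 pi_gt_zero in \<open>simp only: of_int_minus of_int_numeral of_int_0 of_int_1; linarith\<close>)+)
        next
          case 4
          show thesis
            by (rule that[of "1", OF _ close])
               (simp add: J_def, (use 4 x2 pi_gt_zero in \<open>simp only: of_int_minus of_int_numeral of_int_0 of_int_1; linarith\<close>)+)
        next
          case 5
          show thesis
            by (rule that[of "2", OF _ close])
               (simp add: J_def, (use 5 x2 pi_gt_zero in \<open>simp only: of_int_minus of_int_numeral of_int_0 of_int_1; linarith\<close>)+)
        qed
      qed
      define y where "y = x - of_int j * pi"
      have y: "2 * \<bar>y\<bar> / pi \<le> \<bar>sin x\<bar>"
        using abs_sin_ge_dist[OF j(2)] by (simp add: y_def)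
      have y0: "y \<noteq> 0"
      proof
        assume "y = 0"
        then have "sin x = 0"
          using sin_npi_int[of j] by (simp add: y_def mult.commute)
        then show False using s by (simp add: x_def)
      qed
      have "norm (1 - of_real r * cis t * cnj w) powr (- a) * norm (of_real r * cis t - w) powr (- 1 / 2) \<le> K y"
        unfolding K_def
      proof (intro mult_mono powr_mono2')
        show "max \<delta> (2 * \<bar>y\<bar> / pi) \<le> norm (1 - of_real r * cis t * cnj w)"
          using p p2 y by simp
        have "\<bar>y\<bar> / pi = (2 * \<bar>y\<bar> / pi) / 2" by simp
        also have "\<dots> \<le> \<bar>sin x\<bar> / 2"
          using y by (rule divide_right_mono) simp
        also note u
        finally show "\<bar>y\<bar> / pi \<le> norm (of_real r * cis t - w)" .
      qed (use a \<delta> y0 in auto)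
      also have "K y \<le> (\<Sum>j\<in>J. K (x - of_int j * pi))"
        unfolding y_def using j(1) K0 by (intro member_le_sum) (auto simp: J_def)
      finally show ?thesis by (simp add: x_def)
    qed
    \<comment> \<open>Where the sine vanishes \<open>K\<close> takes the default value 0 of
      \<open>powr\<close> at 0, so the pointwise bound is claimed only off this countable
      set.\<close>
    have count: "countable {t. sin (t - f) = 0}"
    proof (rule countable_subset)
      show "{t. sin (t - f) = 0} \<subseteq> (\<lambda>j :: int. f + of_int j * pi) ` UNIV"
        by (auto simp: sin_zero_iff_int2 image_iff) (metis add.commute diff_add_cancel)
    qed auto
    have AE: "AE t in lborel. sin (t - f) \<noteq> 0"
      by (rule AE_I'[OF countable_imp_null_set_lborel[OF count]]) auto
    have "(\<integral>\<^sup>+ t. ennreal (norm (1 - of_real r * cis t * cnj w) powr (- a) * norm (of_real r * cis t - w) powr (- 1 / 2))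
        * indicator {0..2 * pi} t \<partial>lborel) \<le> (\<integral>\<^sup>+ t. (\<Sum>j\<in>J. ennreal (K (t - f - of_int j * pi))) \<partial>lborel)"
    proof (intro nn_integral_mono_AE)
      show "AE t in lborel. ennreal (norm (1 - of_real r * cis t * cnj w) powr (- a) * norm (of_real r * cis t - w) powr (- 1 / 2))
        * indicator {0..2 * pi} t \<le> (\<Sum>j\<in>J. ennreal (K (t - f - of_int j * pi)))"
        using AE
      proof eventually_elim
        case (elim t)
        then show ?case
          using bound[of t] K0 by (cases "t \<in> {0..2 * pi}") (auto simp: sum_ennreal intro!: ennreal_leI)
      qed
    qed
    also have "\<dots> = (\<Sum>j\<in>J. \<integral>\<^sup>+ t. ennreal (K (t - f - of_int j * pi)) \<partial>lborel)"
      by (rule nn_integral_sum) measurable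
    also have "\<dots> = (\<Sum>j\<in>J. \<integral>\<^sup>+ t. ennreal (K t) \<partial>lborel)"
    proof (intro sum.cong refl)
      fix j :: int
      show "(\<integral>\<^sup>+ t. ennreal (K (t - f - of_int j * pi)) \<partial>lborel) = (\<integral>\<^sup>+ t. ennreal (K t) \<partial>lborel)"
        using nn_integral_real_affine[of "\<lambda>t. ennreal (K t)" 1 "- f - of_int j * pi"] by (simp add: algebra_simps)
    qed
    also have "\<dots> = 5 * (\<integral>\<^sup>+ t. ennreal (K t) \<partial>lborel)"
      by (simp add: J_def)
    also have "\<dots> \<le> 5 * ennreal (C0 * \<delta> powr (1 / 2 - a))"
      using nn_integral_max_powr_scaled[OF a \<delta>] by (intro mult_left_mono) (auto simp: K_def C0_def)
    also have "\<dots> = ennreal (5 * C0 * (1 - r * norm w) powr (1 / 2 - a))"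
      using C0 by (simp add: \<delta>_def \<rho>_def ennreal_mult'[symmetric] mult.assoc flip: ennreal_numeral)
    finally show "(\<integral>\<^sup>+ t. ennreal (norm (1 - of_real r * cis t * cnj w) powr (- a) * norm (of_real r * cis t - w) powr (- 1 / 2))
        * indicator {0..2 * pi} t \<partial>lborel) \<le> ennreal (5 * C0 * (1 - r * norm w) powr (1 / 2 - a))" .
  qed
qed

section \<open>Existence\<close>

lemma countable_cis_eq: "countable {t. of_real r * cis t = w}" if "r \<noteq> 0"
proof (cases "\<exists>s. of_real r * cis s = w")
  case True
  then obtain s where s: "of_real r * cis s = w" by blast
  have "{t. of_real r * cis t = w} \<subseteq> (\<lambda>j :: int. s + of_int j * pi) ` UNIV"
  proof
    fix t assume "t \<in> {t. of_real r * cis t = w}"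
    then have "cis t = cis s"
      using s that by auto
    then have "cis (t - s) = 1"
      using cis_divide[of t s] cis_neq_zero[of s] by simp
    then have "sin (t - s) = 0"
      by (simp add: complex_eq_iff)
    then obtain j :: int where "t - s = of_int j * pi"
      by (auto simp: sin_zero_iff_int2)
    then have "t = s + of_int j * pi" by simp
    then show "t \<in> (\<lambda>j :: int. s + of_int j * pi) ` UNIV" by blast
  qed
  then show ?thesis
    by (rule countable_subset) auto
qed auto

text \<open>\<open>green_potential\<close> carries a dummy value and is handled through a Borel
  function \<open>g\<close> that agrees with it almost everywhere. The three parts carry
  integrability, pairings and norms over to the completion.\<close>

lemma absolutely_integrable_AE_cong:
  fixes f g :: "'a::euclidean_space \<Rightarrow> complex"
  assumes g [measurable]: "g \<in> borel_measurable borel" and A [measurable]: "A \<in> sets borel"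
    and eq: "AE x in lborel. x \<in> A \<longrightarrow> f x = g x"
    and fin: "(\<integral>\<^sup>+ x. ennreal (norm (g x)) * indicator A x \<partial>lborel) < \<infinity>"
  shows "f absolutely_integrable_on A"
    and "\<And>h. h \<in> borel_measurable borel \<Longrightarrow> (LINT x:A|lebesgue. f x * h x) = (LINT x:A|lborel. g x * h x)"
    and "(LINT x:A|lebesgue. norm (f x)) = enn2real (\<integral>\<^sup>+ x. ennreal (norm (g x)) * indicator A x \<partial>lborel)"
proof -
  have AE: "AE x in lebesgue. indicator A x *\<^sub>R g x = indicator A x *\<^sub>R f x"
    using AE_completion[OF eq] by eventually_elim (auto simp: indicator_def)
  have gm: "(\<lambda>x. indicator A x *\<^sub>R g x) \<in> borel_measurable lebesgue"
    by (intro measurable_completion) measurable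
  have fm: "(\<lambda>x. indicator A x *\<^sub>R f x) \<in> borel_measurable lebesgue"
    by (rule borel_measurable_AE[OF gm AE])
  have "integrable lborel (\<lambda>x. indicator A x *\<^sub>R g x)"
  proof (rule integrableI_bounded)
    have "(\<integral>\<^sup>+ x. ennreal (norm (indicator A x *\<^sub>R g x)) \<partial>lborel) = (\<integral>\<^sup>+ x. ennreal (norm (g x)) * indicator A x \<partial>lborel)"
      by (intro nn_integral_cong) (auto split: split_indicator)
    then show "(\<integral>\<^sup>+ x. ennreal (norm (indicator A x *\<^sub>R g x)) \<partial>lborel) < \<infinity>"
      using fin by simp
  qed measurable
  then have "integrable lebesgue (\<lambda>x. indicator A x *\<^sub>R g x)"
    by (subst integrable_completion) auto
  then show "f absolutely_integrable_on A"
    unfolding set_integrable_def using integrable_cong_AE[OF gm fm AE] by simp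
  show "(LINT x:A|lebesgue. f x * h x) = (LINT x:A|lborel. g x * h x)" if h [measurable]: "h \<in> borel_measurable borel" for h
  proof -
    have hm: "h \<in> borel_measurable lebesgue"
      by (rule measurable_completion) (simp add: h)
    have "(LINT x:A|lebesgue. f x * h x) = (\<integral>x. (indicator A x *\<^sub>R f x) * h x \<partial>lebesgue)"
      by (simp add: set_lebesgue_integral_def)
    also have "\<dots> = (\<integral>x. (indicator A x *\<^sub>R g x) * h x \<partial>lebesgue)"
    proof (intro integral_cong_AE borel_measurable_times fm gm hm)
      show "AE x in lebesgue. (indicator A x *\<^sub>R f x) * h x = (indicator A x *\<^sub>R g x) * h x"
        using AE by eventually_elim auto
    qed
    also have "\<dots> = (\<integral>x. (indicator A x *\<^sub>R g x) * h x \<partial>lborel)"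
      by (rule integral_completion) measurable
    finally show ?thesis
      by (simp add: set_lebesgue_integral_def)
  qed
  have "(LINT x:A|lebesgue. norm (f x)) = (\<integral>x. norm (indicator A x *\<^sub>R f x) \<partial>lebesgue)"
    by (simp add: set_lebesgue_integral_def)
  also have "\<dots> = enn2real (\<integral>\<^sup>+ x. ennreal (norm (indicator A x *\<^sub>R f x)) \<partial>lebesgue)"
    by (rule integral_eq_nn_integral[OF measurable_compose[OF fm borel_measurable_norm]]) simp
  also have "(\<integral>\<^sup>+ x. ennreal (norm (indicator A x *\<^sub>R f x)) \<partial>lebesgue) = (\<integral>\<^sup>+ x. ennreal (norm (g x)) * indicator A x \<partial>lebesgue)"
  proof (intro nn_integral_cong_AE)
    show "AE x in lebesgue. ennreal (norm (indicator A x *\<^sub>R f x)) = ennreal (norm (g x)) * indicator A x"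
      using AE by eventually_elim (auto split: split_indicator_asm split_indicator)
  qed
  finally show "(LINT x:A|lebesgue. norm (f x)) = enn2real (\<integral>\<^sup>+ x. ennreal (norm (g x)) * indicator A x \<partial>lborel)"
    by (simp add: nn_integral_completion)
qed

context
  fixes \<alpha> :: real and M :: "complex measure" and \<sigma> :: "complex \<Rightarrow> complex"
  assumes \<alpha>: "-1 < \<alpha>" and M: "complex_borel_measure M \<sigma>"
    and fin: "(\<integral>\<^sup>+ w. ennreal ((1 - (norm w)\<^sup>2) powr (\<alpha> + 1)) \<partial>M) < \<infinity>"
begin

section \<open>The measure\<close>

lemma sets_M: "sets M = sets (restrict_space borel unit_disc)"
  using M by (simp add: complex_borel_measure_def)

lemma space_M: "space M = unit_disc"
  using sets_eq_imp_space_eq[OF sets_M] by (simp add: space_restrict_space)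

lemma measurable_M: "(f :: complex \<Rightarrow> 'b::topological_space) \<in> borel_measurable borel \<Longrightarrow> f \<in> borel_measurable M"
  unfolding measurable_cong_sets[OF sets_M refl] by (rule measurable_restrict_space1)

lemma ident_M: "(\<lambda>w. w) \<in> borel_measurable M"
  by (rule measurable_M) simp

lemma measurable_sigma: "\<sigma> \<in> borel_measurable M"
  using M by (simp add: complex_borel_measure_def)

lemma norm_sigma: "w \<in> unit_disc \<Longrightarrow> norm (\<sigma> w) = 1"
  using M by (simp add: complex_borel_measure_def)

text \<open>The total mass may be infinite, but the weight is positive on the disc and has a finite
  integral, so by Markov's inequality its superlevel sets have finite mass. Fubini's theorem depends
  on this.\<close>

lemma sigma_finite_M: "sigma_finite_measure M"
proof
  define u where "u w = ennreal ((1 - (norm w)\<^sup>2) powr (\<alpha> + 1))" for w :: complex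
  have u [measurable]: "u \<in> borel_measurable M"
    unfolding u_def[abs_def] by (rule measurable_M) measurable
  define A where "A n = {w \<in> space M. 1 \<le> of_nat n * u w}" for n :: nat
  have A: "A n \<in> sets M" for n
    unfolding A_def by measurable
  have "emeasure M (A n) < \<infinity>" for n
  proof -
    have "emeasure M (A n) \<le> of_nat n * (\<integral>\<^sup>+ w. u w * indicator (space M) w \<partial>M)"
      unfolding A_def by (intro nn_integral_Markov_inequality) auto
    also have "(\<integral>\<^sup>+ w. u w * indicator (space M) w \<partial>M) = (\<integral>\<^sup>+ w. u w \<partial>M)"
      by (intro nn_integral_cong) simp
    also have "of_nat n * (\<integral>\<^sup>+ w. u w \<partial>M) < \<infinity>"
      using fin by (simp add: u_def ennreal_mult_less_top of_nat_less_top)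
    finally show ?thesis .
  qed
  moreover have "(\<Union>n. A n) = space M"
  proof (intro equalityI subsetI)
    fix w assume w: "w \<in> space M"
    define x where "x = (1 - (norm w)\<^sup>2) powr (\<alpha> + 1)"
    have x: "0 < x"
      using one_minus_norm_square_pos[of w] w by (simp add: x_def space_M)
    obtain n :: nat where "1 / x < real n"
      using reals_Archimedean2 by blast
    then have "1 \<le> real n * x"
      using x by (simp add: field_simps)
    then have "1 \<le> of_nat n * u w"
      using x by (simp add: u_def x_def[symmetric] ennreal_of_nat_eq_real_of_nat ennreal_mult'[symmetric])
    then show "w \<in> (\<Union>n. A n)"
      using w by (auto simp: A_def)
  qed (auto simp: A_def)
  ultimately show "\<exists>A. countable A \<and> A \<subseteq> sets M \<and> \<Union> A = space M \<and> (\<forall>a\<in>A. emeasure M a \<noteq> \<infinity>)"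
    using A by (intro exI[of _ "range A"]) (auto simp: less_top[symmetric])
qed

lemma pair_sigma_finite_M: "pair_sigma_finite (lborel :: 'b::euclidean_space measure) M"
  by (intro pair_sigma_finite.intro sigma_finite_M lborel.sigma_finite_measure_axioms)

lemma measurable_pair_M:
  fixes f :: "complex \<times> complex \<Rightarrow> 'b::topological_space"
  assumes f: "f \<in> borel_measurable borel" and g: "g \<in> borel_measurable borel"
  shows "(\<lambda>(x, w). f (g x, w)) \<in> borel_measurable (lborel \<Otimes>\<^sub>M M)"
proof -
  have "(\<lambda>p. (g (fst p), snd p)) \<in> borel_measurable (lborel \<Otimes>\<^sub>M M)"
    using g ident_M
    by (intro borel_measurable_Pair measurable_compose[OF measurable_fst] measurable_compose[OF measurable_snd]) auto
  from measurable_compose[OF this f] show ?thesis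
    by (simp add: split_beta')
qed

text \<open>Extension by 0 off the bidisc gives a Borel function on the whole product, although
  \<open>M\<close> lives on the disc and \<open>lborel\<close> on the plane.\<close>

definition green_kernel :: "complex \<times> complex \<Rightarrow> complex"
  where "green_kernel p = (if fst p \<in> unit_disc \<and> snd p \<in> unit_disc then green_function \<alpha> (fst p) (snd p) else 0)"

lemma measurable_kernel: "green_kernel \<in> borel_measurable borel"
proof -
  define P where "P p = (1 - cnj (fst p) * snd p) powr of_real \<alpha>" for p :: "complex \<times> complex"
  have "continuous_on (unit_disc \<times> unit_disc) P"
    unfolding P_def[abs_def]
  proof (rule continuous_on_compose2[where t="- \<real>\<^sub>\<le>\<^sub>0" and f="\<lambda>p. 1 - cnj (fst p) * snd p" and g="\<lambda>x. x powr of_real \<alpha>"])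
    show "continuous_on (- \<real>\<^sub>\<le>\<^sub>0) (\<lambda>x :: complex. x powr of_real \<alpha>)"
      by (rule DERIV_continuous_on[OF has_field_derivative_at_within[OF has_field_derivative_powr]]) auto
    show "continuous_on (unit_disc \<times> unit_disc) (\<lambda>p :: complex \<times> complex. 1 - cnj (fst p) * snd p)"
      by (intro continuous_intros)
    show "(\<lambda>p. 1 - cnj (fst p) * snd p) ` (unit_disc \<times> unit_disc) \<subseteq> - \<real>\<^sub>\<le>\<^sub>0"
      using one_minus_cnj_mult(2) by (fastforce simp: complex_nonpos_Reals_iff)
  qed
  moreover have D: "unit_disc \<times> unit_disc \<in> sets (borel :: (complex \<times> complex) measure)"
    by (intro borel_open open_Times) auto
  ultimately have P: "(\<lambda>p. indicator (unit_disc \<times> unit_disc) p *\<^sub>R P p) \<in> borel_measurable borel"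
    by (intro borel_measurable_continuous_on_indicator)
  \<comment> \<open>The value of \<open>green_h\<close> at 1 is a default of the integral, but it is
    what the kernel takes on the diagonal. Adding it as a separate point keeps \<open>H\<close>
    Borel and makes the equality with the kernel hold everywhere.\<close>
  define H where "H s = indicator {0<..<1} s *\<^sub>R green_h \<alpha> s + (if s = 1 then green_h \<alpha> 1 else 0)" for s :: real
  have "continuous_on {0<..<1} (green_h \<alpha>)"
    by (rule DERIV_continuous_on[where D="\<lambda>s. s powr \<alpha> / (1 - s)"])
       (rule has_field_derivative_at_within, rule green_h_has_derivative[OF \<alpha>], auto)
  then have "(\<lambda>s. indicator {0<..<1} s *\<^sub>R green_h \<alpha> s) \<in> borel_measurable borel"
    by (intro borel_measurable_continuous_on_indicator) auto
  then have [measurable]: "H \<in> borel_measurable borel"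
    unfolding H_def[abs_def] by measurable
  have [measurable]: "fst \<in> borel_measurable (borel :: (complex \<times> complex) measure)"
    "snd \<in> borel_measurable (borel :: (complex \<times> complex) measure)"
    by (intro borel_measurable_continuous_onI continuous_intros)+
  have cm: "cnj \<in> borel_measurable borel"
    by (intro borel_measurable_continuous_onI continuous_intros)
  have [measurable]: "(\<lambda>p :: complex \<times> complex. cnj (snd p)) \<in> borel_measurable borel"
    by (rule measurable_compose[OF _ cm]) measurable
  have "(\<lambda>p. H (green_g (fst p) (snd p))) \<in> borel_measurable borel"
    unfolding green_g_def by measurable
  then have "(\<lambda>p. indicator (unit_disc \<times> unit_disc) p *\<^sub>R P p * of_real (H (green_g (fst p) (snd p)))) \<in> borel_measurable borel"
    using P by measurable
  also have "(\<lambda>p. indicator (unit_disc \<times> unit_disc) p *\<^sub>R P p * of_real (H (green_g (fst p) (snd p)))) = green_kernel"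
  proof
    fix p :: "complex \<times> complex"
    show "indicator (unit_disc \<times> unit_disc) p *\<^sub>R P p * of_real (H (green_g (fst p) (snd p))) = green_kernel p"
    proof (cases "p \<in> unit_disc \<times> unit_disc")
      case True
      then have p: "fst p \<in> unit_disc" "snd p \<in> unit_disc" by auto
      have "H (green_g (fst p) (snd p)) = green_h \<alpha> (green_g (fst p) (snd p))"
        using green_g_pos[OF p] green_g_le_1[OF p] by (cases "green_g (fst p) (snd p) = 1") (auto simp: H_def)
      then show ?thesis
        using True p by (simp add: green_kernel_def P_def green_function_def)
    qed (auto simp: green_kernel_def mem_Times_iff)
  qed
  finally show ?thesis .
qed

lemma kernel_eq: "z \<in> unit_disc \<Longrightarrow> w \<in> unit_disc \<Longrightarrow> green_kernel (z, w) = green_function \<alpha> z w"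
  by (simp add: green_kernel_def)

text \<open>The majorant is infinite on the diagonal, so that finiteness of its integral against \<open>M\<close> at
  \<open>z\<close> also excludes an atom of \<open>M\<close> at \<open>z\<close>.\<close>

definition ext_majorant :: "complex \<times> complex \<Rightarrow> ennreal"
  where "ext_majorant p = (if fst p = snd p then \<infinity> else ennreal (green_majorant \<alpha> (fst p) (snd p)))"

lemma measurable_majorant: "ext_majorant \<in> borel_measurable borel"
proof -
  have [measurable]: "fst \<in> borel_measurable (borel :: (complex \<times> complex) measure)"
    "snd \<in> borel_measurable (borel :: (complex \<times> complex) measure)"
    by (intro borel_measurable_continuous_onI continuous_intros)+
  have cm: "cnj \<in> borel_measurable borel"
    by (intro borel_measurable_continuous_onI continuous_intros)
  have [measurable]: "(\<lambda>p :: complex \<times> complex. cnj (snd p)) \<in> borel_measurable borel"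
    by (rule measurable_compose[OF _ cm]) measurable
  show ?thesis
    unfolding ext_majorant_def[abs_def] green_majorant_def by measurable
qed

lemma measurable_majorant_section: "(\<lambda>w. ext_majorant (z, w)) \<in> borel_measurable M"
  by (rule measurable_M, rule measurable_compose[OF _ measurable_majorant])
     (intro borel_measurable_continuous_onI continuous_intros)

lemma measurable_kernel_section: "(\<lambda>w. green_kernel (z, w)) \<in> borel_measurable M"
  by (rule measurable_M, rule measurable_compose[OF _ measurable_kernel])
     (intro borel_measurable_continuous_onI continuous_intros)

lemma norm_kernel_le: "z \<in> unit_disc \<Longrightarrow> w \<in> unit_disc \<Longrightarrow> ennreal (norm (green_kernel (z, w))) \<le> ext_majorant (z, w)"
  using green_function_bound[OF \<alpha>, of z w] by (auto simp: ext_majorant_def kernel_eq intro: ennreal_leI)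

text \<open>A Borel stand-in for the potential, without the test for convergence; the two agree
  wherever the majorant has a finite integral.\<close>

definition kernel_integral :: "complex \<Rightarrow> complex"
  where "kernel_integral z = (\<integral>w. green_kernel (z, w) * \<sigma> w \<partial>M)"

lemma measurable_potential: "kernel_integral \<in> borel_measurable borel"
proof -
  interpret sigma_finite_measure M by (rule sigma_finite_M)
  have "(\<lambda>(z, w). green_kernel (z, w) * \<sigma> w) \<in> borel_measurable (lborel \<Otimes>\<^sub>M M)"
    using borel_measurable_times[OF measurable_pair_M[OF measurable_kernel measurable_ident_sets[OF refl]] measurable_compose[OF measurable_snd measurable_sigma]]
    by (simp add: split_beta')
  from borel_measurable_lebesgue_integral[OF this] show ?thesis
    by (simp add: kernel_integral_def[abs_def])
qed

lemma norm_potential_le: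
  assumes z: "z \<in> unit_disc"
  shows "ennreal (norm (kernel_integral z)) \<le> (\<integral>\<^sup>+ w. ext_majorant (z, w) \<partial>M)"
\<comment> \<open>If the integrand is not integrable, the integral has the default value 0 and the
  bound is trivial.\<close>
proof (cases "integrable M (\<lambda>w. green_kernel (z, w) * \<sigma> w)")
  case True
  have "ennreal (norm (kernel_integral z)) \<le> (\<integral>\<^sup>+ w. ennreal (norm (green_kernel (z, w) * \<sigma> w)) \<partial>M)"
    unfolding kernel_integral_def by (rule integral_norm_bound_ennreal[OF True])
  also have "\<dots> \<le> (\<integral>\<^sup>+ w. ext_majorant (z, w) \<partial>M)"
    using norm_kernel_le[OF z] by (intro nn_integral_mono) (simp add: norm_mult norm_sigma space_M)
  finally show ?thesis .
qed (simp add: kernel_integral_def not_integrable_integral_eq)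

lemma
  assumes z: "z \<in> unit_disc" and f: "(\<integral>\<^sup>+ w. ext_majorant (z, w) \<partial>M) < \<infinity>"
  shows converges_of_finite: "green_potential_converges \<alpha> M z"
    and green_potential_eq: "green_potential \<alpha> M \<sigma> z = kernel_integral z"
proof -
  have "{z} \<in> sets M"
    unfolding sets_M using z by (auto simp: sets_restrict_space intro!: image_eqI[of _ _ "{z}"])
  then have "\<infinity> * emeasure M {z} = (\<integral>\<^sup>+ w. \<infinity> * indicator {z} w \<partial>M)"
    by (simp add: nn_integral_cmult_indicator)
  also have "\<dots> \<le> (\<integral>\<^sup>+ w. ext_majorant (z, w) \<partial>M)"
    by (intro nn_integral_mono) (auto simp: ext_majorant_def split: split_indicator)
  finally have "\<infinity> * emeasure M {z} < \<infinity>"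
    using f by (rule le_less_trans)
  then have atom: "emeasure M {z} = 0"
    by (auto simp: ennreal_mult_less_top)
  have "integrable M (\<lambda>w. green_kernel (z, w))"
  proof (rule integrableI_bounded)
    have "(\<integral>\<^sup>+ w. ennreal (norm (green_kernel (z, w))) \<partial>M) \<le> (\<integral>\<^sup>+ w. ext_majorant (z, w) \<partial>M)"
      using norm_kernel_le[OF z] by (intro nn_integral_mono) (simp add: space_M)
    then show "(\<integral>\<^sup>+ w. ennreal (norm (green_kernel (z, w))) \<partial>M) < \<infinity>"
      using f by (rule le_less_trans)
  qed (rule measurable_kernel_section)
  moreover have "integrable M (\<lambda>w. green_kernel (z, w)) \<longleftrightarrow> integrable M (green_function \<alpha> z)"
    by (rule Bochner_Integration.integrable_cong) (use z in \<open>auto simp: kernel_eq space_M\<close>)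
  ultimately show conv: "green_potential_converges \<alpha> M z"
    using atom by (simp add: green_potential_converges_def)
  have "(\<integral>w. green_function \<alpha> z w * \<sigma> w \<partial>M) = (\<integral>w. green_kernel (z, w) * \<sigma> w \<partial>M)"
    by (rule Bochner_Integration.integral_cong) (use z in \<open>auto simp: kernel_eq space_M\<close>)
  then show "green_potential \<alpha> M \<sigma> z = kernel_integral z"
    using conv by (simp add: green_potential_def cm_integral_def kernel_integral_def)
qed

section \<open>Area integrals of the potential\<close>

lemma area_majorant:
  assumes \<rho>: "\<rho> < 1"
  shows "(\<integral>\<^sup>+ z. (\<integral>\<^sup>+ w. ext_majorant (z, w) \<partial>M) * indicator (cball 0 \<rho>) z \<partial>lborel) < \<infinity>"
proof -
  interpret pair_sigma_finite "lborel :: complex measure" M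
    by (rule pair_sigma_finite_M)
  define K where "K = 2 * green_h_const \<alpha> * (1 - \<rho>) powr (- \<alpha> - 3 / 2)"
  have K: "0 \<le> K"
    using green_h_const_pos[OF \<alpha>] by (simp add: K_def)
  have maj: "(\<lambda>(z, w). ext_majorant (z, w) * indicator (cball 0 \<rho>) z) \<in> borel_measurable (lborel \<Otimes>\<^sub>M M)"
  proof -
    have "(\<lambda>p. indicator (cball 0 \<rho>) (fst p) :: ennreal) \<in> borel_measurable (lborel \<Otimes>\<^sub>M M)"
      by (rule measurable_compose[OF measurable_fst borel_measurable_indicator]) simp
    from borel_measurable_times_ennreal[OF measurable_pair_M[OF measurable_majorant measurable_ident_sets[OF refl]] this]
    show ?thesis by (simp add: split_beta')
  qed
  have "(\<integral>\<^sup>+ z. (\<integral>\<^sup>+ w. ext_majorant (z, w) \<partial>M) * indicator (cball 0 \<rho>) z \<partial>lborel)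
      = (\<integral>\<^sup>+ z. (\<integral>\<^sup>+ w. ext_majorant (z, w) * indicator (cball 0 \<rho>) z \<partial>M) \<partial>lborel)"
    by (intro nn_integral_cong nn_integral_multc[symmetric] measurable_majorant_section)
  also have "\<dots> = (\<integral>\<^sup>+ w. (\<integral>\<^sup>+ z. ext_majorant (z, w) * indicator (cball 0 \<rho>) z \<partial>lborel) \<partial>M)"
    by (rule Fubini'[OF maj, symmetric])
  also have "\<dots> \<le> (\<integral>\<^sup>+ w. ennreal (K * 64) * ennreal ((1 - (norm w)\<^sup>2) powr (\<alpha> + 1)) \<partial>M)"
  proof (intro nn_integral_mono)
    fix w assume "w \<in> space M"
    then have w: "w \<in> unit_disc" by (simp add: space_M)
    define c where "c = K * (1 - (norm w)\<^sup>2) powr (\<alpha> + 1)"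
    have c: "0 \<le> c" using K by (simp add: c_def)
    \<comment> \<open>For fixed \<open>w\<close> the diagonal is the single point z = w, so the
      infinite value does not affect the area integral.\<close>
    have "AE z in lborel. ext_majorant (z, w) * indicator (cball 0 \<rho>) z \<le> ennreal c * (ennreal (1 / norm (z - w)) * indicator unit_disc z)"
      using AE_lborel_singleton[of w]
    proof eventually_elim
      case (elim z)
      show ?case
      proof (cases "norm z \<le> \<rho>")
        case True
        have "green_majorant \<alpha> z w \<le> c * (1 / norm (z - w))"
          using green_majorant_local_bound[OF \<alpha> True \<rho> w elim] by (simp add: c_def K_def)
        then show ?thesis
          using elim True \<rho> c by (simp add: ext_majorant_def ennreal_mult'[symmetric] ennreal_leI)
      qed simp
    qed
    then have "(\<integral>\<^sup>+ z. ext_majorant (z, w) * indicator (cball 0 \<rho>) z \<partial>lborel)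
        \<le> (\<integral>\<^sup>+ z. ennreal c * (ennreal (1 / norm (z - w)) * indicator unit_disc z) \<partial>lborel)"
      by (rule nn_integral_mono_AE)
    also have "\<dots> = ennreal c * (\<integral>\<^sup>+ z. ennreal (1 / norm (z - w)) * indicator unit_disc z \<partial>lborel)"
      by (rule nn_integral_cmult) measurable
    also have "\<dots> \<le> ennreal c * ennreal 64"
      by (intro mult_left_mono nn_integral_inverse_dist w) auto
    also have "\<dots> = ennreal (c * 64)"
      using c by (simp add: ennreal_mult)
    also have "c * 64 = (K * 64) * (1 - (norm w)\<^sup>2) powr (\<alpha> + 1)"
      by (simp add: c_def)
    finally show "(\<integral>\<^sup>+ z. ext_majorant (z, w) * indicator (cball 0 \<rho>) z \<partial>lborel)
        \<le> ennreal (K * 64) * ennreal ((1 - (norm w)\<^sup>2) powr (\<alpha> + 1))"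
      using K by (simp only: ennreal_mult powr_ge_zero mult_nonneg_nonneg zero_le_numeral)
  qed
  also have "\<dots> = ennreal (K * 64) * (\<integral>\<^sup>+ w. ennreal ((1 - (norm w)\<^sup>2) powr (\<alpha> + 1)) \<partial>M)"
    by (rule nn_integral_cmult) (rule measurable_M, measurable)
  also have "\<dots> < \<infinity>"
    using fin by (simp add: ennreal_mult_less_top)
  finally show ?thesis .
qed

lemma AE_majorant_finite: "AE z in lborel. z \<in> unit_disc \<longrightarrow> (\<integral>\<^sup>+ w. ext_majorant (z, w) \<partial>M) < \<infinity>"
proof -
  interpret sigma_finite_measure M by (rule sigma_finite_M)
  have m: "(\<lambda>z. \<integral>\<^sup>+ w. ext_majorant (z, w) \<partial>M) \<in> borel_measurable lborel"
    using borel_measurable_nn_integral[OF measurable_pair_M[OF measurable_majorant measurable_ident_sets[OF refl]]] by simp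
  \<comment> \<open>The finite integral is available on closed discs of radius less than 1;
    countably many of them exhaust the disc.\<close>
  have "AE z in lborel. (\<integral>\<^sup>+ w. ext_majorant (z, w) \<partial>M) * indicator (cball 0 (1 - 1 / real (Suc n))) z \<noteq> \<infinity>" for n
    using area_majorant[of "1 - 1 / real (Suc n)"] m by (intro nn_integral_PInf_AE borel_measurable_times_ennreal borel_measurable_indicator) auto
  then have "AE z in lborel. \<forall>n. (\<integral>\<^sup>+ w. ext_majorant (z, w) \<partial>M) * indicator (cball 0 (1 - 1 / real (Suc n))) z \<noteq> \<infinity>"
    by (simp add: AE_all_countable)
  then show ?thesis
  proof eventually_elim
    case (elim z)
    show ?case
    proof
      assume "z \<in> unit_disc"
      then have "0 < 1 - norm z" by simp
      then obtain n where "1 / real (Suc n) < 1 - norm z"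
        using nat_approx_posE by blast
      then have "norm z \<le> 1 - 1 / real (Suc n)" by simp
      then show "(\<integral>\<^sup>+ w. ext_majorant (z, w) \<partial>M) < \<infinity>"
        using elim[rule_format, of n] by (simp add: less_top)
    qed
  qed
qed

lemma AE_converges: "AE z in lborel. z \<in> unit_disc \<longrightarrow> green_potential_converges \<alpha> M z"
  using AE_majorant_finite by eventually_elim (auto intro: converges_of_finite)

lemma AE_green_potential_eq: "AE z in lborel. z \<in> unit_disc \<longrightarrow> green_potential \<alpha> M \<sigma> z = kernel_integral z"
  using AE_majorant_finite by eventually_elim (auto intro: green_potential_eq)

lemma area_potential:
  assumes "\<rho> < 1" "A \<subseteq> cball 0 \<rho>"
  shows "(\<integral>\<^sup>+ z. ennreal (norm (kernel_integral z)) * indicator A z \<partial>lborel) < \<infinity>"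
proof -
  have "(\<integral>\<^sup>+ z. ennreal (norm (kernel_integral z)) * indicator A z \<partial>lborel)
      \<le> (\<integral>\<^sup>+ z. (\<integral>\<^sup>+ w. ext_majorant (z, w) \<partial>M) * indicator (cball 0 \<rho>) z \<partial>lborel)"
    using assms by (intro nn_integral_mono) (auto split: split_indicator intro!: norm_potential_le)
  then show ?thesis
    using area_majorant[OF assms(1)] by (rule le_less_trans)
qed

lemma compact_subset_disc:
  assumes "compact K" "K \<subseteq> unit_disc"
  obtains \<rho> where "0 \<le> \<rho>" "\<rho> < 1" "K \<subseteq> cball 0 \<rho>"
proof (cases "K = {}")
  case True
  then show ?thesis using that[of 0] by auto
next
  case False
  then obtain x where "x \<in> K" "\<And>y. y \<in> K \<Longrightarrow> norm y \<le> norm x"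
    using continuous_attains_sup[OF assms(1) False, of norm] by (auto intro: continuous_intros)
  then show ?thesis
    by (intro that[of "norm x"]) (use assms in auto)
qed

lemma L1_loc_green_potential: "L1_loc_disc (green_potential \<alpha> M \<sigma>)"
  unfolding L1_loc_disc_def
proof (intro allI impI)
  fix K :: "complex set" assume K: "compact K \<and> K \<subseteq> unit_disc"
  obtain \<rho> where \<rho>: "\<rho> < 1" "K \<subseteq> cball 0 \<rho>"
    using compact_subset_disc[of K] K by metis
  show "green_potential \<alpha> M \<sigma> absolutely_integrable_on K"
  proof (rule absolutely_integrable_AE_cong(1)[OF measurable_potential])
    show "K \<in> sets borel"
      using K by (simp add: borel_compact)
    show "AE z in lborel. z \<in> K \<longrightarrow> green_potential \<alpha> M \<sigma> z = kernel_integral z"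
      using AE_green_potential_eq by eventually_elim (use K in auto)
    show "(\<integral>\<^sup>+ z. ennreal (norm (kernel_integral z)) * indicator K z \<partial>lborel) < \<infinity>"
      by (rule area_potential[OF \<rho>])
  qed
qed

text \<open>By Fubini's theorem the pairing with \<open>L_bar\<close> of a test function becomes the
  integral over w of the pairing for G(., w), which is pi \<phi>(w); the normalization of area
  removes the pi. Integrability on the product holds because \<open>L_bar \<alpha> \<phi>\<close> is
  bounded and supported in a smaller disc.\<close>

lemma distr_green_potential:
  "distr_eq (L_distr \<alpha> (distr_of_fun (green_potential \<alpha> M \<sigma>))) (cm_integral M \<sigma>)"
  unfolding distr_eq_def
proof (intro allI impI)
  fix \<phi> assume \<phi>: "test_function \<phi>"
  interpret pair_sigma_finite "lborel :: complex measure" M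
    by (rule pair_sigma_finite_M)
  define L where "L = L_bar \<alpha> \<phi>"
  obtain \<rho> where \<rho>: "0 < \<rho>" "\<rho> < 1" and L0: "\<And>z. \<rho> \<le> norm z \<Longrightarrow> L z = 0"
    using test_function_support[OF \<phi>, of \<alpha>] unfolding L_def by metis
  have contL: "continuous_on UNIV L"
    unfolding L_def by (rule continuous_on_L_bar[OF \<phi>])
  have [measurable]: "L \<in> borel_measurable borel"
    by (rule borel_measurable_continuous_onI[OF contL])
  obtain C where C: "0 < C" "\<And>z. norm (L z) \<le> C"
    using bounded_continuous_compact_support[OF contL L0] by blast
  have "(LINT z:unit_disc|lebesgue. green_potential \<alpha> M \<sigma> z * L z)
      = (LINT z:cball 0 \<rho>|lebesgue. green_potential \<alpha> M \<sigma> z * L z)"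
    unfolding set_lebesgue_integral_def
    by (intro Bochner_Integration.integral_cong) (use \<rho> L0 in \<open>auto split: split_indicator\<close>)
  also have "\<dots> = (LINT z:cball 0 \<rho>|lborel. kernel_integral z * L z)"
  proof (rule absolutely_integrable_AE_cong(2)[OF measurable_potential])
    show "AE z in lborel. z \<in> cball 0 \<rho> \<longrightarrow> green_potential \<alpha> M \<sigma> z = kernel_integral z"
      using AE_green_potential_eq by eventually_elim (use \<rho> in auto)
    show "(\<integral>\<^sup>+ z. ennreal (norm (kernel_integral z)) * indicator (cball 0 \<rho>) z \<partial>lborel) < \<infinity>"
      by (rule area_potential[OF \<rho>(2)]) simp
  qed auto
  also have "\<dots> = (\<integral>z. kernel_integral z * L z \<partial>lborel)"
    unfolding set_lebesgue_integral_def
    by (intro Bochner_Integration.integral_cong) (use L0 in \<open>auto split: split_indicator\<close>)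
  also have "\<dots> = (\<integral>z. (\<integral>w. green_kernel (z, w) * \<sigma> w * L z \<partial>M) \<partial>lborel)"
    by (simp add: kernel_integral_def)
  also have "\<dots> = (\<integral>w. (\<integral>z. green_kernel (z, w) * \<sigma> w * L z \<partial>lborel) \<partial>M)"
  proof (rule Fubini_integral[symmetric])
    have meas: "(\<lambda>(z, w). green_kernel (z, w) * \<sigma> w * L z) \<in> borel_measurable (lborel \<Otimes>\<^sub>M M)"
    proof -
      have "L \<in> borel_measurable lborel" by simp
      from borel_measurable_times[OF borel_measurable_times[OF measurable_pair_M[OF measurable_kernel measurable_ident_sets[OF refl]]
          measurable_compose[OF measurable_snd measurable_sigma]] measurable_compose[OF measurable_fst this]]
      show ?thesis by (simp add: split_beta')
    qed
    show "integrable (lborel \<Otimes>\<^sub>M M) (\<lambda>(z, w). green_kernel (z, w) * \<sigma> w * L z)"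
    proof (rule integrableI_bounded[OF meas])
      have "(\<integral>\<^sup>+ p. ennreal (norm (case p of (z, w) \<Rightarrow> green_kernel (z, w) * \<sigma> w * L z)) \<partial>(lborel \<Otimes>\<^sub>M M))
         = (\<integral>\<^sup>+ z. (\<integral>\<^sup>+ w. ennreal (norm (green_kernel (z, w) * \<sigma> w * L z)) \<partial>M) \<partial>lborel)"
        using M2.nn_integral_fst[OF measurable_compose[OF meas, of "\<lambda>x. ennreal (norm x)"]] by simp
      also have "\<dots> \<le> (\<integral>\<^sup>+ z. ennreal C * ((\<integral>\<^sup>+ w. ext_majorant (z, w) \<partial>M) * indicator (cball 0 \<rho>) z) \<partial>lborel)"
      proof (intro nn_integral_mono)
        fix z :: complex
        show "(\<integral>\<^sup>+ w. ennreal (norm (green_kernel (z, w) * \<sigma> w * L z)) \<partial>M)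
          \<le> ennreal C * ((\<integral>\<^sup>+ w. ext_majorant (z, w) \<partial>M) * indicator (cball 0 \<rho>) z)"
        proof (cases "z \<in> cball 0 \<rho>")
          case True
          then have z: "z \<in> unit_disc" using \<rho> by auto
          have "(\<integral>\<^sup>+ w. ennreal (norm (green_kernel (z, w) * \<sigma> w * L z)) \<partial>M) \<le> (\<integral>\<^sup>+ w. ennreal C * ext_majorant (z, w) \<partial>M)"
          proof (intro nn_integral_mono)
            fix w assume "w \<in> space M"
            then have w: "w \<in> unit_disc" by (simp add: space_M)
            have "ennreal (norm (green_kernel (z, w) * \<sigma> w * L z)) = ennreal (norm (L z)) * ennreal (norm (green_kernel (z, w)))"
              using norm_sigma[OF w] by (simp add: norm_mult ennreal_mult'[symmetric] mult.commute)
            also have "\<dots> \<le> ennreal C * ext_majorant (z, w)"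
              by (intro mult_mono ennreal_leI C norm_kernel_le z w) auto
            finally show "ennreal (norm (green_kernel (z, w) * \<sigma> w * L z)) \<le> ennreal C * ext_majorant (z, w)" .
          qed
          also have "\<dots> = ennreal C * (\<integral>\<^sup>+ w. ext_majorant (z, w) \<partial>M)"
            by (rule nn_integral_cmult[OF measurable_majorant_section])
          finally show ?thesis using True by simp
        qed (use L0[of z] in simp)
      qed
      also have "\<dots> = ennreal C * (\<integral>\<^sup>+ z. (\<integral>\<^sup>+ w. ext_majorant (z, w) \<partial>M) * indicator (cball 0 \<rho>) z \<partial>lborel)"
        using M2.borel_measurable_nn_integral[OF measurable_pair_M[OF measurable_majorant measurable_ident_sets[OF refl]]]
        by (intro nn_integral_cmult borel_measurable_times_ennreal borel_measurable_indicator) auto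
      also have "\<dots> < \<infinity>"
        using area_majorant[OF \<rho>(2)] by (simp add: ennreal_mult_less_top)
      finally show "(\<integral>\<^sup>+ p. ennreal (norm (case p of (z, w) \<Rightarrow> green_kernel (z, w) * \<sigma> w * L z)) \<partial>(lborel \<Otimes>\<^sub>M M)) < \<infinity>" .
    qed
  qed
  also have "\<dots> = (\<integral>w. of_real pi * (\<phi> w * \<sigma> w) \<partial>M)"
  proof (intro Bochner_Integration.integral_cong refl)
    fix w assume "w \<in> space M"
    then have w: "w \<in> unit_disc" by (simp add: space_M)
    have "(\<integral>z. green_kernel (z, w) * \<sigma> w * L z \<partial>lborel) = (\<integral>z. \<sigma> w * (green_function \<alpha> z w * L z) \<partial>lborel)"
    proof (intro Bochner_Integration.integral_cong refl)
      fix z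
      show "green_kernel (z, w) * \<sigma> w * L z = \<sigma> w * (green_function \<alpha> z w * L z)"
        using w \<rho> L0[of z] by (cases "z \<in> unit_disc") (auto simp: kernel_eq)
    qed
    also have "\<dots> = \<sigma> w * (of_real pi * \<phi> w)"
      using green_function_L_bar[OF \<alpha> \<phi> w] by (simp add: L_def)
    finally show "(\<integral>z. green_kernel (z, w) * \<sigma> w * L z \<partial>lborel) = of_real pi * (\<phi> w * \<sigma> w)"
      by (simp add: mult_ac)
  qed
  finally have "(LINT z:unit_disc|lebesgue. green_potential \<alpha> M \<sigma> z * L z) = of_real pi * cm_integral M \<sigma> \<phi>"
    by (simp add: cm_integral_def)
  then show "L_distr \<alpha> (distr_of_fun (green_potential \<alpha> M \<sigma>)) \<phi> = cm_integral M \<sigma> \<phi>"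
    by (simp add: L_distr_def distr_of_fun_def L_def)
qed

section \<open>Circle integrals of the potential\<close>

lemma circle_majorant:
  obtains C where "0 \<le> C"
    "\<And>r. 1 / 2 \<le> r \<Longrightarrow> r < 1 \<Longrightarrow>
      (\<integral>\<^sup>+ t. (\<integral>\<^sup>+ w. ext_majorant (of_real r * cis t, w) \<partial>M) * indicator {0..2 * pi} t \<partial>lborel)
      \<le> (\<integral>\<^sup>+ w. ennreal (C * ((1 - r\<^sup>2) / (1 - r * norm w)) powr (\<alpha> + 1) * (1 - (norm w)\<^sup>2) powr (\<alpha> + 1)) \<partial>M)"
proof -
  obtain C where C: "0 \<le> C" and circle: "\<And>r w. 1 / 2 \<le> r \<Longrightarrow> r < 1 \<Longrightarrow> w \<in> unit_disc \<Longrightarrow>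
      (\<integral>\<^sup>+ t. ennreal (norm (1 - of_real r * cis t * cnj w) powr (- (\<alpha> + 3 / 2))
          * norm (of_real r * cis t - w) powr (- 1 / 2)) * indicator {0..2 * pi} t \<partial>lborel)
      \<le> ennreal (C * (1 - r * norm w) powr (1 / 2 - (\<alpha> + 3 / 2)))"
    using nn_integral_circle_kernel[of "\<alpha> + 3 / 2"] \<alpha> by auto
  define h where "h = green_h_const \<alpha>"
  have h: "0 \<le> h" using green_h_const_pos[OF \<alpha>] by (simp add: h_def)
  show ?thesis
  proof (rule that[of "h * C"])
    show "0 \<le> h * C" using h C by simp
    fix r :: real assume r: "1 / 2 \<le> r" "r < 1"
    interpret pair_sigma_finite "lborel :: real measure" M
      by (rule pair_sigma_finite_M)
    have cis_m: "(\<lambda>t. of_real r * cis t) \<in> borel_measurable borel"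
      by (intro borel_measurable_continuous_onI continuous_intros)
    have rz: "of_real r * cis t \<in> unit_disc" for t
      using r by (simp add: norm_mult)
    have maj: "(\<lambda>(t, w). ext_majorant (of_real r * cis t, w) * indicator {0..2 * pi} t) \<in> borel_measurable (lborel \<Otimes>\<^sub>M M)"
    proof -
      have "(\<lambda>p. indicator {0..2 * pi} (fst p) :: ennreal) \<in> borel_measurable (lborel \<Otimes>\<^sub>M M)"
        by (rule measurable_compose[OF measurable_fst borel_measurable_indicator]) simp
      from borel_measurable_times_ennreal[OF measurable_pair_M[OF measurable_majorant cis_m] this]
      show ?thesis by (simp add: split_beta')
    qed
    have "(\<integral>\<^sup>+ t. (\<integral>\<^sup>+ w. ext_majorant (of_real r * cis t, w) \<partial>M) * indicator {0..2 * pi} t \<partial>lborel)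
        = (\<integral>\<^sup>+ t. (\<integral>\<^sup>+ w. ext_majorant (of_real r * cis t, w) * indicator {0..2 * pi} t \<partial>M) \<partial>lborel)"
      by (intro nn_integral_cong nn_integral_multc[symmetric] measurable_majorant_section)
    also have "\<dots> = (\<integral>\<^sup>+ w. (\<integral>\<^sup>+ t. ext_majorant (of_real r * cis t, w) * indicator {0..2 * pi} t \<partial>lborel) \<partial>M)"
      by (rule Fubini'[OF maj, symmetric])
    also have "\<dots> \<le> (\<integral>\<^sup>+ w. ennreal (h * C * ((1 - r\<^sup>2) / (1 - r * norm w)) powr (\<alpha> + 1) * (1 - (norm w)\<^sup>2) powr (\<alpha> + 1)) \<partial>M)"
    proof (intro nn_integral_mono)
      fix w assume "w \<in> space M"
      then have w: "w \<in> unit_disc" by (simp add: space_M)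
      define c where "c = h * (1 - r\<^sup>2) powr (\<alpha> + 1) * (1 - (norm w)\<^sup>2) powr (\<alpha> + 1)"
      have c: "0 \<le> c" using h by (simp add: c_def)
      let ?k = "\<lambda>t. ennreal (norm (1 - of_real r * cis t * cnj w) powr (- (\<alpha> + 3 / 2))
          * norm (of_real r * cis t - w) powr (- 1 / 2)) * indicator {0..2 * pi} t"
      have km: "?k \<in> borel_measurable borel"
      proof -
        have "(\<lambda>t. norm (1 - of_real r * cis t * cnj w)) \<in> borel_measurable borel"
          "(\<lambda>t. norm (of_real r * cis t - w)) \<in> borel_measurable borel"
          by (intro borel_measurable_continuous_onI continuous_intros)+
        then show ?thesis by measurable
      qed
      have "countable {t. of_real r * cis t = w}"
        using r by (intro countable_cis_eq) auto
      then have "AE t in lborel. of_real r * cis t \<noteq> w"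
        by (intro AE_I'[OF countable_imp_null_set_lborel]) auto
      then have "AE t in lborel. ext_majorant (of_real r * cis t, w) * indicator {0..2 * pi} t = ennreal c * ?k t"
      proof eventually_elim
        case (elim t)
        have "norm (of_real r * cis t) = r"
          using r by (simp add: norm_mult)
        then have "green_majorant \<alpha> (of_real r * cis t) w = c * (norm (1 - of_real r * cis t * cnj w) powr (- (\<alpha> + 3 / 2))
          * norm (of_real r * cis t - w) powr (- 1 / 2))"
          unfolding green_majorant_def c_def h_def by (simp add: mult_ac)
        then show ?case
          using elim c by (simp add: ext_majorant_def ennreal_mult mult.assoc)
      qed
      then have "(\<integral>\<^sup>+ t. ext_majorant (of_real r * cis t, w) * indicator {0..2 * pi} t \<partial>lborel)
          = (\<integral>\<^sup>+ t. ennreal c * ?k t \<partial>lborel)"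
        by (rule nn_integral_cong_AE)
      also have "\<dots> = ennreal c * (\<integral>\<^sup>+ t. ?k t \<partial>lborel)"
        using km by (intro nn_integral_cmult) simp
      also have "\<dots> \<le> ennreal c * ennreal (C * (1 - r * norm w) powr (1 / 2 - (\<alpha> + 3 / 2)))"
        by (intro mult_left_mono circle r w) auto
      also have "\<dots> = ennreal (c * (C * (1 - r * norm w) powr (1 / 2 - (\<alpha> + 3 / 2))))"
        using c by (simp add: ennreal_mult')
      \<comment> \<open>The exponents of 1 - r^2 from the majorant and of 1 - r |w| from the circle
        integral are \<alpha>+1 and -(\<alpha>+1), so they combine into the power of one ratio,
        which is the form suited to dominated convergence.\<close>
      also have "c * (C * (1 - r * norm w) powr (1 / 2 - (\<alpha> + 3 / 2)))
          = h * C * ((1 - r\<^sup>2) / (1 - r * norm w)) powr (\<alpha> + 1) * (1 - (norm w)\<^sup>2) powr (\<alpha> + 1)"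
      proof -
        have "r * norm w \<le> r"
          using r w by (intro mult_left_le) auto
        then have "0 \<le> 1 - r * norm w"
          using r by linarith
        moreover have "0 \<le> 1 - r\<^sup>2"
          using r by (simp add: abs_square_le_1)
        ultimately have "((1 - r\<^sup>2) / (1 - r * norm w)) powr (\<alpha> + 1) = (1 - r\<^sup>2) powr (\<alpha> + 1) / (1 - r * norm w) powr (\<alpha> + 1)"
          by (intro powr_divide)
        moreover have "1 / 2 - (\<alpha> + 3 / 2) = - (\<alpha> + 1)" by simp
        then have "(1 - r * norm w) powr (1 / 2 - (\<alpha> + 3 / 2)) = 1 / (1 - r * norm w) powr (\<alpha> + 1)"
          by (simp only: powr_minus_divide)
        ultimately show ?thesis
          by (simp only: c_def) simp
      qed
      finally show "(\<integral>\<^sup>+ t. ext_majorant (of_real r * cis t, w) * indicator {0..2 * pi} t \<partial>lborel)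
        \<le> ennreal (h * C * ((1 - r\<^sup>2) / (1 - r * norm w)) powr (\<alpha> + 1) * (1 - (norm w)\<^sup>2) powr (\<alpha> + 1))" .
    qed
    finally show "(\<integral>\<^sup>+ t. (\<integral>\<^sup>+ w. ext_majorant (of_real r * cis t, w) \<partial>M) * indicator {0..2 * pi} t \<partial>lborel)
        \<le> (\<integral>\<^sup>+ w. ennreal (h * C * ((1 - r\<^sup>2) / (1 - r * norm w)) powr (\<alpha> + 1) * (1 - (norm w)\<^sup>2) powr (\<alpha> + 1)) \<partial>M)" .
  qed
qed

text \<open>The ratio (1 - r^2) / (1 - r |w|) is at most 1 + r \<le> 2, and for fixed w it tends to
  0 because its denominator tends to 1 - |w| > 0. As \<alpha> + 1 > 0, its power is bounded and
  tends to 0 too, and the weight of the hypothesis serves as majorant.\<close>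

lemma circle_majorant_tendsto_0:
  "((\<lambda>r. \<integral>\<^sup>+ t. (\<integral>\<^sup>+ w. ext_majorant (of_real r * cis t, w) \<partial>M) * indicator {0..2 * pi} t \<partial>lborel) \<longlongrightarrow> 0) (at_left 1)"
proof -
  obtain C where C: "0 \<le> C" and bound: "\<And>r. 1 / 2 \<le> r \<Longrightarrow> r < 1 \<Longrightarrow>
      (\<integral>\<^sup>+ t. (\<integral>\<^sup>+ w. ext_majorant (of_real r * cis t, w) \<partial>M) * indicator {0..2 * pi} t \<partial>lborel)
      \<le> (\<integral>\<^sup>+ w. ennreal (C * ((1 - r\<^sup>2) / (1 - r * norm w)) powr (\<alpha> + 1) * (1 - (norm w)\<^sup>2) powr (\<alpha> + 1)) \<partial>M)"
    using circle_majorant by blast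
  define b where "b r w = ennreal (C * ((1 - r\<^sup>2) / (1 - r * norm w)) powr (\<alpha> + 1) * (1 - (norm w)\<^sup>2) powr (\<alpha> + 1))"
    for r :: real and w :: complex
  have bm: "b r \<in> borel_measurable M" for r
    unfolding b_def[abs_def] by (rule measurable_M) measurable
  have "((\<lambda>r. \<integral>\<^sup>+ w. b r w \<partial>M) \<longlongrightarrow> 0) (at_left 1)"
  proof (rule tendsto_at_left_sequentially[of "1 / 2"])
    fix S :: "nat \<Rightarrow> real" assume S: "\<And>n. S n < 1" "\<And>n. 1 / 2 < S n" "S \<longlonglongrightarrow> 1"
    have pos: "0 < 1 - S n * norm w" "S n * norm w \<le> S n" if "w \<in> unit_disc" for n w
    proof -
      show "S n * norm w \<le> S n"
        using that S(2)[of n] by (intro mult_left_le) auto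
      then show "0 < 1 - S n * norm w"
        using S(1)[of n] by linarith
    qed
    have "(\<lambda>n. \<integral>\<^sup>+ w. b (S n) w \<partial>M) \<longlonglongrightarrow> (\<integral>\<^sup>+ w. 0 \<partial>M)"
    proof (rule nn_integral_dominated_convergence[where w="\<lambda>w. ennreal (C * 2 powr (\<alpha> + 1)) * ennreal ((1 - (norm w)\<^sup>2) powr (\<alpha> + 1))", OF bm])
      show "(\<lambda>w. ennreal (C * 2 powr (\<alpha> + 1)) * ennreal ((1 - (norm w)\<^sup>2) powr (\<alpha> + 1))) \<in> borel_measurable M"
        by (rule measurable_M) measurable
      have "(\<integral>\<^sup>+ w. ennreal (C * 2 powr (\<alpha> + 1)) * ennreal ((1 - (norm w)\<^sup>2) powr (\<alpha> + 1)) \<partial>M)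
          = ennreal (C * 2 powr (\<alpha> + 1)) * (\<integral>\<^sup>+ w. ennreal ((1 - (norm w)\<^sup>2) powr (\<alpha> + 1)) \<partial>M)"
        by (rule nn_integral_cmult) (rule measurable_M, measurable)
      then show "(\<integral>\<^sup>+ w. ennreal (C * 2 powr (\<alpha> + 1)) * ennreal ((1 - (norm w)\<^sup>2) powr (\<alpha> + 1)) \<partial>M) < \<infinity>"
        using fin by (simp add: ennreal_mult_less_top)
      show "AE w in M. b (S n) w \<le> ennreal (C * 2 powr (\<alpha> + 1)) * ennreal ((1 - (norm w)\<^sup>2) powr (\<alpha> + 1))" for n
      proof (rule AE_I2)
        fix w assume "w \<in> space M"
        then have w: "w \<in> unit_disc" by (simp add: space_M)
        have "1 - (S n)\<^sup>2 = (1 - S n) * (1 + S n)"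
          by (simp add: power2_eq_square algebra_simps)
        also have "\<dots> \<le> (1 - S n * norm w) * 2"
          using S(1,2)[of n] pos[OF w, of n] by (intro mult_mono) linarith+
        finally have "(1 - (S n)\<^sup>2) / (1 - S n * norm w) \<le> 2"
          using pos(1)[OF w, of n] by (simp add: divide_le_eq mult.commute)
        moreover have "0 \<le> 1 - (S n)\<^sup>2"
          using S(1,2)[of n] by (simp add: abs_square_le_1)
        ultimately have "((1 - (S n)\<^sup>2) / (1 - S n * norm w)) powr (\<alpha> + 1) \<le> 2 powr (\<alpha> + 1)"
          using \<alpha> pos(1)[OF w, of n] by (intro powr_mono2) auto
        then have "C * ((1 - (S n)\<^sup>2) / (1 - S n * norm w)) powr (\<alpha> + 1) * (1 - (norm w)\<^sup>2) powr (\<alpha> + 1)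
            \<le> C * 2 powr (\<alpha> + 1) * (1 - (norm w)\<^sup>2) powr (\<alpha> + 1)"
          using C by (intro mult_right_mono mult_left_mono) auto
        then show "b (S n) w \<le> ennreal (C * 2 powr (\<alpha> + 1)) * ennreal ((1 - (norm w)\<^sup>2) powr (\<alpha> + 1))"
          unfolding b_def using C by (subst ennreal_mult[symmetric]) (auto intro: ennreal_leI)
      qed
      show "AE w in M. (\<lambda>n. b (S n) w) \<longlonglongrightarrow> 0"
      proof (rule AE_I2)
        fix w assume "w \<in> space M"
        then have w: "w \<in> unit_disc" by (simp add: space_M)
        have S_le: "\<bar>S n\<bar> \<le> 1" for n
          using S(1,2)[of n] by linarith
        have "(\<lambda>n. (1 - (S n)\<^sup>2) / (1 - S n * norm w)) \<longlonglongrightarrow> (1 - 1\<^sup>2) / (1 - 1 * norm w)"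
          using w by (intro tendsto_intros S) auto
        then have "(\<lambda>n. ((1 - (S n)\<^sup>2) / (1 - S n * norm w)) powr (\<alpha> + 1)) \<longlonglongrightarrow> 0 powr (\<alpha> + 1)"
          using \<alpha> S_le pos(1)[OF w]
          by (intro tendsto_powr2) (auto intro!: always_eventually divide_nonneg_pos simp: abs_square_le_1 less_imp_le)
        from tendsto_ennrealI[OF tendsto_mult[OF tendsto_mult[OF tendsto_const[of C] this] tendsto_const[of "(1 - (norm w)\<^sup>2) powr (\<alpha> + 1)"]]]
        show "(\<lambda>n. b (S n) w) \<longlonglongrightarrow> 0"
          unfolding b_def by simp
      qed
    qed simp
    then show "(\<lambda>n. \<integral>\<^sup>+ w. b (S n) w \<partial>M) \<longlonglongrightarrow> 0" by simp
  qed simp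
  then show ?thesis
  proof (rule tendsto_sandwich[rotated 2, OF tendsto_const])
    show "\<forall>\<^sub>F r in at_left 1. (\<integral>\<^sup>+ t. (\<integral>\<^sup>+ w. ext_majorant (of_real r * cis t, w) \<partial>M) * indicator {0..2 * pi} t \<partial>lborel)
        \<le> (\<integral>\<^sup>+ w. b r w \<partial>M)"
      unfolding b_def by (rule eventually_at_leftI[of "1 / 2"]) (auto intro: bound)
  qed simp
qed

lemma eventually_circle_majorant_finite:
  "\<forall>\<^sub>F r in at_left (1::real). 1 / 2 < r \<and> r < 1 \<and>
    (\<integral>\<^sup>+ t. (\<integral>\<^sup>+ w. ext_majorant (of_real r * cis t, w) \<partial>M) * indicator {0..2 * pi} t \<partial>lborel) < \<infinity>"
proof (intro eventually_conj)
  show "\<forall>\<^sub>F r in at_left (1::real). 1 / 2 < r" "\<forall>\<^sub>F r in at_left (1::real). r < 1"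
    by (rule eventually_at_leftI[of "1 / 2"]; simp)+
  show "\<forall>\<^sub>F r in at_left 1. (\<integral>\<^sup>+ t. (\<integral>\<^sup>+ w. ext_majorant (of_real r * cis t, w) \<partial>M) * indicator {0..2 * pi} t \<partial>lborel) < \<infinity>"
    using order_tendstoD(2)[OF circle_majorant_tendsto_0, of \<infinity>] by simp
qed

text \<open>Circles are null sets of the plane, so convergence on them does not follow from
  convergence almost everywhere in the disc; it is extracted from the finite circle
  integral.\<close>

lemma AE_circle_majorant_finite:
  assumes r: "1 / 2 < r" "r < 1"
    and f: "(\<integral>\<^sup>+ t. (\<integral>\<^sup>+ w. ext_majorant (of_real r * cis t, w) \<partial>M) * indicator {0..2 * pi} t \<partial>lborel) < \<infinity>"
  shows "AE t in lborel. t \<in> {0..2 * pi} \<longrightarrow> (\<integral>\<^sup>+ w. ext_majorant (of_real r * cis t, w) \<partial>M) < \<infinity>"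
proof -
  interpret sigma_finite_measure M by (rule sigma_finite_M)
  have cis_m: "(\<lambda>t. of_real r * cis t) \<in> borel_measurable borel"
    by (intro borel_measurable_continuous_onI continuous_intros)
  have "(\<lambda>t. \<integral>\<^sup>+ w. ext_majorant (of_real r * cis t, w) \<partial>M) \<in> borel_measurable lborel"
    using borel_measurable_nn_integral[OF measurable_pair_M[OF measurable_majorant cis_m]] by simp
  then have "AE t in lborel. (\<integral>\<^sup>+ w. ext_majorant (of_real r * cis t, w) \<partial>M) * indicator {0..2 * pi} t \<noteq> \<infinity>"
    using f by (intro nn_integral_PInf_AE borel_measurable_times_ennreal borel_measurable_indicator) auto
  then show ?thesis
    by eventually_elim (auto simp: less_top)
qed

lemma eventually_AE_circle_converges:
  "\<forall>\<^sub>F r in at_left 1. AE t in lebesgue. t \<in> {0..2 * pi} \<longrightarrow>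
      green_potential_converges \<alpha> M (of_real r * cis t)"
  using eventually_circle_majorant_finite
proof eventually_elim
  case (elim r)
  then have r: "1 / 2 < r" "r < 1" by auto
  have "AE t in lborel. t \<in> {0..2 * pi} \<longrightarrow> (\<integral>\<^sup>+ w. ext_majorant (of_real r * cis t, w) \<partial>M) < \<infinity>"
    using AE_circle_majorant_finite[OF r] elim by blast
  then have "AE t in lborel. t \<in> {0..2 * pi} \<longrightarrow> green_potential_converges \<alpha> M (of_real r * cis t)"
    by eventually_elim (use r in \<open>auto intro!: converges_of_finite simp: norm_mult\<close>)
  then show ?case
    by (rule AE_completion)
qed

lemma vanishes_green_potential: "vanishes_at_circle_L1 (green_potential \<alpha> M \<sigma>)"
proof -
  define m where "m r = (\<integral>\<^sup>+ t. (\<integral>\<^sup>+ w. ext_majorant (of_real r * cis t, w) \<partial>M) * indicator {0..2 * pi} t \<partial>lborel)" for r :: real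
  have *: "(\<lambda>t. green_potential \<alpha> M \<sigma> (of_real r * cis t)) absolutely_integrable_on {0..2 * pi} \<and>
      (LINT t:{0..2 * pi}|lebesgue. norm (green_potential \<alpha> M \<sigma> (of_real r * cis t))) \<le> enn2real (m r)"
    if r: "1 / 2 < r" "r < 1" and fm: "m r < \<infinity>" for r
  proof -
    have rz: "of_real r * cis t \<in> unit_disc" for t
      using r by (simp add: norm_mult)
    have cis_m: "(\<lambda>t. of_real r * cis t) \<in> borel_measurable borel"
      by (intro borel_measurable_continuous_onI continuous_intros)
    have pm: "(\<lambda>t. kernel_integral (of_real r * cis t)) \<in> borel_measurable borel"
      by (rule measurable_compose[OF cis_m measurable_potential])
    have AE: "AE t in lborel. t \<in> {0..2 * pi} \<longrightarrow> green_potential \<alpha> M \<sigma> (of_real r * cis t) = kernel_integral (of_real r * cis t)"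
      using AE_circle_majorant_finite[OF r fm[unfolded m_def]] by eventually_elim (use rz in \<open>auto intro: green_potential_eq\<close>)
    have le: "(\<integral>\<^sup>+ t. ennreal (norm (kernel_integral (of_real r * cis t))) * indicator {0..2 * pi} t \<partial>lborel) \<le> m r"
      unfolding m_def using norm_potential_le[OF rz] by (intro nn_integral_mono mult_right_mono) auto
    then have fin': "(\<integral>\<^sup>+ t. ennreal (norm (kernel_integral (of_real r * cis t))) * indicator {0..2 * pi} t \<partial>lborel) < \<infinity>"
      using fm by (rule le_less_trans)
    note a = absolutely_integrable_AE_cong[OF pm _ AE fin']
    show ?thesis
      using a(1) a(3) enn2real_mono[OF le] fm by simp
  qed
  have ev: "\<forall>\<^sub>F r in at_left (1::real). 1 / 2 < r \<and> r < 1 \<and> m r < \<infinity>"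
    using eventually_circle_majorant_finite unfolding m_def .
  have lim: "((\<lambda>r. enn2real (m r)) \<longlongrightarrow> 0) (at_left 1)"
    using circle_majorant_tendsto_0 unfolding m_def by (intro tendsto_enn2real) simp_all
  show ?thesis
    unfolding vanishes_at_circle_L1_def
  proof
    show "\<forall>\<^sub>F r in at_left 1. (\<lambda>t. green_potential \<alpha> M \<sigma> (of_real r * cis t)) absolutely_integrable_on {0..2 * pi}"
      using ev by eventually_elim (use * in auto)
    show "((\<lambda>r. (LINT t:{0..2 * pi}|lebesgue. norm (green_potential \<alpha> M \<sigma> (of_real r * cis t))) / (2 * pi)) \<longlongrightarrow> 0) (at_left 1)"
    proof (rule tendsto_sandwich[OF _ _ tendsto_const])
      show "\<forall>\<^sub>F r in at_left 1. 0 \<le> (LINT t:{0..2 * pi}|lebesgue. norm (green_potential \<alpha> M \<sigma> (of_real r * cis t))) / (2 * pi)"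
        by (intro always_eventually allI divide_nonneg_pos) (auto simp: set_lebesgue_integral_def)
      show "\<forall>\<^sub>F r in at_left 1. (LINT t:{0..2 * pi}|lebesgue. norm (green_potential \<alpha> M \<sigma> (of_real r * cis t))) / (2 * pi)
          \<le> enn2real (m r) / (2 * pi)"
        using ev by eventually_elim (use * in \<open>auto intro!: divide_right_mono\<close>)
      show "((\<lambda>r. enn2real (m r) / (2 * pi)) \<longlongrightarrow> 0) (at_left 1)"
        using tendsto_divide[OF lim tendsto_const[of "2 * pi"]] by simp
    qed
  qed
qed

lemma solves_poisson_green_potential: "solves_poisson \<alpha> M \<sigma> (green_potential \<alpha> M \<sigma>)"
  unfolding solves_poisson_def
  using L1_loc_green_potential distr_green_potential vanishes_green_potential by blast

end

section \<open>Smooth cutoffs\<close>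

text \<open>The set \<open>S\<close> makes it possible to piece a function together over an open
  cover: the radial profile of the test functions is treated as a power times a cutoff for t < 1 and
  as 0 beyond a point before 1.\<close>

primrec real_cont_diff :: "nat \<Rightarrow> real set \<Rightarrow> (real \<Rightarrow> real) \<Rightarrow> bool"
  where
    "real_cont_diff 0 S f \<longleftrightarrow> continuous_on S f"
  | "real_cont_diff (Suc k) S f \<longleftrightarrow>
      (\<exists>f'. (\<forall>t\<in>S. (f has_real_derivative f' t) (at t)) \<and> real_cont_diff k S f')"

lemma real_cont_diff_SucI:
  "real_cont_diff k S f' \<Longrightarrow> \<forall>t\<in>S. (f has_real_derivative f' t) (at t) \<Longrightarrow> real_cont_diff (Suc k) S f"
  by auto

lemma real_cont_diff_Suc_D: "real_cont_diff (Suc k) S f \<Longrightarrow> real_cont_diff k S f"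
proof (induction k arbitrary: f)
  case 0
  then obtain f' where f': "\<And>t. t \<in> S \<Longrightarrow> (f has_real_derivative f' t) (at t)"
    by auto
  have "continuous_on S f"
    by (rule DERIV_continuous_on[OF has_field_derivative_at_within[OF f']])
  then show ?case by simp
next
  case (Suc k)
  then obtain f' where "\<forall>t\<in>S. (f has_real_derivative f' t) (at t)" "real_cont_diff (Suc k) S f'"
    unfolding real_cont_diff.simps(2)[of "Suc k"] by blast
  then show ?case
    using Suc.IH unfolding real_cont_diff.simps(2)[of k S f] by blast
qed

lemma real_cont_diff_cong:
  assumes "open S" "\<And>t. t \<in> S \<Longrightarrow> f t = g t" "real_cont_diff k S f"
  shows "real_cont_diff k S g"
proof (cases k)
  case 0
  then show ?thesis using assms continuous_on_cong[of S S f g] by auto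
next
  case (Suc j)
  then obtain f' where f': "\<forall>t\<in>S. (f has_real_derivative f' t) (at t)" "real_cont_diff j S f'"
    using assms(3) by auto
  have "(g has_real_derivative f' t) (at t)" if "t \<in> S" for t
    by (rule has_field_derivative_transform_within_open[OF f'(1)[rule_format, OF that] assms(1) that assms(2)])
  then show ?thesis
    using f'(2) unfolding Suc by auto
qed

lemma real_cont_diff_const: "real_cont_diff k S (\<lambda>t. c)"
proof (induction k arbitrary: c)
  case (Suc k)
  show ?case
    using Suc[of 0] by (auto intro!: exI[of _ "\<lambda>_. 0"])
qed auto

lemma real_cont_diff_add:
  "real_cont_diff k S f \<Longrightarrow> real_cont_diff k S g \<Longrightarrow> real_cont_diff k S (\<lambda>t. f t + g t)"
proof (induction k arbitrary: f g)
  case (Suc k)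
  from Suc.prems obtain f' g' where
    "\<forall>t\<in>S. (f has_real_derivative f' t) (at t)" "real_cont_diff k S f'"
    "\<forall>t\<in>S. (g has_real_derivative g' t) (at t)" "real_cont_diff k S g'"
    by auto
  then have "\<forall>t\<in>S. ((\<lambda>t. f t + g t) has_real_derivative f' t + g' t) (at t)" "real_cont_diff k S (\<lambda>t. f' t + g' t)"
    using Suc.IH by (auto intro: DERIV_add)
  then show ?case by auto
qed (auto intro: continuous_on_add)

lemma real_cont_diff_mult:
  "real_cont_diff k S f \<Longrightarrow> real_cont_diff k S g \<Longrightarrow> real_cont_diff k S (\<lambda>t. f t * g t)"
proof (induction k arbitrary: f g)
  case (Suc k)
  note low = Suc.prems[THEN real_cont_diff_Suc_D]
  from Suc.prems obtain f' g' where
    *: "\<forall>t\<in>S. (f has_real_derivative f' t) (at t)" "real_cont_diff k S f'"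
    "\<forall>t\<in>S. (g has_real_derivative g' t) (at t)" "real_cont_diff k S g'"
    by auto
  have "real_cont_diff k S (\<lambda>t. f' t * g t + g' t * f t)"
    by (intro real_cont_diff_add Suc.IH * low)
  moreover have "\<forall>t\<in>S. ((\<lambda>t. f t * g t) has_real_derivative f' t * g t + g' t * f t) (at t)"
    using * by (auto intro: DERIV_mult)
  ultimately show ?case by auto
qed (auto intro: continuous_on_mult)

lemma real_cont_diff_inverse:
  "real_cont_diff k S f \<Longrightarrow> (\<And>t. t \<in> S \<Longrightarrow> f t \<noteq> 0) \<Longrightarrow> real_cont_diff k S (\<lambda>t. inverse (f t))"
proof (induction k arbitrary: f)
  case (Suc k)
  from Suc.prems(1) obtain f' where
    *: "\<forall>t\<in>S. (f has_real_derivative f' t) (at t)" "real_cont_diff k S f'"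
    by auto
  have inv: "real_cont_diff k S (\<lambda>t. inverse (f t))"
    by (rule Suc.IH[OF real_cont_diff_Suc_D[OF Suc.prems(1)] Suc.prems(2)])
  have "real_cont_diff k S (\<lambda>t. (- 1) * f' t * (inverse (f t) * inverse (f t)))"
    by (intro real_cont_diff_mult real_cont_diff_const * inv)
  moreover have "\<forall>t\<in>S. ((\<lambda>t. inverse (f t)) has_real_derivative (- 1) * f' t * (inverse (f t) * inverse (f t))) (at t)"
  proof
    fix t assume t: "t \<in> S"
    show "((\<lambda>t. inverse (f t)) has_real_derivative (- 1) * f' t * (inverse (f t) * inverse (f t))) (at t)"
      using DERIV_inverse'[OF *(1)[rule_format, OF t] Suc.prems(2)[OF t]] by (simp add: mult_ac)
  qed
  ultimately show ?case
    by (rule real_cont_diff_SucI)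
qed (auto intro: continuous_on_inverse)

lemma real_cont_diff_affine:
  assumes "real_cont_diff k S f" "\<And>t. t \<in> T \<Longrightarrow> c * t + d \<in> S"
  shows "real_cont_diff k T (\<lambda>t. f (c * t + d))"
  using assms(1)
proof (induction k arbitrary: f)
  case 0
  then show ?case
    using assms(2) by (auto intro!: continuous_on_compose2[of S f] continuous_intros)
next
  case (Suc k)
  then obtain f' where
    *: "\<forall>t\<in>S. (f has_real_derivative f' t) (at t)" "real_cont_diff k S f'"
    by auto
  have "real_cont_diff k T (\<lambda>t. f' (c * t + d) * c)"
    by (intro real_cont_diff_mult real_cont_diff_const Suc.IH *)
  moreover have "\<forall>t\<in>T. ((\<lambda>t. f (c * t + d)) has_real_derivative f' (c * t + d) * c) (at t)"
  proof
    fix t assume "t \<in> T"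
    then have "(f has_real_derivative f' (c * t + d)) (at (c * t + d))"
      using *(1) assms(2) by blast
    moreover have "((\<lambda>t. c * t + d) has_real_derivative c) (at t)"
      by (auto intro!: derivative_eq_intros)
    ultimately show "((\<lambda>t. f (c * t + d)) has_real_derivative f' (c * t + d) * c) (at t)"
      by (rule DERIV_chain2)
  qed
  ultimately show ?case
    by (rule real_cont_diff_SucI)
qed

lemma real_cont_diff_Un:
  assumes "open A" "open B"
  shows "real_cont_diff k A f \<Longrightarrow> real_cont_diff k B f \<Longrightarrow> real_cont_diff k (A \<union> B) f"
proof (induction k arbitrary: f)
  case 0
  then show ?case using assms by (auto intro: continuous_on_open_Un)
next
  case (Suc k)
  then obtain f' g' where
    *: "\<forall>t\<in>A. (f has_real_derivative f' t) (at t)" "real_cont_diff k A f'"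
    "\<forall>t\<in>B. (f has_real_derivative g' t) (at t)" "real_cont_diff k B g'"
    by auto
  \<comment> \<open>On the overlap the two derivatives agree by uniqueness, so the choice between
    them is immaterial.\<close>
  define h where "h t = (if t \<in> A then f' t else g' t)" for t
  have "real_cont_diff k A h"
    by (rule real_cont_diff_cong[OF assms(1) _ *(2)]) (simp add: h_def)
  moreover have "real_cont_diff k B h"
    by (rule real_cont_diff_cong[OF assms(2) _ *(4)]) (use *(1,3) in \<open>auto simp: h_def intro: DERIV_unique\<close>)
  ultimately have "real_cont_diff k (A \<union> B) h"
    by (rule Suc.IH)
  moreover have "\<forall>t\<in>A \<union> B. (f has_real_derivative h t) (at t)"
    using *(1,3) by (auto simp: h_def)
  ultimately show ?case by auto
qed

lemma real_cont_diff_powr: "real_cont_diff k {0<..} (\<lambda>t. t powr a)"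
proof (induction k arbitrary: a)
  case 0
  then show ?case by (auto intro!: continuous_intros)
next
  case (Suc k)
  have "real_cont_diff k {0<..} (\<lambda>t. a * t powr (a - 1))"
    by (intro real_cont_diff_mult real_cont_diff_const Suc)
  moreover have "\<forall>t\<in>{0<..}. ((\<lambda>t. t powr a) has_real_derivative a * t powr (a - 1)) (at t)"
    using has_real_derivative_powr by auto
  ultimately show ?case
    by (rule real_cont_diff_SucI)
qed

text \<open>The classical flat function exp (-1/t) with inverse powers attached: the derivative of
  member n combines members n + 1 and n + 2, so the smoothness of the whole family follows by one
  induction.\<close>

definition flat_exp :: "nat \<Rightarrow> real \<Rightarrow> real"
  where "flat_exp n t = (if t \<le> 0 then 0 else inverse t ^ n * exp (- inverse t))"

lemma flat_exp_has_derivative: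
  "(flat_exp n has_real_derivative - real n * flat_exp (Suc n) t + flat_exp (n + 2) t) (at t)"
proof (cases t "0 :: real" rule: linorder_cases)
  case less
  have "(flat_exp n has_real_derivative 0) (at t)"
    by (rule has_field_derivative_transform_within_open[of "\<lambda>_. 0", where S="{..<0}"])
       (use less in \<open>auto simp: flat_exp_def\<close>)
  then show ?thesis
    using less by (simp add: flat_exp_def)
next
  case greater
  define x where "x = inverse t"
  have i: "(inverse has_real_derivative - (x * x)) (at t)"
    using DERIV_inverse[of t] greater by (simp add: x_def power2_eq_square)
  have p: "((\<lambda>t. inverse t ^ n) has_real_derivative real n * x ^ (n - 1) * - (x * x)) (at t)"
    using DERIV_chain2[OF DERIV_pow i] by (simp add: x_def)
  have e: "((\<lambda>t. exp (- inverse t)) has_real_derivative exp (- x) * (x * x)) (at t)"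
    using DERIV_chain2[OF DERIV_exp DERIV_minus[OF i]] by (simp add: x_def)
  have "((\<lambda>t. inverse t ^ n * exp (- inverse t)) has_real_derivative
      real n * x ^ (n - 1) * - (x * x) * exp (- x) + exp (- x) * (x * x) * x ^ n) (at t)"
    using DERIV_mult[OF p e] by (simp add: x_def)
  moreover have "real n * x ^ (n - 1) * - (x * x) * exp (- x) + exp (- x) * (x * x) * x ^ n
      = - real n * flat_exp (Suc n) t + flat_exp (n + 2) t"
    using greater by (cases n) (simp_all add: flat_exp_def x_def algebra_simps)
  ultimately have "((\<lambda>t. inverse t ^ n * exp (- inverse t)) has_real_derivative
      - real n * flat_exp (Suc n) t + flat_exp (n + 2) t) (at t)"
    by simp
  then show ?thesis
    by (rule has_field_derivative_transform_within_open[where S="{0<..}"])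
       (use greater in \<open>auto simp: flat_exp_def\<close>)
next
  case equal
  have r: "((\<lambda>h. flat_exp n h / h) \<longlongrightarrow> 0) (at_right 0)"
  proof (rule Lim_transform_eventually)
    \<comment> \<open>With x = 1/h the difference quotient at 0 from the right is x^(n+1) / exp
      x.\<close>
    show "((\<lambda>h. inverse h ^ Suc n / exp (inverse h)) \<longlongrightarrow> 0) (at_right (0::real))"
      by (rule filterlim_compose[OF tendsto_power_div_exp_0 filterlim_inverse_at_top_right])
    show "\<forall>\<^sub>F h in at_right 0. inverse h ^ Suc n / exp (inverse h) = flat_exp n h / h"
      unfolding eventually_at_right_field
      by (intro exI[of _ 1]) (auto simp: flat_exp_def exp_minus divide_inverse)
  qed
  have l: "((\<lambda>h. flat_exp n h / h) \<longlongrightarrow> 0) (at_left 0)"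
  proof (rule Lim_transform_eventually[OF tendsto_const])
    show "\<forall>\<^sub>F h in at_left 0. 0 = flat_exp n h / h"
      unfolding eventually_at_left_field by (intro exI[of _ "-1"]) (auto simp: flat_exp_def)
  qed
  have "((\<lambda>h. flat_exp n h / h) \<longlongrightarrow> 0) (at 0)"
    by (rule filterlim_split_at[OF l r])
  then show ?thesis
    using equal by (simp add: DERIV_def flat_exp_def)
qed

lemma real_cont_diff_flat_exp: "real_cont_diff k UNIV (flat_exp n)"
proof (induction k arbitrary: n)
  case 0
  show ?case
    using flat_exp_has_derivative
    by (auto intro!: DERIV_continuous_on[OF has_field_derivative_at_within[OF flat_exp_has_derivative]])
next
  case (Suc k)
  have "real_cont_diff k UNIV (\<lambda>t. - real n * flat_exp (Suc n) t + flat_exp (n + 2) t)"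
    by (intro real_cont_diff_add real_cont_diff_mult real_cont_diff_const Suc)
  then show ?case
    by (rule real_cont_diff_SucI) (simp only: flat_exp_has_derivative ball_UNIV simp_thms)
qed

text \<open>The quotient f / (f + g) of flat functions, f positive for t > 1 and g for t < 2, so
  that the denominator never vanishes. The first two derivatives are bounded because they are
  continuous and live on [1, 2].\<close>

lemma smooth_cutoff_exists:
  obtains \<eta> \<eta>' \<eta>'' :: "real \<Rightarrow> real" and C
  where "\<And>k. real_cont_diff k UNIV \<eta>" "\<And>t. t \<le> 1 \<Longrightarrow> \<eta> t = 0" "\<And>t. 2 \<le> t \<Longrightarrow> \<eta> t = 1"
    "\<And>t. \<bar>\<eta> t\<bar> \<le> 1"
    "\<And>t. (\<eta> has_real_derivative \<eta>' t) (at t)" "\<And>t. (\<eta>' has_real_derivative \<eta>'' t) (at t)"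
    "\<And>t. t \<notin> {1<..<2} \<Longrightarrow> \<eta>' t = 0" "\<And>t. t \<notin> {1<..<2} \<Longrightarrow> \<eta>'' t = 0"
    "0 \<le> C" "\<And>t. \<bar>\<eta>' t\<bar> \<le> C" "\<And>t. \<bar>\<eta>'' t\<bar> \<le> C"
proof -
  define f g where "f t = flat_exp 0 (1 * t + (- 1))" and "g t = flat_exp 0 ((- 1) * t + 2)" for t :: real
  define \<eta> where "\<eta> t = f t * inverse (f t + g t)" for t
  have nn: "0 \<le> f t" "0 \<le> g t" and pos: "0 < f t + g t" for t
    by (auto simp: f_def g_def flat_exp_def add_pos_nonneg)
  have s: "real_cont_diff k UNIV f" "real_cont_diff k UNIV g" for k
    unfolding f_def g_def by (rule real_cont_diff_affine[OF real_cont_diff_flat_exp], simp)+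
  have smooth: "real_cont_diff k UNIV \<eta>" for k
    unfolding \<eta>_def[abs_def]
    using pos by (intro real_cont_diff_mult real_cont_diff_inverse real_cont_diff_add s) (simp add: less_imp_neq[symmetric])
  have 1: "\<eta> t = 0" if "t \<le> 1" for t
    using that by (simp add: \<eta>_def f_def flat_exp_def)
  have 2: "\<eta> t = 1" if "2 \<le> t" for t
    using that pos[of t] by (simp add: \<eta>_def g_def flat_exp_def)
  have 3: "\<bar>\<eta> t\<bar> \<le> 1" for t
    using nn[of t] pos[of t] by (simp add: \<eta>_def abs_mult divide_inverse[symmetric] divide_le_eq)
  have "real_cont_diff (Suc (Suc 0)) UNIV \<eta>"
    by (rule smooth)
  then obtain \<eta>' \<eta>'' where d: "\<And>t. (\<eta> has_real_derivative \<eta>' t) (at t)"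
    "\<And>t. (\<eta>' has_real_derivative \<eta>'' t) (at t)" and c: "continuous_on UNIV \<eta>''"
    by auto
  have c': "continuous_on UNIV \<eta>'"
    by (rule DERIV_continuous_on[OF has_field_derivative_at_within[OF d(2)]])
  \<comment> \<open>Vanishing of the derivatives is immediate on the two open half-lines; continuity
    carries it to the end points 1 and 2.\<close>
  have zero: "h t = 0" if h: "continuous_on UNIV h" and z: "\<And>t. t < 1 \<or> 2 < t \<Longrightarrow> h t = 0" and t: "t \<notin> {1<..<2}"
    for h :: "real \<Rightarrow> real" and t
  proof -
    have "t \<in> closure ({..<1} \<union> {2<..})"
      using t by (auto simp: closure_Un closure_lessThan closure_greaterThan)
    then show ?thesis
      using continuous_constant_on_closure[of "{..<1} \<union> {2<..}" h 0 t] h z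
      by (auto intro: continuous_on_subset)
  qed
  have z1: "\<eta>' t = 0" if "t \<notin> {1<..<2}" for t
  proof (rule zero[OF c' _ that])
    fix t :: real assume "t < 1 \<or> 2 < t"
    then show "\<eta>' t = 0"
    proof
      assume "t < 1"
      have "(\<eta> has_real_derivative 0) (at t)"
        by (rule has_field_derivative_transform_within_open[of "\<lambda>_. 0", where S="{..<1}"]) (use 1 \<open>t < 1\<close> in auto)
      then show ?thesis using d(1) DERIV_unique by blast
    next
      assume "2 < t"
      have "(\<eta> has_real_derivative 0) (at t)"
        by (rule has_field_derivative_transform_within_open[of "\<lambda>_. 1", where S="{2<..}"]) (use 2 \<open>2 < t\<close> in auto)
      then show ?thesis using d(1) DERIV_unique by blast
    qed
  qed
  have z2: "\<eta>'' t = 0" if "t \<notin> {1<..<2}" for t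
  proof (rule zero[OF c _ that])
    fix t :: real assume t: "t < 1 \<or> 2 < t"
    have "(\<eta>' has_real_derivative 0) (at t)"
      by (rule has_field_derivative_transform_within_open[of "\<lambda>_. 0", where S="{..<1} \<union> {2<..}"]) (use z1 t in auto)
    then show "\<eta>'' t = 0" using d(2) DERIV_unique by blast
  qed
  have "\<exists>C\<ge>0. \<forall>t. \<bar>h t\<bar> \<le> C" if "continuous_on UNIV h" "\<And>t. t \<notin> {1<..<2} \<Longrightarrow> h t = 0" for h :: "real \<Rightarrow> real"
  proof -
    have "bounded (h ` {1..2})"
      by (intro compact_imp_bounded compact_continuous_image continuous_on_subset[OF that(1)]) auto
    then obtain C where C: "0 < C" "\<And>t. t \<in> {1..2} \<Longrightarrow> \<bar>h t\<bar> \<le> C"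
      by (auto simp: bounded_pos)
    have "\<bar>h t\<bar> \<le> C" for t
      using C that(2)[of t] by (cases "t \<in> {1<..<2}") auto
    then show ?thesis using C(1) by (auto intro: exI[of _ C])
  qed
  from this[OF c' z1] this[OF c z2] obtain C1 C2
    where C: "0 \<le> C1" "\<And>t. \<bar>\<eta>' t\<bar> \<le> C1" "0 \<le> C2" "\<And>t. \<bar>\<eta>'' t\<bar> \<le> C2"
    by blast
  show ?thesis
    by (rule that[of \<eta> \<eta>' \<eta>'' "C1 + C2", OF smooth 1 2 3 d z1 z2])
       (use C in \<open>auto intro: order_trans[of _ C1] order_trans[of _ C2]\<close>)
qed

text \<open>\<open>p\<close> is the \<open>d/dz\<close>-derivative of \<open>f\<close> at \<open>z\<close> and \<open>q\<close> its conjugate counterpart.\<close>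

definition has_wirtinger :: "(complex \<Rightarrow> complex) \<Rightarrow> complex \<Rightarrow> complex \<Rightarrow> complex \<Rightarrow> bool"
  where "has_wirtinger f p q z \<longleftrightarrow> (f has_derivative (\<lambda>v. p * v + q * cnj v)) (at z)"

section \<open>Wirtinger calculus\<close>

lemma has_wirtinger_imp:
  assumes "has_wirtinger f p q z"
  shows "wirtinger f z = p" "wirtinger_bar f z = q"
  using wirtinger_eq[OF assms[unfolded has_wirtinger_def]] wirtinger_bar_eq[OF assms[unfolded has_wirtinger_def]]
  by (simp_all add: algebra_simps)

lemma has_wirtinger_const: "has_wirtinger (\<lambda>_. c) 0 0 z"
  by (simp add: has_wirtinger_def)

lemma has_wirtinger_ident: "has_wirtinger (\<lambda>z. z) 1 0 z"
  by (simp add: has_wirtinger_def)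

lemma has_wirtinger_cnj: "has_wirtinger cnj 0 1 z"
  unfolding has_wirtinger_def by (auto intro!: derivative_eq_intros)

lemma has_wirtinger_add:
  "has_wirtinger f p q z \<Longrightarrow> has_wirtinger g p' q' z \<Longrightarrow> has_wirtinger (\<lambda>z. f z + g z) (p + p') (q + q') z"
  unfolding has_wirtinger_def by (drule (1) has_derivative_add) (simp add: algebra_simps)

lemma has_wirtinger_mult:
  "has_wirtinger f p q z \<Longrightarrow> has_wirtinger g p' q' z \<Longrightarrow>
    has_wirtinger (\<lambda>z. f z * g z) (f z * p' + p * g z) (f z * q' + q * g z) z"
  unfolding has_wirtinger_def by (drule (1) has_derivative_mult) (simp add: algebra_simps)

lemma has_wirtinger_power:
  assumes "has_wirtinger f p q z"
  shows "has_wirtinger (\<lambda>z. f z ^ n) (of_nat n * f z ^ (n - 1) * p) (of_nat n * f z ^ (n - 1) * q) z"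
proof (induction n)
  case (Suc n)
  \<comment> \<open>For n = 0 the truncated exponent n - 1 is multiplied by 0.\<close>
  have *: "of_nat (Suc n) * f z ^ (Suc n - 1) * x = f z * (of_nat n * f z ^ (n - 1) * x) + x * f z ^ n" for x
    by (cases n) (simp_all add: algebra_simps)
  show ?case
    using has_wirtinger_mult[OF assms Suc] unfolding * by simp
qed (simp add: has_wirtinger_const)

text \<open>|z|^2 = z cnj z has the Wirtinger derivatives cnj z and z. Working with |z|^2 rather
  than |z| keeps radial functions smooth at the origin.\<close>

lemma has_wirtinger_radial:
  assumes "(f has_real_derivative f') (at ((norm z)\<^sup>2))"
  shows "has_wirtinger (\<lambda>z. of_real (f ((norm z)\<^sup>2))) (of_real f' * cnj z) (of_real f' * z) z"
proof -
  have "((\<lambda>z. (norm z)\<^sup>2) has_derivative (\<lambda>v. 2 * Re (cnj z * v))) (at z)"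
    unfolding cmod_power2 by (auto intro!: derivative_eq_intros simp: algebra_simps)
  from has_derivative_of_real[OF has_derivative_compose[OF this assms[unfolded has_field_derivative_def]]]
  have "((\<lambda>z. complex_of_real (f ((norm z)\<^sup>2))) has_derivative (\<lambda>v. of_real (f' * (2 * Re (cnj z * v))))) (at z)" .
  moreover have "of_real (f' * (2 * Re (cnj z * v))) = of_real f' * cnj z * v + of_real f' * z * cnj v" for v
  proof -
    have "complex_of_real (2 * Re (cnj z * v)) = cnj z * v + z * cnj v"
      using complex_add_cnj[of "cnj z * v"] by simp
    then show ?thesis
      unfolding of_real_mult[of f'] by (simp add: algebra_simps)
  qed
  ultimately show ?thesis
    by (simp add: has_wirtinger_def)
qed

lemma times_cont_diff_Suc_has_derivative:
  assumes "\<And>z. has_wirtinger f (p z) (q z) z" "times_cont_diff k p" "times_cont_diff k q"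
  shows "times_cont_diff (Suc k) f"
proof -
  have d: "(f has_derivative (\<lambda>v. p z * v + q z * cnj v)) (at z)" for z
    using assms(1) by (simp add: has_wirtinger_def)
  have "deriv_x f = (\<lambda>z. p z + q z)" "deriv_y f = (\<lambda>z. \<i> * p z + (- \<i>) * q z)"
    by (auto simp: fun_eq_iff deriv_x_eq[OF d] deriv_y_eq[OF d])
  moreover have "times_cont_diff k (\<lambda>z. p z + q z)"
    by (rule times_cont_diff_add[OF assms(2,3)])
  moreover have "times_cont_diff k (\<lambda>z. \<i> * p z + (- \<i>) * q z)"
    by (rule times_cont_diff_add[OF times_cont_diff_mult[OF times_cont_diff_const assms(2)]
        times_cont_diff_mult[OF times_cont_diff_const assms(3)]])
  ultimately show ?thesis
    using d by (auto simp: differentiable_def)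
qed

lemma times_cont_diff_ident: "times_cont_diff k (\<lambda>z. z)"
  using times_cont_diff_Suc_D[OF times_cont_diff_Suc_has_derivative[OF has_wirtinger_ident
    times_cont_diff_const times_cont_diff_const]] .

lemma times_cont_diff_cnj: "times_cont_diff k cnj"
  using times_cont_diff_Suc_D[OF times_cont_diff_Suc_has_derivative[OF has_wirtinger_cnj
    times_cont_diff_const times_cont_diff_const]] .

lemma times_cont_diff_power: "times_cont_diff k f \<Longrightarrow> times_cont_diff k (\<lambda>z. f z ^ n)"
  by (induction n) (simp_all add: times_cont_diff_const times_cont_diff_mult)

lemma times_cont_diff_radial:
  "real_cont_diff k UNIV f \<Longrightarrow> times_cont_diff k (\<lambda>z. of_real (f ((norm z)\<^sup>2)))"
proof (induction k arbitrary: f)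
  case 0
  then have "continuous_on UNIV f" by simp
  then have "continuous_on UNIV (\<lambda>z :: complex. f ((norm z)\<^sup>2))"
    by (rule continuous_on_compose2) (auto intro!: continuous_intros)
  then show ?case
    by (auto intro!: continuous_intros)
next
  case (Suc k)
  then obtain f' where f': "\<And>t. (f has_real_derivative f' t) (at t)" "real_cont_diff k UNIV f'"
    by auto
  show ?case
    by (rule times_cont_diff_Suc_has_derivative[OF has_wirtinger_radial[OF f'(1)]
        times_cont_diff_mult[OF Suc.IH[OF f'(2)] times_cont_diff_cnj]
        times_cont_diff_mult[OF Suc.IH[OF f'(2)] times_cont_diff_ident]])
qed

section \<open>Uniqueness\<close>

lemma nn_integral_periodic_shift:
  fixes q :: "real \<Rightarrow> ennreal"
  assumes q [measurable]: "q \<in> borel_measurable borel" and per: "\<And>t. q (t + 2 * pi) = q t"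
    and s: "0 \<le> s" "s \<le> 2 * pi"
  shows "(\<integral>\<^sup>+ t. q (t + s) * indicator {0..<2 * pi} t \<partial>lborel) = (\<integral>\<^sup>+ t. q t * indicator {0..<2 * pi} t \<partial>lborel)"
proof -
  have "(\<integral>\<^sup>+ t. q (t + s) * indicator {0..<2 * pi} t \<partial>lborel) = (\<integral>\<^sup>+ t. q (s + 1 * t) * indicator {s..<s + 2 * pi} (s + 1 * t) \<partial>lborel)"
    by (intro nn_integral_cong) (auto simp: add.commute split: split_indicator)
  also have "\<dots> = (\<integral>\<^sup>+ t. q t * indicator {s..<s + 2 * pi} t \<partial>lborel)"
    using nn_integral_real_affine[of "\<lambda>t. q t * indicator {s..<s + 2 * pi} t" 1 s] by simp
  also have "\<dots> = (\<integral>\<^sup>+ t. q t * indicator {s..<2 * pi} t + q t * indicator {2 * pi..<2 * pi + s} t \<partial>lborel)"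
    using s by (intro nn_integral_cong) (auto split: split_indicator)
  also have "\<dots> = (\<integral>\<^sup>+ t. q t * indicator {s..<2 * pi} t \<partial>lborel) + (\<integral>\<^sup>+ t. q t * indicator {2 * pi..<2 * pi + s} t \<partial>lborel)"
    by (rule nn_integral_add) measurable
  also have "(\<integral>\<^sup>+ t. q t * indicator {2 * pi..<2 * pi + s} t \<partial>lborel)
      = (\<integral>\<^sup>+ t. q (2 * pi + 1 * t) * indicator {2 * pi..<2 * pi + s} (2 * pi + 1 * t) \<partial>lborel)"
    using nn_integral_real_affine[of "\<lambda>t. q t * indicator {2 * pi..<2 * pi + s} t" 1 "2 * pi"] by simp
  also have "\<dots> = (\<integral>\<^sup>+ t. q t * indicator {0..<s} t \<partial>lborel)"
    using per by (intro nn_integral_cong) (auto simp: add.commute split: split_indicator)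
  also have "(\<integral>\<^sup>+ t. q t * indicator {s..<2 * pi} t \<partial>lborel) + (\<integral>\<^sup>+ t. q t * indicator {0..<s} t \<partial>lborel)
      = (\<integral>\<^sup>+ t. q t * indicator {s..<2 * pi} t + q t * indicator {0..<s} t \<partial>lborel)"
    by (rule nn_integral_add[symmetric]) measurable
  also have "\<dots> = (\<integral>\<^sup>+ t. q t * indicator {0..<2 * pi} t \<partial>lborel)"
    using s by (intro nn_integral_cong) (auto split: split_indicator)
  finally show ?thesis .
qed

lemma measurable_rotate:
  fixes f :: "complex \<Rightarrow> 'b::topological_space"
  assumes f: "f \<in> borel_measurable borel"
  shows "(\<lambda>(z, t). f (cis t * z)) \<in> borel_measurable (lborel \<Otimes>\<^sub>M lborel)"
proof -
  have "(\<lambda>p :: complex \<times> real. cis (snd p) * fst p) \<in> borel_measurable borel"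
    by (intro borel_measurable_continuous_onI continuous_intros)
  from measurable_compose[OF this f] show ?thesis
    by (simp add: split_beta' lborel_prod)
qed

lemma nn_integral_rotation_average:
  assumes f [measurable]: "f \<in> borel_measurable borel"
  shows "(\<integral>\<^sup>+ z. (\<integral>\<^sup>+ t. f (cis t * z) * indicator {0..<2 * pi} t \<partial>lborel) \<partial>lborel)
    = ennreal (2 * pi) * (\<integral>\<^sup>+ z. f z \<partial>lborel)"
proof -
  have m: "(\<lambda>(z, t). f (cis t * z) * indicator {0..<2 * pi} t) \<in> borel_measurable (lborel \<Otimes>\<^sub>M lborel)"
  proof -
    have "(\<lambda>p. indicator {0..<2 * pi} (snd p) :: ennreal) \<in> borel_measurable (lborel \<Otimes>\<^sub>M lborel)"
      by (rule measurable_compose[OF measurable_snd borel_measurable_indicator]) simp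
    from borel_measurable_times_ennreal[OF measurable_rotate[OF f] this] show ?thesis
      by (simp add: split_beta')
  qed
  have mz: "(\<lambda>z. f (cis t * z)) \<in> borel_measurable lborel" for t
    by measurable
  have "(\<integral>\<^sup>+ z. (\<integral>\<^sup>+ t. f (cis t * z) * indicator {0..<2 * pi} t \<partial>lborel) \<partial>lborel)
      = (\<integral>\<^sup>+ t. (\<integral>\<^sup>+ z. f (cis t * z) * indicator {0..<2 * pi} t \<partial>lborel) \<partial>lborel)"
    by (rule lborel_pair.Fubini'[OF m, symmetric])
  also have "\<dots> = (\<integral>\<^sup>+ t. (\<integral>\<^sup>+ z. f z \<partial>lborel) * indicator {0..<2 * pi} t \<partial>lborel)"
  proof (rule nn_integral_cong_AE)
    show "AE t in lborel. (\<integral>\<^sup>+ z. f (cis t * z) * indicator {0..<2 * pi} t \<partial>lborel) = (\<integral>\<^sup>+ z. f z \<partial>lborel) * indicator {0..<2 * pi} t"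
      using AE_lborel_singleton[of pi]
    proof eventually_elim
      case (elim t)
      \<comment> \<open>The half turn is the only angle in [0, 2 pi) to which the factorization into
        shears does not apply.\<close>
      have "cos (t / 2) \<noteq> 0" if "t \<in> {0..<2 * pi}"
        using that elim cos_inj_pi[of "t / 2" "pi / 2"] by auto
      then show ?case
        using nn_integral_rotate[OF f, of t] mz[of t]
        by (cases "t \<in> {0..<2 * pi}") (simp_all add: nn_integral_multc)
    qed
  qed
  also have "\<dots> = (\<integral>\<^sup>+ z. f z \<partial>lborel) * ennreal (2 * pi)"
    by (simp add: nn_integral_cmult_indicator)
  finally show ?thesis
    by (simp add: mult.commute)
qed

lemma emeasure_annulus:
  assumes "0 \<le> r1" "r1 \<le> r2"
  shows "emeasure lborel {z :: complex. r1 < norm z \<and> norm z < r2} = ennreal (pi * (r2\<^sup>2 - r1\<^sup>2))"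
\<comment> \<open>For equal radii the closed disc is not contained in the open one, so the
  subtraction of measures needs r1 < r2.\<close>
proof (cases "r1 = r2")
  case True
  then have e: "{z :: complex. r1 < norm z \<and> norm z < r2} = {}" by auto
  show ?thesis unfolding e by (simp add: True)
next
  case False
  have "{z :: complex. r1 < norm z \<and> norm z < r2} = ball 0 r2 - cball 0 r1"
    by auto
  moreover have "emeasure lborel (ball 0 r2 - cball (0 :: complex) r1)
      = emeasure lborel (ball (0 :: complex) r2) - emeasure lborel (cball (0 :: complex) r1)"
    using False assms by (intro emeasure_Diff) (auto simp: emeasure_cball)
  moreover have "r1\<^sup>2 \<le> r2\<^sup>2"
    using assms by (intro power_mono) auto
  ultimately show ?thesis
    using assms by (simp add: emeasure_ball emeasure_cball unit_ball_vol_2 ennreal_minus algebra_simps)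
qed

text \<open>Rotation invariance replaces polar coordinates: averaging the area integral over all rotations
  produces the circle integrals.\<close>

lemma nn_integral_annulus_le:
  fixes v :: "complex \<Rightarrow> complex"
  assumes v: "(\<lambda>z. indicator unit_disc z *\<^sub>R v z) \<in> borel_measurable lebesgue"
    and r: "0 \<le> r1" "r1 \<le> r2" "r2 \<le> 1" and m: "0 \<le> m"
    and circle: "\<And>r. r1 < r \<Longrightarrow> r < r2 \<Longrightarrow>
      (\<integral>\<^sup>+ t. ennreal (norm (v (of_real r * cis t))) * indicator {0..2 * pi} t \<partial>lebesgue) \<le> ennreal m"
  shows "(\<integral>\<^sup>+ z. ennreal (norm (v z)) * indicator {z. r1 < norm z \<and> norm z < r2} z \<partial>lebesgue)
    \<le> ennreal (m / 2 * (r2\<^sup>2 - r1\<^sup>2))"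
proof -
  define A where "A = {z :: complex. r1 < norm z \<and> norm z < r2}"
  have A [measurable]: "A \<in> sets borel"
    unfolding A_def by measurable
  define f where "f z = ennreal (norm (v z)) * indicator A z" for z
  have "f = (\<lambda>z. ennreal (norm (indicator unit_disc z *\<^sub>R v z)) * indicator A z)"
    using r(3) by (auto simp: f_def A_def fun_eq_iff split: split_indicator)
  moreover have "(\<lambda>z. indicator A z :: ennreal) \<in> borel_measurable lebesgue"
    by (intro measurable_completion) simp
  ultimately have fm: "f \<in> borel_measurable lebesgue"
    using borel_measurable_times_ennreal[OF measurable_compose[OF measurable_compose[OF v borel_measurable_norm]
        measurable_ennreal]] by simp
  obtain g where g [measurable]: "g \<in> borel_measurable lborel" and fg: "AE z in lborel. f z = g z"
    using completion_ex_borel_measurable[OF fm] by blast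
  \<comment> \<open>The Borel representative \<open>g\<close> may differ from \<open>f\<close> on
    the null set \<open>N\<close>, which could still contain whole circles. Averaging
    \<open>indicator N\<close> over rotations shows that for almost every z the circle through z
    meets \<open>N\<close> in a null set of angles, so that \<open>f\<close> and \<open>g\<close>
    have the same integral over it.\<close>
  obtain N where N: "N \<in> null_sets lborel" "{z. f z \<noteq> g z} \<subseteq> N"
    using fg unfolding eventually_ae_filter by auto
  have fgN: "f z = g z" if "z \<notin> N" for z
    using N(2) that by auto
  have N' [measurable]: "N \<in> sets borel"
    using N(1) by (simp add: null_sets_def)
  have "(\<integral>\<^sup>+ z. (\<integral>\<^sup>+ t. indicator N (cis t * z) * indicator {0..<2 * pi} t \<partial>lborel) \<partial>lborel)
      = ennreal (2 * pi) * (\<integral>\<^sup>+ z. indicator N z \<partial>lborel)"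
    by (rule nn_integral_rotation_average) measurable
  also have "\<dots> = 0"
    using N(1) by (simp add: null_sets_def)
  finally have "AE z in lborel. (\<integral>\<^sup>+ t. indicator N (cis t * z) * indicator {0..<2 * pi} t \<partial>lborel) = 0"
  proof (subst (asm) nn_integral_0_iff_AE)
    have "(\<lambda>(z, t). indicator N (cis t * z) * indicator {0..<2 * pi} t :: ennreal) \<in> borel_measurable (lborel \<Otimes>\<^sub>M lborel)"
    proof -
      have "(\<lambda>p. indicator {0..<2 * pi} (snd p) :: ennreal) \<in> borel_measurable (lborel \<Otimes>\<^sub>M lborel)"
        by (rule measurable_compose[OF measurable_snd borel_measurable_indicator]) simp
      from borel_measurable_times_ennreal[OF measurable_rotate[OF borel_measurable_indicator[OF N']] this] show ?thesis
        by (simp add: split_beta')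
    qed
    then show "(\<lambda>z. \<integral>\<^sup>+ t. indicator N (cis t * z) * indicator {0..<2 * pi} t \<partial>lborel) \<in> borel_measurable lborel"
      by (rule lborel.borel_measurable_nn_integral)
  qed
  then have key: "AE z in lborel. (\<integral>\<^sup>+ t. g (cis t * z) * indicator {0..<2 * pi} t \<partial>lborel) \<le> ennreal m * indicator A z"
  proof eventually_elim
    case (elim z)
    define r s where "r = norm z" and "s = Arg2pi z"
    have z: "z = of_real r * cis s"
      using Arg2pi_eq[of z] by (simp add: r_def s_def cis_conv_exp mult.commute)
    have s: "0 \<le> s" "s \<le> 2 * pi"
      using Arg2pi[of z] by (auto simp: s_def)
    have rot: "cis t * z = of_real r * cis (t + s)" for t
      by (simp add: z cis_mult[symmetric] mult_ac)
    have cm [measurable]: "(\<lambda>t. of_real r * cis t) \<in> borel_measurable borel"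
      by (intro borel_measurable_continuous_onI continuous_intros)
    have per: "cis (t + 2 * pi) = cis t" for t
      by (simp add: complex_eq_iff)
    have "(\<integral>\<^sup>+ t. indicator N (of_real r * cis t) * indicator {0..<2 * pi} t \<partial>lborel)
        = (\<integral>\<^sup>+ t. indicator N (of_real r * cis (t + s)) * indicator {0..<2 * pi} t \<partial>lborel)"
      by (rule nn_integral_periodic_shift[OF _ _ s, symmetric]) (simp_all add: per)
    also have "\<dots> = 0"
      using elim unfolding rot .
    finally have "(\<integral>\<^sup>+ t. indicator N (of_real r * cis t) * indicator {0..<2 * pi} t \<partial>lborel) = 0" .
    then have AEN: "AE t in lborel. indicator N (of_real r * cis t) * indicator {0..<2 * pi} t = (0 :: ennreal)"
      by (subst (asm) nn_integral_0_iff_AE) auto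
    have "(\<integral>\<^sup>+ t. g (cis t * z) * indicator {0..<2 * pi} t \<partial>lborel) = (\<integral>\<^sup>+ t. g (of_real r * cis t) * indicator {0..<2 * pi} t \<partial>lborel)"
      unfolding rot by (rule nn_integral_periodic_shift[OF _ _ s]) (simp_all add: per)
    also have "\<dots> = (\<integral>\<^sup>+ t. g (of_real r * cis t) * indicator {0..<2 * pi} t \<partial>lebesgue)"
      by (simp add: nn_integral_completion)
    also have "\<dots> = (\<integral>\<^sup>+ t. f (of_real r * cis t) * indicator {0..<2 * pi} t \<partial>lebesgue)"
    proof (rule nn_integral_cong_AE)
      show "AE t in lebesgue. g (of_real r * cis t) * indicator {0..<2 * pi} t = f (of_real r * cis t) * indicator {0..<2 * pi} t"
        using AE_completion[OF AEN] by eventually_elim (use fgN in \<open>auto split: split_indicator_asm\<close>)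
    qed
    also have "\<dots> \<le> ennreal m * indicator A z"
    proof (cases "z \<in> A")
      case True
      then have "r1 < r" "r < r2"
        by (auto simp: A_def r_def)
      have "(\<integral>\<^sup>+ t. f (of_real r * cis t) * indicator {0..<2 * pi} t \<partial>lebesgue)
          \<le> (\<integral>\<^sup>+ t. ennreal (norm (v (of_real r * cis t))) * indicator {0..2 * pi} t \<partial>lebesgue)"
        by (intro nn_integral_mono) (auto simp: f_def split: split_indicator)
      then show ?thesis
        using circle[OF \<open>r1 < r\<close> \<open>r < r2\<close>] True by simp
    next
      case False
      then have "f (of_real r * cis t) = 0" for t
        by (auto simp: f_def A_def r_def norm_mult)
      then show ?thesis by simp
    qed
    finally show ?case .
  qed
  \<comment> \<open>Averaging over rotations costs the factor 2 pi, and the annulus has area pi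
    (r2^2 - r1^2); the quotient is the origin of m / 2.\<close>
  have "ennreal (2 * pi) * (\<integral>\<^sup>+ z. f z \<partial>lebesgue) = ennreal (2 * pi) * (\<integral>\<^sup>+ z. g z \<partial>lborel)"
    using nn_integral_cong_AE[OF fg] by (simp add: nn_integral_completion)
  also have "\<dots> = (\<integral>\<^sup>+ z. (\<integral>\<^sup>+ t. g (cis t * z) * indicator {0..<2 * pi} t \<partial>lborel) \<partial>lborel)"
    by (rule nn_integral_rotation_average[symmetric]) simp
  also have "\<dots> \<le> (\<integral>\<^sup>+ z. ennreal m * indicator A z \<partial>lborel)"
    by (rule nn_integral_mono_AE[OF key])
  also have "\<dots> = ennreal m * ennreal (pi * (r2\<^sup>2 - r1\<^sup>2))"
    using emeasure_annulus[OF r(1,2)] by (simp add: nn_integral_cmult_indicator A_def)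
  also have "\<dots> = ennreal (2 * pi) * ennreal (m / 2 * (r2\<^sup>2 - r1\<^sup>2))"
    using m r by (simp add: ennreal_mult'[symmetric] power_mono mult_ac)
  finally show ?thesis
    unfolding f_def A_def by (subst (asm) ennreal_mult_le_mult_iff) auto
qed

text \<open>\<open>P\<close> is \<open>L_bar\<close> of (1 - |z|^2)^(\<alpha>+1) z^a cnj z^b without
  cutoff, and the cutoff is a fixed profile in (1 - |z|^2) / e. Terms in which the cutoff is not
  differentiated add up to \<eta> P. All others contain its first derivative over e or its second
  over e^2, and the second comes with a factor 1 - |z|^2 < 2 e, whence K / e. The truncated
  exponents in \<open>P\<close> are harmless: for a = 0 or b = 0 the factor a b is 0.\<close>

lemma cutoff_test_function:
  fixes \<alpha> :: real and a b :: nat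
  defines "P \<equiv> \<lambda>z. of_real ((\<alpha> + 1 + real b) * real (a + 1)) * (z ^ a * cnj z ^ b) - of_nat (a * b) * (z ^ (a - 1) * cnj z ^ (b - 1))"
  obtains K where "0 \<le> K"
    "\<And>e. 0 < e \<Longrightarrow> e < 1 / 2 \<Longrightarrow> \<exists>\<phi> \<eta>. test_function \<phi> \<and> continuous_on UNIV \<eta> \<and> (\<forall>z. norm (\<eta> z) \<le> 1) \<and>
      (\<forall>z. (norm z)\<^sup>2 \<le> 1 - 2 * e \<longrightarrow> \<eta> z = 1) \<and>
      (\<forall>z\<in>unit_disc. norm (L_bar \<alpha> \<phi> z - \<eta> z * P z) \<le> K / e) \<and>
      (\<forall>z\<in>unit_disc. L_bar \<alpha> \<phi> z - \<eta> z * P z \<noteq> 0 \<longrightarrow> e < 1 - (norm z)\<^sup>2 \<and> 1 - (norm z)\<^sup>2 < 2 * e)"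
proof -
  obtain \<eta> \<eta>' \<eta>'' :: "real \<Rightarrow> real" and C
    where smooth: "\<And>k. real_cont_diff k UNIV \<eta>" and \<eta>0: "\<And>t. t \<le> 1 \<Longrightarrow> \<eta> t = 0" and \<eta>1: "\<And>t. 2 \<le> t \<Longrightarrow> \<eta> t = 1"
    and \<eta>le: "\<And>t. \<bar>\<eta> t\<bar> \<le> 1"
    and d\<eta>: "\<And>t. (\<eta> has_real_derivative \<eta>' t) (at t)" and d\<eta>': "\<And>t. (\<eta>' has_real_derivative \<eta>'' t) (at t)"
    and z': "\<And>t. t \<notin> {1<..<2} \<Longrightarrow> \<eta>' t = 0" and z'': "\<And>t. t \<notin> {1<..<2} \<Longrightarrow> \<eta>'' t = 0"
    and C: "0 \<le> C" "\<And>t. \<bar>\<eta>' t\<bar> \<le> C" "\<And>t. \<bar>\<eta>'' t\<bar> \<le> C"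
    by (rule smooth_cutoff_exists) blast
  define K where "K = C * (\<bar>\<alpha> + 2\<bar> + 2 + 2 * real (a + 1 + b))"
  show ?thesis
  proof (rule that[of K])
    show "0 \<le> K" using C by (simp add: K_def)
    fix e :: real assume e: "0 < e" "e < 1 / 2"
    define s where "s t = (1 - t) / e" for t
    have s_eq: "s t = (- 1 / e) * t + 1 / e" for t
      by (simp add: s_def diff_divide_distrib)
    have ds: "(s has_real_derivative - 1 / e) (at t)" for t
      unfolding s_eq[abs_def] using e by (auto intro!: derivative_eq_intros)
    define F where "F t = (- 1 * t + 1) powr (\<alpha> + 1) * \<eta> (- 1 / e * t + 1 / e)" for t
    have F_eq: "F = (\<lambda>t. (1 - t) powr (\<alpha> + 1) * \<eta> (s t))"
      by (simp add: fun_eq_iff F_def s_eq)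
    \<comment> \<open>Two overlapping half-lines: a product of smooth factors for t < 1, and 0 for t
      > 1 - e, where the cutoff vanishes before the power becomes singular.\<close>
    have F: "real_cont_diff k UNIV F" for k
    proof -
      have "real_cont_diff k {..<1} F"
        unfolding F_def[abs_def]
        by (intro real_cont_diff_mult real_cont_diff_affine[OF real_cont_diff_powr] real_cont_diff_affine[OF smooth]) auto
      moreover have "real_cont_diff k {1 - e<..} F"
      proof (rule real_cont_diff_cong[OF _ _ real_cont_diff_const[of k _ 0]])
        fix t assume "t \<in> {1 - e<..}"
        then have "s t \<le> 1"
          using e by (simp add: s_def divide_le_eq)
        then show "0 = F t"
          using \<eta>0[of "s t"] unfolding s_eq by (simp add: F_def)
      qed simp
      ultimately have "real_cont_diff k ({..<1} \<union> {1 - e<..}) F"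
        by (intro real_cont_diff_Un) auto
      also have "{..<1} \<union> {1 - e<..} = UNIV"
        using e by auto
      finally show ?thesis .
    qed
    define \<phi> where "\<phi> z = of_real (F ((norm z)\<^sup>2)) * (z ^ a * cnj z ^ b)" for z
    have test: "test_function \<phi>"
      unfolding test_function_def
    proof
      show "\<forall>k. times_cont_diff k \<phi>"
        unfolding \<phi>_def[abs_def]
        by (intro allI times_cont_diff_mult times_cont_diff_radial F times_cont_diff_power times_cont_diff_ident times_cont_diff_cnj)
      have "closure {z. \<phi> z \<noteq> 0} \<subseteq> {z. (norm z)\<^sup>2 \<le> 1 - e}"
      proof (rule closure_minimal)
        show "{z. \<phi> z \<noteq> 0} \<subseteq> {z. (norm z)\<^sup>2 \<le> 1 - e}"
        proof (intro subsetI, rule ccontr)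
          fix z assume z: "z \<in> {z. \<phi> z \<noteq> 0}" "z \<notin> {z. (norm z)\<^sup>2 \<le> 1 - e}"
          then have "s ((norm z)\<^sup>2) \<le> 1"
            using e by (simp add: s_def divide_le_eq)
          then have "F ((norm z)\<^sup>2) = 0"
            using \<eta>0[of "s ((norm z)\<^sup>2)"] unfolding s_eq by (simp add: F_def)
          then show False using z(1) by (simp add: \<phi>_def)
        qed
        show "closed {z :: complex. (norm z)\<^sup>2 \<le> 1 - e}"
          by (intro closed_Collect_le continuous_intros)
      qed
      also have "\<dots> \<subseteq> unit_disc"
      proof
        fix z :: complex assume "z \<in> {z. (norm z)\<^sup>2 \<le> 1 - e}"
        then have "(norm z)\<^sup>2 < 1" using e by simp
        then show "z \<in> unit_disc" by (simp add: power_less_one_iff abs_square_less_1)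
      qed
      finally show "closure {z. \<phi> z \<noteq> 0} \<subseteq> unit_disc" .
    qed
    \<comment> \<open>\<open>A\<close> and \<open>B\<close> are F' and F divided by (1 -
      t)^\<alpha>, which is the effect of the weight in \<open>L_bar\<close>; what is left of the
      power is at most a plain factor 1 - t.\<close>
    define A where "A t = - (\<alpha> + 1) * \<eta> (s t) - (1 - t) * (\<eta>' (s t) / e)" for t
    define A' where "A' t = (\<alpha> + 2) * (\<eta>' (s t) / e) + (1 - t) * (\<eta>'' (s t) / e\<^sup>2)" for t
    define B where "B t = (1 - t) * \<eta> (s t)" for t
    define B' where "B' t = - \<eta> (s t) - (1 - t) * (\<eta>' (s t) / e)" for t
    have d1: "((\<lambda>t. \<eta> (s t)) has_real_derivative - (\<eta>' (s t) / e)) (at t)" for t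
      using DERIV_chain2[OF d\<eta> ds] by simp
    have d2: "((\<lambda>t. \<eta>' (s t)) has_real_derivative - (\<eta>'' (s t) / e)) (at t)" for t
      using DERIV_chain2[OF d\<eta>' ds] by simp
    have dA: "(A has_real_derivative A' t) (at t)" for t
      unfolding A_def[abs_def] A'_def using e
      by (auto intro!: derivative_eq_intros d1 d2 simp: field_simps power2_eq_square)
    have dB: "(B has_real_derivative B' t) (at t)" for t
      unfolding B_def[abs_def] B'_def
      by (auto intro!: derivative_eq_intros d1)
    define Q where "Q z = of_real (A ((norm z)\<^sup>2)) * (z ^ (a + 1) * cnj z ^ b)
        + of_nat b * (of_real (B ((norm z)\<^sup>2)) * (z ^ a * cnj z ^ (b - 1)))" for z
    have wb: "of_real ((1 - (norm z)\<^sup>2) powr (- \<alpha>)) * wirtinger_bar \<phi> z = Q z" if z: "z \<in> unit_disc" for z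
    proof -
      define t where "t = (norm z)\<^sup>2"
      have t: "0 < 1 - t" using one_minus_norm_square_pos[OF z] by (simp add: t_def)
      have "((\<lambda>t. (1 - t) powr (\<alpha> + 1)) has_real_derivative (\<alpha> + 1) * (1 - t) powr (\<alpha> + 1 - 1) * - 1) (at t)"
        by (rule DERIV_chain2[where f="\<lambda>x. x powr (\<alpha> + 1)" and g="\<lambda>t. 1 - t", OF has_real_derivative_powr[OF t]]) (auto intro!: derivative_eq_intros)
      from DERIV_mult[OF this d1]
      have "(F has_real_derivative (\<alpha> + 1) * (1 - t) powr (\<alpha> + 1 - 1) * - 1 * \<eta> (s t)
          + - (\<eta>' (s t) / e) * (1 - t) powr (\<alpha> + 1)) (at t)"
        unfolding F_eq .
      moreover have pw: "(1 - t) powr (\<alpha> + 1) = (1 - t) powr \<alpha> * (1 - t)"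
        using t by (simp add: powr_add)
      have "(\<alpha> + 1) * (1 - t) powr (\<alpha> + 1 - 1) * - 1 * \<eta> (s t)
          + - (\<eta>' (s t) / e) * (1 - t) powr (\<alpha> + 1) = (1 - t) powr \<alpha> * A t"
      proof -
        have "(\<alpha> + 1) * x * - 1 * h + - k * (x * (1 - t)) = x * (- (\<alpha> + 1) * h - (1 - t) * k)" for x h k
          by (simp add: algebra_simps)
        then show ?thesis
          unfolding pw A_def add_diff_cancel_right' .
      qed
      ultimately have "(F has_real_derivative (1 - t) powr \<alpha> * A t) (at t)"
        by simp
      from has_wirtinger_mult[OF has_wirtinger_radial[OF this[unfolded t_def]]
          has_wirtinger_mult[OF has_wirtinger_power[OF has_wirtinger_ident, of a] has_wirtinger_power[OF has_wirtinger_cnj, of b]]]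
      have "wirtinger_bar \<phi> z = of_real (F t) * (z ^ a * (of_nat b * cnj z ^ (b - 1)))
          + of_real ((1 - t) powr \<alpha> * A t) * z * (z ^ a * cnj z ^ b)"
        unfolding \<phi>_def[abs_def] by (subst has_wirtinger_imp(2)) (auto simp: t_def)
      also have "F t = (1 - t) powr \<alpha> * B t"
        using t by (simp add: F_eq B_def powr_add)
      finally have "wirtinger_bar \<phi> z = of_real ((1 - t) powr \<alpha>) * Q z"
        by (simp add: Q_def t_def[symmetric] algebra_simps)
      moreover have "of_real ((1 - t) powr (- \<alpha>)) * (of_real ((1 - t) powr \<alpha>) * Q z) = Q z"
        using t by (simp add: powr_minus)
      ultimately show ?thesis
        by (simp add: t_def)
    qed
    have L: "L_bar \<alpha> \<phi> z - of_real (\<eta> (s ((norm z)\<^sup>2))) * P z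
        = of_real ((1 - (norm z)\<^sup>2) * (\<eta>' (s ((norm z)\<^sup>2)) / e) * real (a + 1 + b)) * (z ^ a * cnj z ^ b)
          - of_real (A' ((norm z)\<^sup>2)) * (z ^ (a + 1) * cnj z ^ (b + 1))" if z: "z \<in> unit_disc" for z
    proof -
      define t where "t = (norm z)\<^sup>2"
      have tz: "complex_of_real t = z * cnj z"
        using complex_norm_square[of z] by (simp add: t_def)
      let ?p = "of_real (A t) * (of_nat (a + 1) * z ^ a * cnj z ^ b) + of_real (A' t) * cnj z * (z ^ (a + 1) * cnj z ^ b)
          + of_nat b * (of_real (B t) * (of_nat a * z ^ (a - 1) * cnj z ^ (b - 1)) + of_real (B' t) * cnj z * (z ^ a * cnj z ^ (b - 1)))"
      obtain q where "has_wirtinger Q ?p q z"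
        using has_wirtinger_add[OF has_wirtinger_mult[OF has_wirtinger_radial[OF dA]
            has_wirtinger_mult[OF has_wirtinger_power[OF has_wirtinger_ident, of "a + 1"] has_wirtinger_power[OF has_wirtinger_cnj, of b]]]
          has_wirtinger_mult[OF has_wirtinger_const[of "of_nat b"] has_wirtinger_mult[OF has_wirtinger_radial[OF dB]
            has_wirtinger_mult[OF has_wirtinger_power[OF has_wirtinger_ident, of a] has_wirtinger_power[OF has_wirtinger_cnj, of "b - 1"]]]], of z]
        unfolding Q_def[abs_def] t_def by (simp add: algebra_simps)
      then have "(Q has_derivative (\<lambda>v. ?p * v + q * cnj v)) (at z)"
        by (simp only: has_wirtinger_def)
      then have "((\<lambda>z. of_real ((1 - (norm z)\<^sup>2) powr (- \<alpha>)) * wirtinger_bar \<phi> z) has_derivative (\<lambda>v. ?p * v + q * cnj v)) (at z)"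
        by (rule has_derivative_transform_within_open[OF _ open_ball z]) (simp only: wb)
      then have "has_wirtinger (\<lambda>z. of_real ((1 - (norm z)\<^sup>2) powr (- \<alpha>)) * wirtinger_bar \<phi> z) ?p q z"
        by (simp only: has_wirtinger_def)
      from has_wirtinger_imp(1)[OF this] have "L_bar \<alpha> \<phi> z = - ?p"
        unfolding L_bar_def by (simp only:)
      have b1: "of_nat b * (cnj z * cnj z ^ (b - 1)) = of_nat b * cnj z ^ b"
        by (cases b) auto
      define x y X where "x = z ^ a * cnj z ^ b" and "y = z ^ (a - 1) * cnj z ^ (b - 1)"
        and "X = z ^ (a + 1) * cnj z ^ (b + 1)"
      have e1: "?p = of_real (A t) * of_nat (a + 1) * x + of_real (A' t) * X + of_nat (a * b) * of_real (B t) * y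
          + of_real (B' t) * (of_nat b * x)"
      proof -
        have "of_nat b * (of_real (B' t) * cnj z * (z ^ a * cnj z ^ (b - 1))) = of_real (B' t) * (z ^ a * (of_nat b * (cnj z * cnj z ^ (b - 1))))"
          by (simp only: mult_ac)
        also have "\<dots> = of_real (B' t) * (of_nat b * x)"
          unfolding b1 by (simp add: x_def mult_ac)
        finally show ?thesis
          by (simp add: x_def y_def X_def algebra_simps)
      qed
      \<comment> \<open>Multiplication by |z|^2 = z cnj z raises both exponents by one; for a = 0 or
        b = 0 both sides are 0.\<close>
      have e2: "of_nat (a * b) * of_real t * y = of_nat (a * b) * x"
        unfolding tz x_def y_def by (cases a; cases b) (auto simp: algebra_simps)
      have e3: "of_nat (a * b) * of_real (B t) * y = of_real (\<eta> (s t)) * (of_nat (a * b) * y - of_nat (a * b) * x)"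
        unfolding e2[symmetric] by (simp add: B_def algebra_simps)
      have "- (of_real (- (\<alpha> + 1) * h - (1 - t) * k) * of_nat (a + 1) * x + W + of_real h * (n * y - n * x)
            + of_real (- h - (1 - t) * k) * (of_nat b * x))
          - of_real h * (of_real ((\<alpha> + 1 + real b) * real (a + 1)) * x - n * y)
          = of_real ((1 - t) * k * real (a + 1 + b)) * x - W"
        if "n = of_nat (a * b)" for h k :: real and W n :: complex
        unfolding that by (simp add: algebra_simps)
      from this[OF refl] show ?thesis
        unfolding \<open>L_bar \<alpha> \<phi> z = - ?p\<close> e1 e3 unfolding A_def B'_def P_def t_def[symmetric] x_def[symmetric] y_def[symmetric] X_def[symmetric] .
    qed
    have s1: "1 < s t \<longleftrightarrow> e < 1 - t" "s t < 2 \<longleftrightarrow> 1 - t < 2 * e" for t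
      using e by (auto simp: s_def less_divide_eq divide_less_eq)
    show "\<exists>\<phi> \<eta>. test_function \<phi> \<and> continuous_on UNIV \<eta> \<and> (\<forall>z. norm (\<eta> z) \<le> 1) \<and>
      (\<forall>z. (norm z)\<^sup>2 \<le> 1 - 2 * e \<longrightarrow> \<eta> z = 1) \<and>
      (\<forall>z\<in>unit_disc. norm (L_bar \<alpha> \<phi> z - \<eta> z * P z) \<le> K / e) \<and>
      (\<forall>z\<in>unit_disc. L_bar \<alpha> \<phi> z - \<eta> z * P z \<noteq> 0 \<longrightarrow> e < 1 - (norm z)\<^sup>2 \<and> 1 - (norm z)\<^sup>2 < 2 * e)"
    proof (rule exI[of _ \<phi>], rule exI[of _ "\<lambda>z. of_real (\<eta> (s ((norm z)\<^sup>2)))"], intro conjI test ballI allI impI)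
      have "continuous_on UNIV (\<lambda>t. \<eta> (s t))"
        by (rule DERIV_continuous_on[OF has_field_derivative_at_within[OF d1]])
      then have "continuous_on UNIV (\<lambda>z :: complex. \<eta> (s ((norm z)\<^sup>2)))"
        by (rule continuous_on_compose2) (auto intro!: continuous_intros)
      then show "continuous_on UNIV (\<lambda>z :: complex. complex_of_real (\<eta> (s ((norm z)\<^sup>2))))"
        by (rule continuous_on_of_real)
      show "norm (complex_of_real (\<eta> (s ((norm z)\<^sup>2)))) \<le> 1" for z :: complex
        using \<eta>le by simp
      show "complex_of_real (\<eta> (s ((norm z)\<^sup>2))) = 1" if "(norm z)\<^sup>2 \<le> 1 - 2 * e" for z :: complex
        using \<eta>1[of "s ((norm z)\<^sup>2)"] that s1(2)[of "(norm z)\<^sup>2"] by (simp add: not_less)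
    next
      fix z assume z: "z \<in> unit_disc"
      define t where "t = (norm z)\<^sup>2"
      have t: "0 < 1 - t" using one_minus_norm_square_pos[OF z] by (simp add: t_def)
      {
        assume nz: "L_bar \<alpha> \<phi> z - of_real (\<eta> (s ((norm z)\<^sup>2))) * P z \<noteq> 0"
        have "s t \<in> {1<..<2}"
        proof (rule ccontr)
          assume "s t \<notin> {1<..<2}"
          then have "\<eta>' (s t) = 0" "\<eta>'' (s t) = 0"
            by (rule z', rule z'')
          then have "L_bar \<alpha> \<phi> z - of_real (\<eta> (s ((norm z)\<^sup>2))) * P z = 0"
            unfolding L[OF z] unfolding t_def[symmetric] A'_def by simp
          then show False using nz by contradiction
        qed
        then show "e < 1 - (norm z)\<^sup>2" "1 - (norm z)\<^sup>2 < 2 * e"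
          using s1[of t] by (auto simp: t_def)
      }
      \<comment> \<open>Where a derivative of the cutoff does not vanish, 1 - t < 2 e; this gains
        the factor e that reduces 1 / e^2 to 1 / e.\<close>
      have small: "(1 - t) * \<bar>x\<bar> \<le> 2 * e * C" if "\<bar>x\<bar> \<le> C" "s t \<notin> {1<..<2} \<Longrightarrow> x = 0" for x
      proof (cases "s t \<in> {1<..<2}")
        case True
        then show ?thesis
          using s1[of t] that(1) C(1) t by (intro mult_mono) auto
      qed (use that(2) e C(1) in auto)
      have zp: "norm (z ^ i * cnj z ^ j) \<le> 1" for i j
        using z by (auto simp: norm_mult norm_power intro!: mult_le_one power_le_one)
      have 1: "norm (of_real ((1 - t) * (\<eta>' (s t) / e) * real (a + 1 + b)) * (z ^ a * cnj z ^ b))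
          \<le> (2 * e * C) / e * real (a + 1 + b) * 1"
      proof -
        have "norm (of_real ((1 - t) * (\<eta>' (s t) / e) * real (a + 1 + b)) * (z ^ a * cnj z ^ b))
            = ((1 - t) * \<bar>\<eta>' (s t)\<bar>) / e * real (a + 1 + b) * norm (z ^ a * cnj z ^ b)"
          using t e unfolding norm_mult[of "of_real _"] norm_of_real by (simp add: abs_mult)
        also have "\<dots> \<le> (2 * e * C) / e * real (a + 1 + b) * 1"
          by (rule mult_mono[OF mult_right_mono[OF divide_right_mono[OF small[OF C(2) z']]] zp]) (use e C in auto)
        finally show ?thesis .
      qed
      have 2: "norm (of_real (A' t) * (z ^ (a + 1) * cnj z ^ (b + 1))) \<le> (\<bar>\<alpha> + 2\<bar> * (C / e) + (2 * e * C) / e\<^sup>2) * 1"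
      proof -
        have "\<bar>A' t\<bar> \<le> \<bar>\<alpha> + 2\<bar> * (\<bar>\<eta>' (s t)\<bar> / e) + ((1 - t) * \<bar>\<eta>'' (s t)\<bar>) / e\<^sup>2"
          unfolding A'_def using t e by (intro order_trans[OF abs_triangle_ineq]) (simp add: abs_mult)
        also have "\<dots> \<le> \<bar>\<alpha> + 2\<bar> * (C / e) + (2 * e * C) / e\<^sup>2"
          by (rule add_mono[OF mult_left_mono[OF divide_right_mono[OF C(2)]] divide_right_mono[OF small[OF C(3) z'']]])
             (use e in auto)
        finally show ?thesis
          unfolding norm_mult[of "of_real (A' t)"] norm_of_real by (rule mult_mono[OF _ zp]) (use C e in auto)
      qed
      have "norm (L_bar \<alpha> \<phi> z - of_real (\<eta> (s t)) * P z)
          \<le> (2 * e * C) / e * real (a + 1 + b) * 1 + (\<bar>\<alpha> + 2\<bar> * (C / e) + (2 * e * C) / e\<^sup>2) * 1"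
        unfolding t_def L[OF z] unfolding t_def[symmetric]
        by (intro order_trans[OF norm_triangle_ineq4] add_mono 1 2)
      also have "\<dots> = (C * (\<bar>\<alpha> + 2\<bar> + 2) + C * (2 * real (a + 1 + b)) * e) / e"
        using e by (simp add: field_simps power2_eq_square)
      also have "\<dots> \<le> (C * (\<bar>\<alpha> + 2\<bar> + 2) + C * (2 * real (a + 1 + b)) * 1) / e"
        using e C by (intro divide_right_mono add_left_mono mult_left_mono) auto
      also have "\<dots> = K / e"
        by (simp add: K_def algebra_simps)
      finally show "norm (L_bar \<alpha> \<phi> z - of_real (\<eta> (s ((norm z)\<^sup>2))) * P z) \<le> K / e"
        by (simp add: t_def)
    qed
  qed
qed

section \<open>Moments determine an integrable function\<close>

lemma integrable_mult_continuous:
  fixes V f :: "complex \<Rightarrow> complex"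
  assumes V: "integrable lebesgue V" and zero: "\<And>z. z \<notin> unit_disc \<Longrightarrow> V z = 0" and f: "continuous_on UNIV f"
  shows "integrable lebesgue (\<lambda>z. V z * f z)"
proof -
  have "bounded (f ` cball 0 1)"
    by (intro compact_imp_bounded compact_continuous_image continuous_on_subset[OF f]) auto
  then obtain C where C: "\<And>z. z \<in> cball 0 1 \<Longrightarrow> norm (f z) \<le> C"
    unfolding bounded_pos by blast
  have fm: "f \<in> borel_measurable lebesgue"
    by (rule measurable_completion) (simp add: borel_measurable_continuous_onI f)
  have "integrable lebesgue (\<lambda>z. C * norm (V z))"
    by (intro integrable_mult_right integrable_norm V)
  then show ?thesis
  proof (rule Bochner_Integration.integrable_bound)
    show "(\<lambda>z. V z * f z) \<in> borel_measurable lebesgue"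
      by (intro borel_measurable_times borel_measurable_integrable[OF V] fm)
    show "AE z in lebesgue. norm (V z * f z) \<le> norm (C * norm (V z))"
    proof (rule AE_I2)
      fix z
      show "norm (V z * f z) \<le> norm (C * norm (V z))"
      proof (cases "z \<in> unit_disc")
        case True
        then have "norm (V z) * norm (f z) \<le> norm (V z) * \<bar>C\<bar>"
          using C[of z] by (intro mult_left_mono) auto
        then show ?thesis by (simp add: norm_mult abs_mult mult.commute)
      qed (simp add: zero)
    qed
  qed
qed

text \<open>Continuous functions decreasing to the indicator of a closed set extend the vanishing to
  closed sets. These are stable under intersection and generate the Borel sets; null sets lead on to
  Lebesgue sets, and a function whose integrals over all measurable sets vanish is 0 almost
  everywhere.\<close>

lemma AE_zero_of_continuous_integrals:
  fixes V :: "complex \<Rightarrow> complex"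
  assumes V: "integrable lebesgue V" and zero: "\<And>z. z \<notin> unit_disc \<Longrightarrow> V z = 0"
    and int: "\<And>g :: complex \<Rightarrow> real. continuous_on UNIV g \<Longrightarrow> (\<integral>z. V z * of_real (g z) \<partial>lebesgue) = 0"
  shows "AE z in lebesgue. V z = 0"
proof -
  have ind: "set_integrable lebesgue A V" if "A \<in> sets lebesgue" for A
    unfolding set_integrable_def by (rule integrable_mult_indicator[OF that V])
  have closed: "(LINT z:C|lebesgue. V z) = 0" if C: "closed C" for C
  \<comment> \<open>\<open>infdist\<close> to the empty set is 0 by convention, so there the
    approximation would yield 1 instead of the indicator.\<close>
  proof (cases "C = {}")
    case False
    define g where "g n z = max 0 (1 - real n * infdist z C)" for n z
    have g: "continuous_on UNIV (g n)" for n
      unfolding g_def[abs_def] by (intro continuous_intros)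
    have g01: "0 \<le> g n z" "g n z \<le> 1" for n z
      by (auto simp: g_def infdist_nonneg)
    have gm: "(\<lambda>z. complex_of_real (g n z)) \<in> borel_measurable lebesgue" for n
      by (rule measurable_completion) (simp add: borel_measurable_continuous_onI g continuous_on_of_real)
    have "(\<lambda>n. \<integral>z. V z * of_real (g n z) \<partial>lebesgue) \<longlonglongrightarrow> (\<integral>z. indicator C z *\<^sub>R V z \<partial>lebesgue)"
    proof (rule integral_dominated_convergence[where w="\<lambda>z. norm (V z)"])
      show "(\<lambda>z. indicator C z *\<^sub>R V z) \<in> borel_measurable lebesgue"
        using ind[of C] C by (auto simp: set_integrable_def)
      show "(\<lambda>z. V z * of_real (g n z)) \<in> borel_measurable lebesgue" for n
        by (intro borel_measurable_times borel_measurable_integrable[OF V] gm)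
      show "AE z in lebesgue. (\<lambda>n. V z * of_real (g n z)) \<longlonglongrightarrow> indicator C z *\<^sub>R V z"
      proof (rule AE_I2)
        fix z
        show "(\<lambda>n. V z * of_real (g n z)) \<longlonglongrightarrow> indicator C z *\<^sub>R V z"
        proof (cases "z \<in> C")
          case True
          then show ?thesis by (simp add: g_def)
        next
          case n: False
          then have d: "0 < infdist z C"
            using infdist_pos_not_in_closed[OF C False n] by simp
          obtain N :: nat where N: "1 / infdist z C < real N"
            using reals_Archimedean2 by blast
          have "g n z = 0" if "N \<le> n" for n
          proof -
            have "1 < real N * infdist z C"
              using N d by (simp add: divide_less_eq)
            also have "\<dots> \<le> real n * infdist z C"
              using that d by (intro mult_right_mono) auto
            finally show ?thesis by (simp add: g_def)
          qed
          then have "\<forall>\<^sub>F n in sequentially. 0 = V z * of_real (g n z)"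
            by (intro eventually_sequentiallyI[of N]) simp
          then have "(\<lambda>n. V z * of_real (g n z)) \<longlonglongrightarrow> 0"
            by (rule Lim_transform_eventually[OF tendsto_const])
          then show ?thesis using n by simp
        qed
      qed
      show "AE z in lebesgue. norm (V z * of_real (g n z)) \<le> norm (V z)" for n
        using g01[of n] by (intro AE_I2) (auto simp: norm_mult intro: mult_left_le)
    qed (intro integrable_norm V)
    then have "(\<lambda>n. 0) \<longlonglongrightarrow> (\<integral>z. indicator C z *\<^sub>R V z \<partial>lebesgue)"
      unfolding int[OF g] .
    then show ?thesis
      unfolding set_lebesgue_integral_def by (simp add: LIMSEQ_const_iff)
  qed (simp add: set_lebesgue_integral_def)
  have borel: "(LINT z:A|lebesgue. V z) = 0" if "A \<in> sets borel" for A :: "complex set"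
  proof -
    have sb: "sigma_sets UNIV (Collect closed) = sets (borel :: complex measure)"
      by (simp add: borel_eq_closed)
    have bl: "A \<in> sets lebesgue" if "A \<in> sigma_sets UNIV (Collect closed)" for A :: "complex set"
      using that unfolding sb by (simp add: sets_completionI_sets)
    have "Int_stable (Collect closed :: complex set set)" "Collect closed \<subseteq> Pow (UNIV :: complex set)"
      "A \<in> sigma_sets UNIV (Collect closed)"
      using that by (auto simp: Int_stable_def sb)
    then show ?thesis
    proof (induction rule: sigma_sets_induct_disjoint)
      case (basic A)
      then show ?case using closed by simp
    next
      case empty
      then show ?case by (simp add: set_lebesgue_integral_def)
    next
      case (compl A)
      note A = bl[OF compl(1)]
      have "(LINT z:UNIV|lebesgue. V z) = 0"
        by (rule closed) simp
      moreover have "(LINT z:A \<union> (UNIV - A)|lebesgue. V z) = (LINT z:A|lebesgue. V z) + (LINT z:UNIV - A|lebesgue. V z)"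
        using A by (intro set_integral_Un ind) auto
      moreover have "A \<union> (UNIV - A) = UNIV" by auto
      ultimately show ?case using compl by simp
    next
      case (union A)
      then have A: "A i \<in> sets lebesgue" for i
        by (intro bl) auto
      have "(LINT z:(\<Union>i. A i)|lebesgue. V z) = (\<Sum>i. (LINT z:A i|lebesgue. V z))"
        by (rule lebesgue_integral_countable_add) (use A union(1) ind in \<open>auto simp: disjoint_family_on_def\<close>)
      then show ?case using union by simp
    qed
  qed
  have "sigma_finite_measure (lebesgue :: complex measure)"
  proof
    obtain A :: "complex set set" where "countable A" "A \<subseteq> sets lborel" "\<Union> A = space lborel" "\<forall>a\<in>A. emeasure lborel a \<noteq> \<infinity>"
      using lborel.sigma_finite_countable by auto
    then show "\<exists>A :: complex set set. countable A \<and> A \<subseteq> sets lebesgue \<and> \<Union> A = space lebesgue \<and> (\<forall>a\<in>A. emeasure lebesgue a \<noteq> \<infinity>)"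
      by (intro exI[of _ A]) (auto simp: sets_completionI_sets)
  qed
  then show ?thesis
  proof (rule sigma_finite_measure.density_zero[OF _ V])
    fix A :: "complex set" assume A: "A \<in> sets lebesgue"
    then obtain S N N' where SN: "A = S \<union> N" "S \<in> sets lborel" "N' \<in> null_sets lborel" "N \<subseteq> N'"
      by (auto elim: sets_completionE)
    have S: "S \<in> sets lebesgue"
      using SN(2) by (rule sets_completionI_sets)
    have "AE z in lebesgue. z \<notin> N'"
      using AE_not_in[OF SN(3)] by (rule AE_completion)
    then have "(LINT z:A|lebesgue. V z) = (LINT z:S|lebesgue. V z)"
      unfolding set_lebesgue_integral_def
    proof (intro integral_cong_AE)
      show "(\<lambda>z. indicator A z *\<^sub>R V z) \<in> borel_measurable lebesgue" "(\<lambda>z. indicator S z *\<^sub>R V z) \<in> borel_measurable lebesgue"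
        using ind[OF A] ind[OF S] by (auto simp: set_integrable_def)
      show "AE z in lebesgue. indicator A z *\<^sub>R V z = indicator S z *\<^sub>R V z" if "AE z in lebesgue. z \<notin> N'"
        using that by eventually_elim (use SN in \<open>auto split: split_indicator\<close>)
    qed
    then show "(LINT z:A|lebesgue. V z) = 0"
      using borel[of S] SN(2) by simp
  qed
qed

lemma AE_zero_of_moments:
  fixes V :: "complex \<Rightarrow> complex"
  assumes V: "integrable lebesgue V" and zero: "\<And>z. z \<notin> unit_disc \<Longrightarrow> V z = 0"
    and mom: "\<And>a b. (\<integral>z. V z * (z ^ a * cnj z ^ b) \<partial>lebesgue) = 0"
  shows "AE z in lebesgue. V z = 0"
proof (rule AE_zero_of_continuous_integrals[OF V zero])
  \<comment> \<open>Vanishing against all monomials survives multiplication by z and cnj z, hence by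
    linear functions, and by induction with \<open>h\<close> arbitrary by every real polynomial. The
    integrals against two factors alone would say nothing about their product.\<close>
  define Z where "Z h \<longleftrightarrow> continuous_on UNIV h \<and> (\<forall>a b. (\<integral>z. V z * (h z * (z ^ a * cnj z ^ b)) \<partial>lebesgue) = 0)"
    for h :: "complex \<Rightarrow> complex"
  have int: "integrable lebesgue (\<lambda>z. V z * f z)" if "continuous_on UNIV f" for f
    by (rule integrable_mult_continuous[OF V zero that])
  have Z_lin: "Z (\<lambda>z. h z * (c * z + d * cnj z + k))" if h: "Z h" for h c d k
    unfolding Z_def
  proof (intro conjI allI)
    have ch: "continuous_on UNIV h"
      using h by (simp add: Z_def)
    then show "continuous_on UNIV (\<lambda>z. h z * (c * z + d * cnj z + k))"
      by (intro continuous_intros)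
    fix a b
    have m: "(\<integral>z. V z * (h z * (z ^ a * cnj z ^ b)) \<partial>lebesgue) = 0" for a b
      using h by (simp add: Z_def)
    have i: "integrable lebesgue (\<lambda>z. V z * (h z * (z ^ a * cnj z ^ b)))" for a b
      by (intro int continuous_intros ch)
    have "(\<integral>z. V z * (h z * (c * z + d * cnj z + k) * (z ^ a * cnj z ^ b)) \<partial>lebesgue)
        = (\<integral>z. c * (V z * (h z * (z ^ Suc a * cnj z ^ b))) + d * (V z * (h z * (z ^ a * cnj z ^ Suc b)))
            + k * (V z * (h z * (z ^ a * cnj z ^ b))) \<partial>lebesgue)"
      by (intro Bochner_Integration.integral_cong refl) (simp add: algebra_simps)
    also have "\<dots> = 0"
      using i[of "Suc a" b] i[of a "Suc b"] i[of a b] m[of "Suc a" b] m[of a "Suc b"] m[of a b]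
      by (simp del: power_Suc)
    finally show "(\<integral>z. V z * (h z * (c * z + d * cnj z + k) * (z ^ a * cnj z ^ b)) \<partial>lebesgue) = 0" .
  qed
  have Z_poly: "Z (\<lambda>z. h z * of_real (p z))" if "real_polynomial_function p" "Z h" for h and p :: "complex \<Rightarrow> real"
    using that
  proof (induction arbitrary: h rule: real_polynomial_function.induct)
    case (linear f)
    \<comment> \<open>Coefficients of a real-linear function written in z and cnj z instead of the
      real and imaginary parts.\<close>
    define c where "c = (of_real (f 1) - \<i> * of_real (f \<i>)) / 2"
    define d where "d = (of_real (f 1) + \<i> * of_real (f \<i>)) / 2"
    have "complex_of_real (f z) = c * z + d * cnj z + 0" for z
    proof -
      interpret bounded_linear f by (rule linear)
      have "z = Re z *\<^sub>R 1 + Im z *\<^sub>R \<i>"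
        by (simp add: complex_eq_iff)
      then have "f z = f (Re z *\<^sub>R 1 + Im z *\<^sub>R \<i>)"
        by simp
      also have "\<dots> = Re z * f 1 + Im z * f \<i>"
        unfolding add scaleR by simp
      finally show ?thesis
        by (simp add: c_def d_def complex_eq_iff field_simps)
    qed
    then show ?case
      using Z_lin[OF linear(2), of c d 0] by simp
  next
    case (const k)
    then show ?case
      using Z_lin[of h 0 0 "of_real k"] by simp
  next
    case (add f g)
    from add.IH(1)[OF add.prems] add.IH(2)[OF add.prems]
    have Zf: "Z (\<lambda>z. h z * of_real (f z))" and Zg: "Z (\<lambda>z. h z * of_real (g z))" .
    show ?case
      unfolding Z_def
    proof (intro conjI allI)
      have cf: "continuous_on UNIV (\<lambda>z. h z * of_real (f z))" "continuous_on UNIV (\<lambda>z. h z * of_real (g z))"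
        using Zf Zg by (auto simp: Z_def)
      then have "continuous_on UNIV (\<lambda>z. h z * of_real (f z) + h z * of_real (g z))"
        by (rule continuous_on_add)
      then show "continuous_on UNIV (\<lambda>z. h z * of_real (f z + g z))"
        by (simp add: distrib_left)
      fix a b
      have "(\<integral>z. V z * (h z * of_real (f z + g z) * (z ^ a * cnj z ^ b)) \<partial>lebesgue)
        = (\<integral>z. V z * (h z * of_real (f z) * (z ^ a * cnj z ^ b)) + V z * (h z * of_real (g z) * (z ^ a * cnj z ^ b)) \<partial>lebesgue)"
        by (intro Bochner_Integration.integral_cong refl) (simp add: algebra_simps)
      also have "\<dots> = (\<integral>z. V z * (h z * of_real (f z) * (z ^ a * cnj z ^ b)) \<partial>lebesgue)
          + (\<integral>z. V z * (h z * of_real (g z) * (z ^ a * cnj z ^ b)) \<partial>lebesgue)"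
        by (intro Bochner_Integration.integral_add int continuous_on_mult[OF cf(1)] continuous_on_mult[OF cf(2)] continuous_intros)
      also have "\<dots> = 0"
        using Zf Zg by (simp add: Z_def)
      finally show "(\<integral>z. V z * (h z * of_real (f z + g z) * (z ^ a * cnj z ^ b)) \<partial>lebesgue) = 0" .
    qed
  next
    case (mult f g)
    then have "Z (\<lambda>z. h z * of_real (f z) * of_real (g z))"
      by blast
    then show ?case
      by (simp add: mult.assoc)
  qed
  have Z1: "Z (\<lambda>_. 1)"
    using mom by (simp add: Z_def)
  fix g :: "complex \<Rightarrow> real" assume g: "continuous_on UNIV g"
  have "norm (\<integral>z. V z * of_real (g z) \<partial>lebesgue) \<le> e * (\<integral>z. norm (V z) \<partial>lebesgue)" if e: "0 < e" for e
  proof -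
    obtain p where p: "real_polynomial_function p" "\<And>z. z \<in> cball 0 1 \<Longrightarrow> \<bar>g z - p z\<bar> < e"
      using Stone_Weierstrass_real_polynomial_function[OF compact_cball continuous_on_subset[OF g] e] by blast
    have "Z (\<lambda>z. 1 * of_real (p z))"
      by (rule Z_poly[OF p(1) Z1])
    then have cp: "continuous_on UNIV (\<lambda>z. complex_of_real (p z))"
      and "(\<integral>z. V z * (of_real (p z) * (z ^ 0 * cnj z ^ 0)) \<partial>lebesgue) = 0"
      unfolding Z_def by (simp, auto simp del: power_0)
    then have p0: "(\<integral>z. V z * of_real (p z) \<partial>lebesgue) = 0"
      by simp
    have "(\<integral>z. V z * of_real (g z) \<partial>lebesgue) = (\<integral>z. V z * of_real (g z) - V z * of_real (p z) \<partial>lebesgue)"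
      by (subst Bochner_Integration.integral_diff) (auto intro!: int cp continuous_on_of_real g simp: p0)
    also have "norm \<dots> \<le> (\<integral>z. e * norm (V z) \<partial>lebesgue)"
    proof (rule Bochner_Integration.integral_norm_bound_integral)
      show "integrable lebesgue (\<lambda>z. V z * of_real (g z) - V z * of_real (p z))"
        by (intro Bochner_Integration.integrable_diff int cp continuous_on_of_real g)
      show "integrable lebesgue (\<lambda>z. e * norm (V z))"
        by (intro integrable_mult_right integrable_norm V)
      fix z
      show "norm (V z * of_real (g z) - V z * of_real (p z)) \<le> e * norm (V z)"
      proof (cases "z \<in> unit_disc")
        case True
        have "norm (V z * of_real (g z) - V z * of_real (p z)) = norm (V z) * \<bar>g z - p z\<bar>"
          by (metis norm_mult norm_of_real of_real_diff right_diff_distrib)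
        also have "\<dots> \<le> norm (V z) * e"
          using p(2)[of z] True by (intro mult_left_mono) auto
        finally show ?thesis by (simp add: mult.commute)
      qed (simp add: zero)
    qed
    finally show ?thesis by simp
  qed
  note le = this
  \<comment> \<open>Below e is divided by \<open>W + 1\<close> rather than \<open>W\<close>, since
    \<open>W\<close> may be 0.\<close>
  define W where "W = (\<integral>z. norm (V z) \<partial>lebesgue)"
  have W: "0 \<le> W"
    by (simp add: W_def)
  have "norm (\<integral>z. V z * of_real (g z) \<partial>lebesgue) \<le> 0 + e" if e: "0 < e" for e
  proof -
    have "norm (\<integral>z. V z * of_real (g z) \<partial>lebesgue) \<le> e / (W + 1) * W"
    proof -
      have "0 < e / (W + 1)" using e W by simp
      from le[OF this] show ?thesis unfolding W_def .
    qed
    also have "\<dots> \<le> e"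
      using e W by (simp add: field_simps)
    finally show ?thesis by simp
  qed
  then have "norm (\<integral>z. V z * of_real (g z) \<partial>lebesgue) \<le> 0"
    by (rule field_le_epsilon)
  then show "(\<integral>z. V z * of_real (g z) \<partial>lebesgue) = 0"
    by simp
qed

text \<open>Local integrability and the circle integrals near the boundary make v integrable over
  the whole disc, so that it has moments. The error of the cutoff is at most K / e times the
  integral of |v| over an annulus with r2^2 - r1^2 = e, that is at most K \<delta> / 2 once the
  circle integrals are below \<delta>, independently of e.\<close>

lemma homogeneous_solution_AE_0:
  fixes \<alpha> :: real and v :: "complex \<Rightarrow> complex"
  assumes \<alpha>: "-1 < \<alpha>" and L1: "L1_loc_disc v"
    and hom: "\<And>\<phi>. test_function \<phi> \<Longrightarrow> (LINT z:unit_disc|lebesgue. v z * L_bar \<alpha> \<phi> z) = 0"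
    and van: "vanishes_at_circle_L1 v"
  shows "AE z in lebesgue. z \<in> unit_disc \<longrightarrow> v z = 0"
proof -
  define V where "V z = indicator unit_disc z *\<^sub>R v z" for z
  have V0: "z \<notin> unit_disc \<Longrightarrow> V z = 0" for z
    by (simp add: V_def)
  have cb: "(\<lambda>z. indicator (cball 0 r) z *\<^sub>R v z) \<in> borel_measurable lebesgue"
      "(\<integral>\<^sup>+ z. ennreal (norm (v z)) * indicator (cball 0 r) z \<partial>lebesgue) < \<infinity>" if "r < 1" for r
  proof -
    have "cball 0 r \<subseteq> unit_disc"
      using that by auto
    then have "v absolutely_integrable_on cball 0 r"
      using L1 compact_cball unfolding L1_loc_disc_def by blast
    then have i: "integrable lebesgue (\<lambda>z. indicator (cball 0 r) z *\<^sub>R v z)"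
      by (simp add: set_integrable_def)
    then show "(\<lambda>z. indicator (cball 0 r) z *\<^sub>R v z) \<in> borel_measurable lebesgue"
      by (rule borel_measurable_integrable)
    have "(\<integral>\<^sup>+ z. ennreal (norm (v z)) * indicator (cball 0 r) z \<partial>lebesgue)
        = (\<integral>\<^sup>+ z. ennreal (norm (indicator (cball 0 r) z *\<^sub>R v z)) \<partial>lebesgue)"
      by (intro nn_integral_cong) (auto split: split_indicator)
    then show "(\<integral>\<^sup>+ z. ennreal (norm (v z)) * indicator (cball 0 r) z \<partial>lebesgue) < \<infinity>"
      using i by (simp add: integrable_iff_bounded)
  qed
  have Vm: "V \<in> borel_measurable lebesgue"
  proof (rule borel_measurable_LIMSEQ_metric)
    show "(\<lambda>z. indicator (cball 0 (1 - 1 / real (Suc n))) z *\<^sub>R v z) \<in> borel_measurable lebesgue" for n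
      by (rule cb(1)) simp
    show "(\<lambda>n. indicator (cball 0 (1 - 1 / real (Suc n))) z *\<^sub>R v z) \<longlonglongrightarrow> V z" for z
    proof (cases "z \<in> unit_disc")
      case True
      then have "0 < 1 - norm z" by simp
      then obtain N where N: "1 / real (Suc N) < 1 - norm z"
        using nat_approx_posE by blast
      have "V z = indicator (cball 0 (1 - 1 / real (Suc n))) z *\<^sub>R v z" if "N \<le> n" for n
      proof -
        have "1 / real (Suc n) \<le> 1 / real (Suc N)"
          using that by (intro divide_left_mono) auto
        then have "norm z \<le> 1 - 1 / real (Suc n)"
          using N by linarith
        then show ?thesis using True by (simp add: V_def)
      qed
      then have "\<forall>\<^sub>F n in sequentially. V z = indicator (cball 0 (1 - 1 / real (Suc n))) z *\<^sub>R v z"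
        by (intro eventually_sequentiallyI[of N])
      then show ?thesis
        by (rule Lim_transform_eventually[OF tendsto_const])
    next
      case False
      have "z \<notin> cball 0 (1 - 1 / real (Suc n))" for n
      proof
        assume "z \<in> cball 0 (1 - 1 / real (Suc n))"
        then have "norm z \<le> 1 - 1 / real (Suc n)" by simp
        also have "\<dots> < 1" by simp
        finally show False using False by simp
      qed
      then show ?thesis using False by (simp add: V_def)
    qed
  qed
  have circle: "\<exists>R. 0 \<le> R \<and> R < 1 \<and> (\<forall>r. R < r \<longrightarrow> r < 1 \<longrightarrow>
      (\<integral>\<^sup>+ t. ennreal (norm (v (of_real r * cis t))) * indicator {0..2 * pi} t \<partial>lebesgue) \<le> ennreal \<delta>)" if \<delta>: "0 < \<delta>" for \<delta>
  proof -
    have "\<forall>\<^sub>F r in at_left 1. (LINT t:{0..2 * pi}|lebesgue. norm (v (of_real r * cis t))) / (2 * pi) < \<delta> / (2 * pi)"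
      using van \<delta> unfolding vanishes_at_circle_L1_def by (intro order_tendstoD) auto
    moreover have "\<forall>\<^sub>F r in at_left 1. (\<lambda>t. v (of_real r * cis t)) absolutely_integrable_on {0..2 * pi}"
      using van unfolding vanishes_at_circle_L1_def by blast
    ultimately have "\<forall>\<^sub>F r in at_left (1::real).
        (\<integral>\<^sup>+ t. ennreal (norm (v (of_real r * cis t))) * indicator {0..2 * pi} t \<partial>lebesgue) \<le> ennreal \<delta>"
    proof eventually_elim
      case (elim r)
      let ?f = "\<lambda>t. indicator {0..2 * pi} t *\<^sub>R v (of_real r * cis t)"
      have i: "integrable lebesgue ?f"
        using elim(2) by (simp add: set_integrable_def)
      have "(\<integral>\<^sup>+ t. ennreal (norm (v (of_real r * cis t))) * indicator {0..2 * pi} t \<partial>lebesgue) = (\<integral>\<^sup>+ t. ennreal (norm (?f t)) \<partial>lebesgue)"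
        by (intro nn_integral_cong) (auto split: split_indicator)
      also have "\<dots> = ennreal (\<integral>t. norm (?f t) \<partial>lebesgue)"
        by (intro nn_integral_eq_integral integrable_norm i) auto
      also have "(\<integral>t. norm (?f t) \<partial>lebesgue) = (LINT t:{0..2 * pi}|lebesgue. norm (v (of_real r * cis t)))"
        by (simp add: set_lebesgue_integral_def)
      also have "\<dots> \<le> \<delta>"
        using elim(1) by (simp add: divide_less_cancel)
      finally show ?case by (simp add: ennreal_leI)
    qed
    then obtain b where b: "b < 1" "\<And>r. b < r \<Longrightarrow> r < 1 \<Longrightarrow>
        (\<integral>\<^sup>+ t. ennreal (norm (v (of_real r * cis t))) * indicator {0..2 * pi} t \<partial>lebesgue) \<le> ennreal \<delta>"
      using eventually_at_left[of 0 "1 :: real"] by auto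
    then show ?thesis
      by (intro exI[of _ "max 0 b"]) auto
  qed
  have meas: "(\<lambda>z. ennreal (norm (v z)) * indicator A z) \<in> borel_measurable lebesgue"
    if A: "A \<in> sets borel" "A \<subseteq> unit_disc" for A
  proof -
    have "(\<lambda>z. indicator A z :: ennreal) \<in> borel_measurable lebesgue"
      by (rule borel_measurable_indicator) (simp add: A sets_completionI_sets)
    from borel_measurable_times_ennreal[OF measurable_compose[OF measurable_compose[OF Vm borel_measurable_norm] measurable_ennreal] this]
    show ?thesis
      by (rule measurable_cong[THEN iffD1, rotated]) (use A(2) in \<open>auto simp: V_def split: split_indicator\<close>)
  qed
  have V: "integrable lebesgue V"
  proof (rule integrableI_bounded[OF Vm])
    obtain R where R: "0 \<le> R" "R < 1" and c: "\<And>r. R < r \<Longrightarrow> r < 1 \<Longrightarrow>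
        (\<integral>\<^sup>+ t. ennreal (norm (v (of_real r * cis t))) * indicator {0..2 * pi} t \<partial>lebesgue) \<le> ennreal 1"
      using circle[of 1] by auto
    \<comment> \<open>The disc is covered by a closed disc, on which v is integrable, and an
      overlapping annulus, on which the circle integrals are at most 1.\<close>
    define R' where "R' = (R + 1) / 2"
    have R': "R < R'" "R' < 1" using R by (auto simp: R'_def)
    define A where "A = {z :: complex. R < norm z \<and> norm z < 1}"
    have A: "A \<in> sets borel" "A \<subseteq> unit_disc"
      unfolding A_def by (measurable, auto)
    have "(\<integral>\<^sup>+ z. ennreal (norm (V z)) \<partial>lebesgue)
        \<le> (\<integral>\<^sup>+ z. ennreal (norm (v z)) * indicator (cball 0 R') z + ennreal (norm (v z)) * indicator A z \<partial>lebesgue)"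
      by (intro nn_integral_mono) (use R' in \<open>auto simp: V_def A_def split: split_indicator\<close>)
    also have "\<dots> = (\<integral>\<^sup>+ z. ennreal (norm (v z)) * indicator (cball 0 R') z \<partial>lebesgue)
        + (\<integral>\<^sup>+ z. ennreal (norm (v z)) * indicator A z \<partial>lebesgue)"
      by (intro nn_integral_add meas A) (use R' in auto)
    also have "\<dots> < \<infinity>"
    proof -
      have "(\<integral>\<^sup>+ z. ennreal (norm (v z)) * indicator A z \<partial>lebesgue) \<le> ennreal (1 / 2 * (1\<^sup>2 - R\<^sup>2))"
        unfolding A_def using R by (intro nn_integral_annulus_le Vm[unfolded V_def[abs_def]] c) auto
      then have "(\<integral>\<^sup>+ z. ennreal (norm (v z)) * indicator A z \<partial>lebesgue) < \<infinity>"
        by (rule le_less_trans) simp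
      then show ?thesis
        using cb(2)[OF R'(2)] by simp
    qed
    finally show "(\<integral>\<^sup>+ z. ennreal (norm (V z)) \<partial>lebesgue) < \<infinity>" .
  qed
  have int: "integrable lebesgue (\<lambda>z. V z * f z)" if "continuous_on UNIV f" for f
    by (rule integrable_mult_continuous[OF V _ that]) (rule V0)
  define P where "P a b z = of_real ((\<alpha> + 1 + real b) * real (a + 1)) * (z ^ a * cnj z ^ b)
      - of_nat (a * b) * (z ^ (a - 1) * cnj z ^ (b - 1))" for a b z
  have contP: "continuous_on UNIV (P a b)" for a b
    unfolding P_def[abs_def] by (intro continuous_intros)
  have P0: "(\<integral>z. V z * P a b z \<partial>lebesgue) = 0" for a b
  proof -
    obtain K where K: "0 \<le> K" and test: "\<And>e. 0 < e \<Longrightarrow> e < 1 / 2 \<Longrightarrow>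
      \<exists>\<phi> \<eta>. test_function \<phi> \<and> continuous_on UNIV \<eta> \<and> (\<forall>z. norm (\<eta> z) \<le> 1) \<and>
      (\<forall>z. (norm z)\<^sup>2 \<le> 1 - 2 * e \<longrightarrow> \<eta> z = 1) \<and>
      (\<forall>z\<in>unit_disc. norm (L_bar \<alpha> \<phi> z - \<eta> z * P a b z) \<le> K / e) \<and>
      (\<forall>z\<in>unit_disc. L_bar \<alpha> \<phi> z - \<eta> z * P a b z \<noteq> 0 \<longrightarrow> e < 1 - (norm z)\<^sup>2 \<and> 1 - (norm z)\<^sup>2 < 2 * e)"
      by (rule cutoff_test_function[of \<alpha> b a, folded P_def]) (rule that)
    \<comment> \<open>The shift by 3 keeps all members below 1/2.\<close>
    define e where "e n = 1 / real (n + 3)" for n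
    have e: "0 < e n" "e n < 1 / 2" for n
      by (auto simp: e_def)
    have e_lim: "e \<longlonglongrightarrow> 0"
      unfolding e_def using LIMSEQ_ignore_initial_segment[OF lim_1_over_n, of 3] by simp
    from test[OF e] obtain \<phi> \<eta> where
      test: "\<And>n. test_function (\<phi> n)" and c\<eta>: "\<And>n. continuous_on UNIV (\<eta> n)" and \<eta>1: "\<And>n z. norm (\<eta> n z) \<le> 1"
      and \<eta>: "\<And>n z. (norm z)\<^sup>2 \<le> 1 - 2 * e n \<Longrightarrow> \<eta> n z = 1"
      and E: "\<And>n z. z \<in> unit_disc \<Longrightarrow> norm (L_bar \<alpha> (\<phi> n) z - \<eta> n z * P a b z) \<le> K / e n"
      and supp: "\<And>n z. z \<in> unit_disc \<Longrightarrow> L_bar \<alpha> (\<phi> n) z - \<eta> n z * P a b z \<noteq> 0 \<Longrightarrow>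
        e n < 1 - (norm z)\<^sup>2 \<and> 1 - (norm z)\<^sup>2 < 2 * e n"
      by metis
    define I where "I n = (\<integral>z. V z * (\<eta> n z * P a b z) \<partial>lebesgue)" for n
    have lim: "I \<longlonglongrightarrow> (\<integral>z. V z * P a b z \<partial>lebesgue)"
      unfolding I_def
    proof (rule integral_dominated_convergence[where w="\<lambda>z. norm (V z * P a b z)"])
      show "AE z in lebesgue. (\<lambda>n. V z * (\<eta> n z * P a b z)) \<longlonglongrightarrow> V z * P a b z"
      proof (rule AE_I2)
        fix z
        show "(\<lambda>n. V z * (\<eta> n z * P a b z)) \<longlonglongrightarrow> V z * P a b z"
        proof (cases "z \<in> unit_disc")
          case True
          have "\<forall>\<^sub>F n in sequentially. e n < (1 - (norm z)\<^sup>2) / 2"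
            using one_minus_norm_square_pos[OF True] by (intro order_tendstoD[OF e_lim]) auto
          then have "\<forall>\<^sub>F n in sequentially. V z * P a b z = V z * (\<eta> n z * P a b z)"
          proof eventually_elim
            case (elim n)
            then have "\<eta> n z = 1" by (intro \<eta>) simp
            then show ?case by simp
          qed
          then show ?thesis
            by (rule Lim_transform_eventually[OF tendsto_const])
        qed (simp add: V0)
      qed
      show "AE z in lebesgue. norm (V z * (\<eta> n z * P a b z)) \<le> norm (V z * P a b z)" for n
        using \<eta>1[of n] by (intro AE_I2) (auto simp: norm_mult intro!: mult_left_mono mult_left_le_one_le)
    qed (auto intro!: borel_measurable_integrable integrable_norm int contP continuous_on_mult c\<eta>)
    have small: "norm (\<integral>z. V z * P a b z \<partial>lebesgue) \<le> K * (\<delta> / 2)" if \<delta>: "0 < \<delta>" for \<delta>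
    proof -
      obtain R where R: "0 \<le> R" "R < 1" and c: "\<And>r. R < r \<Longrightarrow> r < 1 \<Longrightarrow>
          (\<integral>\<^sup>+ t. ennreal (norm (v (of_real r * cis t))) * indicator {0..2 * pi} t \<partial>lebesgue) \<le> ennreal \<delta>"
        using circle[OF \<delta>] by auto
      have "R\<^sup>2 < 1" using R by (simp add: power_less_one_iff abs_square_less_1)
      then have "\<forall>\<^sub>F n in sequentially. e n < (1 - R\<^sup>2) / 2"
        by (intro order_tendstoD[OF e_lim]) auto
      then have "\<forall>\<^sub>F n in sequentially. norm (I n) \<le> K * (\<delta> / 2)"
      proof eventually_elim
        case (elim n)
        \<comment> \<open>These radii bound the support of the error, e < 1 - |z|^2 < 2 e; the bound
          on \<open>e n\<close> places the annulus beyond \<open>R\<close>.\<close>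
        define r1 r2 where "r1 = sqrt (1 - 2 * e n)" and "r2 = sqrt (1 - e n)"
        have rr: "r1\<^sup>2 = 1 - 2 * e n" "r2\<^sup>2 = 1 - e n"
          using e[of n] by (auto simp: r1_def r2_def)
        have r12: "0 \<le> r1" "r1 \<le> r2" "r2 \<le> 1" "R \<le> r1"
          using e[of n] elim R by (auto simp: r1_def r2_def real_le_rsqrt)
        define A where "A = {z :: complex. r1 < norm z \<and> norm z < r2}"
        have A: "A \<in> sets borel" "A \<subseteq> unit_disc"
          unfolding A_def using r12 by (measurable, auto)
        have "(LINT z:unit_disc|lebesgue. v z * L_bar \<alpha> (\<phi> n) z) = (\<integral>z. V z * L_bar \<alpha> (\<phi> n) z \<partial>lebesgue)"
          by (simp add: set_lebesgue_integral_def V_def)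
        then have L0: "(\<integral>z. V z * L_bar \<alpha> (\<phi> n) z \<partial>lebesgue) = 0"
          using hom[OF test] by simp
        have iL: "integrable lebesgue (\<lambda>z. V z * L_bar \<alpha> (\<phi> n) z)" "integrable lebesgue (\<lambda>z. V z * (\<eta> n z * P a b z))"
          by (rule int[OF continuous_on_L_bar[OF test]], rule int[OF continuous_on_mult[OF c\<eta> contP]])
        have "I n = - (\<integral>z. V z * L_bar \<alpha> (\<phi> n) z - V z * (\<eta> n z * P a b z) \<partial>lebesgue)"
          using Bochner_Integration.integral_diff[OF iL] L0 by (simp add: I_def)
        then have "ennreal (norm (I n)) = ennreal (norm (\<integral>z. V z * L_bar \<alpha> (\<phi> n) z - V z * (\<eta> n z * P a b z) \<partial>lebesgue))"
          by simp
        also have "\<dots> \<le> (\<integral>\<^sup>+ z. ennreal (norm (V z * L_bar \<alpha> (\<phi> n) z - V z * (\<eta> n z * P a b z))) \<partial>lebesgue)"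
          by (intro integral_norm_bound_ennreal Bochner_Integration.integrable_diff iL)
        also have "\<dots> \<le> (\<integral>\<^sup>+ z. ennreal (K / e n) * (ennreal (norm (v z)) * indicator A z) \<partial>lebesgue)"
        proof (intro nn_integral_mono)
          fix z
          define D where "D = L_bar \<alpha> (\<phi> n) z - \<eta> n z * P a b z"
          have eq: "V z * L_bar \<alpha> (\<phi> n) z - V z * (\<eta> n z * P a b z) = V z * D"
            by (simp add: D_def right_diff_distrib)
          show "ennreal (norm (V z * L_bar \<alpha> (\<phi> n) z - V z * (\<eta> n z * P a b z)))
              \<le> ennreal (K / e n) * (ennreal (norm (v z)) * indicator A z)"
          proof (cases "z \<in> unit_disc \<and> D \<noteq> 0")
            case True
            then have z: "z \<in> unit_disc" and "D \<noteq> 0" by auto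
            then have "e n < 1 - (norm z)\<^sup>2" "1 - (norm z)\<^sup>2 < 2 * e n"
              using supp[OF z] by (auto simp: D_def)
            then have "r1\<^sup>2 < (norm z)\<^sup>2" "(norm z)\<^sup>2 < r2\<^sup>2"
              using rr by auto
            then have "z \<in> A"
              using r12 by (auto simp: A_def intro: power2_less_imp_less)
            moreover have "norm (V z * D) \<le> K / e n * norm (v z)"
            proof -
              have "norm (V z * D) = norm D * norm (v z)"
                using z by (simp add: norm_mult V_def)
              also have "\<dots> \<le> K / e n * norm (v z)"
                using E[OF z, of n] unfolding D_def by (intro mult_right_mono) auto
              finally show ?thesis .
            qed
            ultimately show ?thesis
              unfolding eq using K e(1)[of n] by (simp add: ennreal_mult'[symmetric] ennreal_leI)
          next
            case False
            then have "V z * D = 0" by (auto simp: V_def)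
            then show ?thesis unfolding eq by (simp only: norm_zero ennreal_0 zero_le)
          qed
        qed
        also have "\<dots> = ennreal (K / e n) * (\<integral>\<^sup>+ z. ennreal (norm (v z)) * indicator A z \<partial>lebesgue)"
          by (intro nn_integral_cmult meas A)
        also have "\<dots> \<le> ennreal (K / e n) * ennreal (\<delta> / 2 * (r2\<^sup>2 - r1\<^sup>2))"
          unfolding A_def using r12 \<delta> by (intro mult_left_mono nn_integral_annulus_le Vm[unfolded V_def[abs_def]] c) auto
        also have "\<dots> = ennreal (K / e n * (\<delta> / 2 * e n))"
          using K e(1)[of n] unfolding rr by (subst ennreal_mult'[symmetric]) (auto simp: algebra_simps)
        also have "K / e n * (\<delta> / 2 * e n) = K * (\<delta> / 2)"
          using e(1)[of n] by simp
        finally show ?case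
          using K \<delta> by (simp add: ennreal_le_iff)
      qed
      then show ?thesis
        using tendsto_norm[OF lim] by (intro tendsto_upperbound) auto
    qed
    have "norm (\<integral>z. V z * P a b z \<partial>lebesgue) \<le> 0 + x" if x: "0 < x" for x
    proof -
      \<comment> \<open>The choice \<delta> = 2 x / (K + 1) gives K \<delta> / 2 \<le> x, also for K
        = 0.\<close>
      have "norm (\<integral>z. V z * P a b z \<partial>lebesgue) \<le> K * (2 * x / (K + 1) / 2)"
        using x K by (intro small) auto
      also have "\<dots> \<le> 0 + x"
        using x K by (simp add: field_simps)
      finally show ?thesis .
    qed
    then have "norm (\<integral>z. V z * P a b z \<partial>lebesgue) \<le> 0"
      by (rule field_le_epsilon)
    then show ?thesis by simp
  qed
  \<comment> \<open>For the moments m, \<open>P0\<close> reads (\<alpha> + 1 + b)(a + 1) m(a, b) = a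
    b m(a - 1, b - 1), and the left coefficient is nonzero because \<alpha> > -1. The induction on
    \<open>a\<close> treats all \<open>b\<close> at once, since b drops as well.\<close>
  have mom: "(\<integral>z. V z * (z ^ a * cnj z ^ b) \<partial>lebesgue) = 0" for a b
  proof (induction a arbitrary: b)
    case 0
    have "(\<integral>z. V z * P 0 b z \<partial>lebesgue) = (\<integral>z. of_real (\<alpha> + 1 + real b) * (V z * (z ^ 0 * cnj z ^ b)) \<partial>lebesgue)"
      by (intro Bochner_Integration.integral_cong refl) (simp add: P_def algebra_simps)
    also have "\<dots> = of_real (\<alpha> + 1 + real b) * (\<integral>z. V z * (z ^ 0 * cnj z ^ b) \<partial>lebesgue)"
      by (rule integral_mult_right_zero)
    finally have "of_real (\<alpha> + 1 + real b) * (\<integral>z. V z * (z ^ 0 * cnj z ^ b) \<partial>lebesgue) = 0"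
      using P0[of 0 b] by simp
    moreover have "complex_of_real (\<alpha> + 1 + real b) \<noteq> 0"
      using \<alpha> unfolding of_real_eq_0_iff by linarith
    ultimately show ?case
      by (metis mult_eq_0_iff)
  next
    case (Suc a)
    define c where "c = (\<alpha> + 1 + real b) * real (Suc a + 1)"
    define n where "n = Suc a * b"
    have i: "integrable lebesgue (\<lambda>z. V z * (z ^ a * cnj z ^ b))" for a b
      by (intro int continuous_intros)
    have "(\<integral>z. V z * P (Suc a) b z \<partial>lebesgue)
        = (\<integral>z. of_real c * (V z * (z ^ Suc a * cnj z ^ b)) - of_nat n * (V z * (z ^ a * cnj z ^ (b - 1))) \<partial>lebesgue)"
      by (intro Bochner_Integration.integral_cong refl)
         (simp only: P_def c_def n_def diff_Suc_1 right_diff_distrib mult_ac)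
    also have "\<dots> = of_real c * (\<integral>z. V z * (z ^ Suc a * cnj z ^ b) \<partial>lebesgue)
        - of_nat n * (\<integral>z. V z * (z ^ a * cnj z ^ (b - 1)) \<partial>lebesgue)"
      by (subst Bochner_Integration.integral_diff) (auto intro!: integrable_mult_right i simp del: power_Suc)
    finally have "of_real c * (\<integral>z. V z * (z ^ Suc a * cnj z ^ b) \<partial>lebesgue) = 0"
      using P0[of "Suc a" b] Suc[of "b - 1"] by simp
    moreover have "c \<noteq> 0"
      using \<alpha> by (auto simp: c_def)
    ultimately show ?case by simp
  qed
  have "AE z in lebesgue. V z = 0"
    by (rule AE_zero_of_moments[OF V V0 mom])
  then show ?thesis
    by eventually_elim (auto simp: V_def)
qed

section \<open>Reduction to the homogeneous equation\<close>

lemma L1_loc_integrable_L_bar: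
  assumes "L1_loc_disc u" "test_function \<phi>"
  shows "set_integrable lebesgue unit_disc (\<lambda>z. u z * L_bar \<alpha> \<phi> z)"
proof -
  obtain \<rho> where \<rho>: "\<rho> < 1" "\<And>z. \<rho> \<le> norm z \<Longrightarrow> L_bar \<alpha> \<phi> z = 0"
    using test_function_support[OF assms(2), of \<alpha>] by metis
  have "cball 0 \<rho> \<subseteq> unit_disc"
    using \<rho>(1) by auto
  then have "u absolutely_integrable_on cball 0 \<rho>"
    using assms(1) compact_cball unfolding L1_loc_disc_def by blast
  then have "integrable lebesgue (\<lambda>z. (indicator (cball 0 \<rho>) z *\<^sub>R u z) * L_bar \<alpha> \<phi> z)"
    using \<rho>(1) by (intro integrable_mult_continuous continuous_on_L_bar assms(2)) (auto simp: set_integrable_def)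
  also have "(\<lambda>z. (indicator (cball 0 \<rho>) z *\<^sub>R u z) * L_bar \<alpha> \<phi> z) = (\<lambda>z. indicator unit_disc z *\<^sub>R (u z * L_bar \<alpha> \<phi> z))"
    using \<rho> by (auto simp: fun_eq_iff split: split_indicator)
  finally show ?thesis
    by (simp add: set_integrable_def)
qed

lemma vanishes_at_circle_L1_diff:
  assumes u: "vanishes_at_circle_L1 u" and v: "vanishes_at_circle_L1 v"
  shows "vanishes_at_circle_L1 (\<lambda>z. u z - v z)"
proof -
  let ?I = "\<lambda>u r. (LINT t:{0..2 * pi}|lebesgue. norm (u (of_real r * cis t))) / (2 * pi)"
  have ev: "\<forall>\<^sub>F r in at_left 1. (\<lambda>t. u (of_real r * cis t)) absolutely_integrable_on {0..2 * pi} \<and>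
      (\<lambda>t. v (of_real r * cis t)) absolutely_integrable_on {0..2 * pi}"
    using u v unfolding vanishes_at_circle_L1_def by (auto intro: eventually_conj)
  then have diff: "\<forall>\<^sub>F r in at_left 1. (\<lambda>t. u (of_real r * cis t) - v (of_real r * cis t)) absolutely_integrable_on {0..2 * pi}"
    by eventually_elim (auto intro: set_integral_diff)
  moreover have "(?I (\<lambda>z. u z - v z) \<longlongrightarrow> 0) (at_left 1)"
  proof (rule tendsto_sandwich[OF _ _ tendsto_const])
    show "\<forall>\<^sub>F r in at_left 1. 0 \<le> ?I (\<lambda>z. u z - v z) r"
      by (intro always_eventually allI divide_nonneg_pos) (auto simp: set_lebesgue_integral_def)
    show "\<forall>\<^sub>F r in at_left 1. ?I (\<lambda>z. u z - v z) r \<le> ?I u r + ?I v r"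
      using ev
    proof eventually_elim
      case (elim r)
      then have i: "set_integrable lebesgue {0..2 * pi} (\<lambda>t. norm (u (of_real r * cis t)))"
        "set_integrable lebesgue {0..2 * pi} (\<lambda>t. norm (v (of_real r * cis t)))"
        "set_integrable lebesgue {0..2 * pi} (\<lambda>t. norm (u (of_real r * cis t) - v (of_real r * cis t)))"
        by (auto intro!: set_integrable_norm set_integral_diff)
      have "(LINT t:{0..2 * pi}|lebesgue. norm (u (of_real r * cis t) - v (of_real r * cis t)))
          \<le> (LINT t:{0..2 * pi}|lebesgue. norm (u (of_real r * cis t)) + norm (v (of_real r * cis t)))"
        by (intro set_integral_mono i set_integral_add norm_triangle_ineq4)
      also have "\<dots> = (LINT t:{0..2 * pi}|lebesgue. norm (u (of_real r * cis t))) + (LINT t:{0..2 * pi}|lebesgue. norm (v (of_real r * cis t)))"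
        by (intro set_integral_add i)
      finally show ?case
        by (simp add: add_divide_distrib[symmetric] divide_right_mono)
    qed
    show "((\<lambda>r. ?I u r + ?I v r) \<longlongrightarrow> 0) (at_left 1)"
      using u v tendsto_add[of "?I u" 0 "at_left 1" "?I v" 0] unfolding vanishes_at_circle_L1_def by simp
  qed
  ultimately show ?thesis
    unfolding vanishes_at_circle_L1_def by simp
qed

lemma solves_poisson_unique:
  assumes \<alpha>: "-1 < \<alpha>" and u: "solves_poisson \<alpha> M \<sigma> u" and v: "solves_poisson \<alpha> M \<sigma> v"
  shows "AE z in lebesgue. z \<in> unit_disc \<longrightarrow> u z = v z"
proof -
  have "AE z in lebesgue. z \<in> unit_disc \<longrightarrow> u z - v z = 0"
  proof (rule homogeneous_solution_AE_0[OF \<alpha>])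
    have L1: "L1_loc_disc u" "L1_loc_disc v"
      using u v by (auto simp: solves_poisson_def)
    then show "L1_loc_disc (\<lambda>z. u z - v z)"
      by (auto simp: L1_loc_disc_def intro: set_integral_diff)
    show "vanishes_at_circle_L1 (\<lambda>z. u z - v z)"
      using u v by (intro vanishes_at_circle_L1_diff) (auto simp: solves_poisson_def)
    fix \<phi> assume \<phi>: "test_function \<phi>"
    have "(LINT z:unit_disc|lebesgue. u z * L_bar \<alpha> \<phi> z) = (LINT z:unit_disc|lebesgue. v z * L_bar \<alpha> \<phi> z)"
    proof -
      have "distr_of_fun u (L_bar \<alpha> \<phi>) = distr_of_fun v (L_bar \<alpha> \<phi>)"
        using u v \<phi> by (simp add: solves_poisson_def distr_eq_def L_distr_def)
      then show ?thesis
        by (simp add: distr_of_fun_def)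
    qed
    moreover have "(LINT z:unit_disc|lebesgue. (u z - v z) * L_bar \<alpha> \<phi> z)
        = (LINT z:unit_disc|lebesgue. u z * L_bar \<alpha> \<phi> z) - (LINT z:unit_disc|lebesgue. v z * L_bar \<alpha> \<phi> z)"
      unfolding left_diff_distrib by (intro set_integral_diff L1_loc_integrable_L_bar L1 \<phi>)
    ultimately show "(LINT z:unit_disc|lebesgue. (u z - v z) * L_bar \<alpha> \<phi> z) = 0"
      by simp
  qed
  then show ?thesis
    by eventually_elim simp
qed

text \<open>\<open>green_potential\<close> has the dummy value 0 off its domain of convergence. The
  first two conjuncts ensure that this happens only on null sets, of the disc and of the circles
  near the boundary, so that the other two speak about the potential itself.\<close>

theorem theorem2:
  fixes \<alpha> :: real
    and M :: "complex measure"
    and \<sigma> :: "complex \<Rightarrow> complex"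
  assumes "\<alpha> > -1"
    and "complex_borel_measure M \<sigma>"
    and "(\<integral>\<^sup>+ w. ennreal ((1 - (norm w)\<^sup>2) powr (\<alpha> + 1)) \<partial>M) < \<infinity>"
  shows "(AE z in lebesgue. z \<in> unit_disc \<longrightarrow> green_potential_converges \<alpha> M z) \<and>
    (\<forall>\<^sub>F r in at_left 1. AE \<theta> in lebesgue. \<theta> \<in> {0..2 * pi} \<longrightarrow>
      green_potential_converges \<alpha> M (of_real r * cis \<theta>)) \<and>
    solves_poisson \<alpha> M \<sigma> (green_potential \<alpha> M \<sigma>) \<and>
    (\<forall>u. solves_poisson \<alpha> M \<sigma> u \<longrightarrow>
      (AE z in lebesgue. z \<in> unit_disc \<longrightarrow> u z = green_potential \<alpha> M \<sigma> z))"
proof (intro conjI allI impI)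
  show "AE z in lebesgue. z \<in> unit_disc \<longrightarrow> green_potential_converges \<alpha> M z"
    by (rule AE_completion[OF AE_converges[OF assms]])
  show "\<forall>\<^sub>F r in at_left 1. AE \<theta> in lebesgue. \<theta> \<in> {0..2 * pi} \<longrightarrow>
      green_potential_converges \<alpha> M (of_real r * cis \<theta>)"
    by (rule eventually_AE_circle_converges[OF assms])
  show sol: "solves_poisson \<alpha> M \<sigma> (green_potential \<alpha> M \<sigma>)"
    by (rule solves_poisson_green_potential[OF assms])
  show "AE z in lebesgue. z \<in> unit_disc \<longrightarrow> u z = green_potential \<alpha> M \<sigma> z"
    if "solves_poisson \<alpha> M \<sigma> u" for u
    by (rule solves_poisson_unique[OF assms(1) that sol])
qed

end
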